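(* Let $\mathbb{F}$ be an algebraically closed field and let $q\in\mathbb{F}$ be nonzero with $q^4\neq 1$. Assume $q$ is not a sixth root of unity (i.e. $q^6\neq 1$). Let $\Delta$ be the universal Askey-Wilson algebra and $L$ the Lie subalgebra of $\Delta$ generated by $A,B,C$. Then the standard Lie monomials of $L$ of length at most $5$, except the four elements $$[BA^2BC],\quad [[CB^2],[CA]],\quad [[CA^2],[CB]],\quad [[CAC],[CB]],$$ form a basis for $L_5$.
   Context: $\mathbb{F}\langle A,B,C\rangle$ is the free unital associative $\mathbb{F}$-algebra; every associative algebra is a Lie algebra with $[X,Y]=XY-YX$. Put $\alpha=(q+q^{-1})A+\frac{qBC-q^{-1}CB}{q-q^{-1}}$, $\beta=(q+q^{-1})B+\frac{qCA-q^{-1}AC}{q-q^{-1}}$, $\gamma=(q+q^{-1})C+\frac{qAB-q^{-1}BA}{q-q^{-1}}$. $\Delta$ is the quotient of $\mathbb{F}\langle A,B,C\rangle$ by the two-sided ideal generated by the nine commutators $[X,\delta]$, $X\in\{A,B,C\}$, $\delta\in\{\alpha,\beta,\gamma\}$. $\mathcal{L}$ is the free Lie algebra on $\{A,B,C\}$ (the Lie subalgebra of $\mathbb{F}\langle A,B,C\rangle$ generated by $A,B,C$). Its Hall basis is built with $A<B<C$: Lie monomials are ordered first by length, and $[X_1,Y_1],[X_2,Y_2]$ of the same length satisfy $[X_1,Y_1]<[X_2,Y_2]$ iff $Y_1<Y_2$, or $Y_1=Y_2$ and $X_1<X_2$. The letters are Hall elements, and for Hall elements $U,V$, $[U,V]$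 is a Hall element if $U>V$ and, in case $U=[X,Y]$, also $Y\le V$. For a word $X_1\cdots X_t$ let $[X_1\cdots X_t]=[[\cdots[[X_1,X_2],X_3],\cdots],X_t]$ (left-normed bracket). Explicitly, the Hall elements of length at most $5$ are: the letters $A,B,C$; for $2\le t\le 5$ the left-normed $[X_1X_2\cdots X_t]$ with letters satisfying $X_1>X_2\le X_3\le\cdots\le X_t$; in length $4$ additionally $[[CA],[BA]],[[CB],[BA]],[[CB],[CA]]$; in length $5$ additionally the $24$ elements $[T,S]$ with $T\in\{[BA^2],[CA^2],[BAB],[CAB],[CB^2],[BAC],[CAC],[CBC]\}$ and $S\in\{[BA],[CA],[CB]\}$. The standard Lie monomials of $L$ are the images of the Hall elements under the canonical map $\mathcal{L}\to L$, and $L_n$ is the span in $L$ of the standard Lie monomials of length at most $n$.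
   Formalization: The field F is additionally assumed to have characteristic different from 2; in characteristic 2 the claim fails for every q, since q^2([[BA^2],[CB]]+[[BAB],[CA]])+(q^4+q^2+1)[[BAC],[BA]]=0 is a relation among the claimed basis elements. *)

theory Defs
  imports
    "HOL-Library.Poly_Mapping"
    "HOL-Computational_Algebra.Computational_Algebra"
    "HOL-Algebra.QuotRing"
    "HOL-Algebra.Algebraic_Closure_Type"
    "Jordan_Normal_Form.Missing_VectorSpace"
begin

section \<open>The free associative algebra on three letters\<close>

datatype gen = gA | gB | gC

instantiation gen :: linorder
begin

fun gen_index :: "gen \<Rightarrow> nat" where
  "gen_index gA = 0"
| "gen_index gB = 1"
| "gen_index gC = 2"

definition "x \<le> y \<longleftrightarrow> gen_index x \<le> gen_index y" for x y :: gen
definition "x < y \<longleftrightarrow> gen_index x < gen_index y" for x y :: gen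

instance
proof
  fix x y :: gen
  show "x \<le> y \<Longrightarrow> y \<le> x \<Longrightarrow> x = y"
    by (cases x; cases y) (auto simp: less_eq_gen_def)
qed (auto simp: less_eq_gen_def less_gen_def)

end

text \<open>
  The free monoid, written additively so that the convolution product of finitely supported
  functions on it is the product of the free associative algebra.
\<close>

datatype 'x free_word = Word "'x list"

instantiation free_word :: (type) monoid_add
begin

definition zero_free_word :: "'a free_word" where
  "0 = Word []"

fun plus_free_word :: "'a free_word \<Rightarrow> 'a free_word \<Rightarrow> 'a free_word" where
  "Word u + Word v = Word (u @ v)"

instance
proof
  fix a b c :: "'a free_word"
  show "a + b + c = a + (b + c)" by (cases a; cases b; cases c) simp
  show "0 + a = a" "a + 0 = a" by (cases a; simp add: zero_free_word_def)+
qed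

end

type_synonym 'f free_alg = "gen free_word \<Rightarrow>\<^sub>0 'f"

definition letter :: "gen \<Rightarrow> 'f::field free_alg" where
  "letter x = Poly_Mapping.single (Word [x]) 1"

definition const :: "'f \<Rightarrow> 'f::field free_alg" where
  "const c = Poly_Mapping.single 0 c"


section \<open>The universal Askey-Wilson algebra\<close>

definition aw_alpha :: "'f::field \<Rightarrow> 'f free_alg" where
  "aw_alpha q = const (q + inverse q) * letter gA
     + const (inverse (q - inverse q))
       * (const q * letter gB * letter gC - const (inverse q) * letter gC * letter gB)"

definition aw_beta :: "'f::field \<Rightarrow> 'f free_alg" where
  "aw_beta q = const (q + inverse q) * letter gB
     + const (inverse (q - inverse q))
       * (const q * letter gC * letter gA - const (inverse q) * letter gA * letter gC)"

definition aw_gamma :: "'f::field \<Rightarrow> 'f free_alg" where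
  "aw_gamma q = const (q + inverse q) * letter gC
     + const (inverse (q - inverse q))
       * (const q * letter gA * letter gB - const (inverse q) * letter gB * letter gA)"

definition commutator :: "'a::ring \<Rightarrow> 'a \<Rightarrow> 'a" where
  "commutator x y = x * y - y * x"

text \<open>The library's ideals are two-sided.\<close>

definition aw_ideal :: "'f::field \<Rightarrow> 'f free_alg set" where
  "aw_ideal q = genideal ring_of_type_algebra
     {commutator (letter x) \<delta> | x \<delta>. \<delta> \<in> {aw_alpha q, aw_beta q, aw_gamma q}}"

definition aw_ring :: "'f::field \<Rightarrow> 'f free_alg set ring" where
  "aw_ring q = ring_of_type_algebra Quot aw_ideal q"

definition aw_proj :: "'f::field \<Rightarrow> 'f free_alg \<Rightarrow> 'f free_alg set" where
  "aw_proj q p = aw_ideal q +>\<^bsub>ring_of_type_algebra\<^esub> p"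

text \<open>The quotient ring as an algebra over the field \<open>'f\<close>.\<close>

definition aw_algebra :: "'f::field \<Rightarrow> ('f, 'f free_alg set) module" where
  "aw_algebra q = ring.extend (aw_ring q)
     (module.fields (\<lambda>c x. aw_proj q (const c) \<otimes>\<^bsub>aw_ring q\<^esub> x))"


section \<open>Lie subalgebras of an associative algebra\<close>

definition lie_subalgebra :: "'k ring \<Rightarrow> ('k, 'a) module \<Rightarrow> 'a set \<Rightarrow> bool" where
  "lie_subalgebra K M H \<longleftrightarrow> VectorSpace.subspace K H M \<and>
     (\<forall>x\<in>H. \<forall>y\<in>H. (x \<otimes>\<^bsub>M\<^esub> y) \<ominus>\<^bsub>M\<^esub> (y \<otimes>\<^bsub>M\<^esub> x) \<in> H)"

definition lie_generated :: "'k ring \<Rightarrow> ('k, 'a) module \<Rightarrow> 'a set \<Rightarrow> 'a set" where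
  "lie_generated K M S = \<Inter> {H. lie_subalgebra K M H \<and> S \<subseteq> H}"

text \<open>
  The Lie algebra \<open>L\<close>, carrying the vector space operations of the Askey-Wilson algebra. The
  multiplicative fields of the record are those of the ambient algebra, under which the carrier
  need not be closed.
\<close>

definition aw_lie :: "'f::field \<Rightarrow> ('f, 'f free_alg set) module" where
  "aw_lie q = (aw_algebra q)
     \<lparr>carrier := lie_generated ring_of_type_algebra (aw_algebra q) (range (aw_proj q \<circ> letter))\<rparr>"


section \<open>Hall elements and standard Lie monomials\<close>

text \<open>
  Lie monomials are formal bracketings, so that the factors of a bracket are well defined; they
  are turned into elements of the free Lie algebra by \<open>lie_eval\<close> below.
\<close>

datatype 'x lie_monomial = Letter 'x | Bracket "'x lie_monomial" "'x lie_monomial"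

fun lie_length :: "'x lie_monomial \<Rightarrow> nat" where
  "lie_length (Letter x) = 1"
| "lie_length (Bracket U V) = lie_length U + lie_length V"

text \<open>A bracket is longer than any letter, whence the second and third equation.\<close>

fun lie_less :: "'x::linorder lie_monomial \<Rightarrow> 'x lie_monomial \<Rightarrow> bool" where
  "lie_less (Letter x) (Letter y) \<longleftrightarrow> x < y"
| "lie_less (Letter x) (Bracket X2 Y2) \<longleftrightarrow> True"
| "lie_less (Bracket X1 Y1) (Letter y) \<longleftrightarrow> False"
| "lie_less (Bracket X1 Y1) (Bracket X2 Y2) \<longleftrightarrow>
     lie_length (Bracket X1 Y1) < lie_length (Bracket X2 Y2) \<or>
     lie_length (Bracket X1 Y1) = lie_length (Bracket X2 Y2) \<and>
       (lie_less Y1 Y2 \<or> Y1 = Y2 \<and> lie_less X1 X2)"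

fun hall :: "'x::linorder lie_monomial \<Rightarrow> bool" where
  "hall (Letter x) \<longleftrightarrow> True"
| "hall (Bracket U V) \<longleftrightarrow> hall U \<and> hall V \<and> lie_less V U \<and>
     (case U of Letter _ \<Rightarrow> True | Bracket U1 U2 \<Rightarrow> U2 = V \<or> lie_less U2 V)"

text \<open>The left-normed bracket of a nonempty word.\<close>

definition left_normed :: "'x list \<Rightarrow> 'x lie_monomial" where
  "left_normed w = foldl (\<lambda>U x. Bracket U (Letter x)) (Letter (hd w)) (tl w)"

fun lie_eval :: "gen lie_monomial \<Rightarrow> 'f::field free_alg" where
  "lie_eval (Letter x) = letter x"
| "lie_eval (Bracket U V) = commutator (lie_eval U) (lie_eval V)"

definition std_monomial :: "'f::field \<Rightarrow> gen lie_monomial \<Rightarrow> 'f free_alg set" where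
  "std_monomial q t = aw_proj q (lie_eval t)"

text \<open>
  In characteristic 2 the standard Lie monomials satisfy
  \<open>(q^2 + 1 + q^(-2)) [[BAC],[BA]] + [[BAB],[CA]] + [[BAA],[CB]] = 0\<close>; the family shown to be a basis
  contains all three terms, so characteristic 2 has to be excluded.
\<close>

definition aw_lie_upto :: "'f::field \<Rightarrow> nat \<Rightarrow> 'f free_alg set set" where
  "aw_lie_upto q n = LinearCombinations.module.span ring_of_type_algebra (aw_lie q)
     (std_monomial q ` {t. hall t \<and> lie_length t \<le> n})"

text \<open>
  A basis given as an indexed family: different indices give different vectors, and these vectors
  are a basis.
\<close>

definition basis_family ::
    "'k ring \<Rightarrow> ('k, 'a) module \<Rightarrow> ('i \<Rightarrow> 'a) \<Rightarrow> 'i set \<Rightarrow> bool" where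
  "basis_family K V v I \<longleftrightarrow> inj_on v I \<and> vectorspace.basis K V (v ` I)"

end

theory Submission
  imports Defs
begin

text \<open>
  Write \<open>s = q^2\<close>, \<open>l = q^3 - 1/q\<close> and let \<open>a, b, c\<close> be \<open>q^2 - 1\<close> times \<open>\<alpha>, \<beta>, \<gamma>\<close>. The defining relations
  become \<open>BA = sAB + lC - c\<close>, \<open>CB = sBC + lA - a\<close>, \<open>AC = sCA + lB - b\<close> with \<open>a, b, c\<close> central, and
  dualizing the expected basis \<open>A^i B^j C^k a^x b^y c^z\<close> gives a right action of \<open>\<Delta>\<close> on functions of
  the six exponents.

  Give \<open>a, b, c\<close> the multidegrees of \<open>BC, CA, AB\<close>. The terms with the factor \<open>l\<close> have lower degree,
  so a linear relation between Hall elements of length at most \<open>n\<close> restricts, in every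
  multidegree of total degree \<open>n\<close>, to a relation between leading terms, which are computed with
  \<open>l = 0\<close>. In degree 5 this kills all coefficients but those of multiples of
  \<open>[[BAA],[CA]] - [[CAA],[BA]]\<close> and \<open>[[BAB],[CB]] - [[CBB],[BA]]\<close>. These two elements are equal to
  \<open>l (1 - 1/s) ([BA]^2 - [CA]^2)\<close> and \<open>l (1 - 1/s) ([CB]^2 - [BA]^2)\<close>, hence have degree 4, and in
  multidegrees \<open>(2,2,0)\<close> and \<open>(2,0,2)\<close> the leading term of a square is not a multiple of that of the
  only Hall element. So these coefficients vanish too, and lengths 4, 3, 2, 1 follow in turn.

  For the spanning property, each of the four omitted elements, multiplied by \<open>2 (s + 1)^2\<close>,
  \<open>s\<close>, \<open>s\<close> or \<open>1\<close>, is an explicit combination of the others.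
\<close>

section \<open>The action dual to the PBW basis\<close>

text \<open>The action on functions replaces a normal form theorem: the functions of six exponents
  are a vector space at no cost, and independence in \<open>\<Delta>\<close> follows once the three
  relations hold for the operators. Two of them are the recursion itself; the third is the overlap
  CBA, settled by an induction on the exponent of A. Only the functionals sending p to the value of
  f . p at exponent zero are used afterwards, and these vanish on the ideal. The obstacle is that
  leading terms do not settle degree 5: the brackets [[[BA],[CA]],A], [[[BA],[CB]],B] and
  [[[CA],[CB]],C] drop to degree 4. Their values, multiples of differences of squares, add up to
  zero; this sum is the relation that removes [[CAC],[CB]], and two of the three remain as a
  correction term when degree 4 is examined. The hypothesis on q^4 gives s \<noteq> 1, which cancels
  common powers of s - 1, then s \<noteq> -1, and l \<noteq> 0, without which the squares would be
  invisible. The factor 2 (s + 1)^2 is what elimination leaves in multidegree (2,2,1).\<close>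

text \<open>\<open>f i j k a b c\<close> is the value of a functional at \<open>A^i B^j C^k a^a b^b c^c\<close>.\<close>

type_synonym 'f coord_fun = "nat \<Rightarrow> nat \<Rightarrow> nat \<Rightarrow> nat \<Rightarrow> nat \<Rightarrow> nat \<Rightarrow> 'f"

section \<open>Bounded recursion for the operators of B and C\<close>

locale aw_parameter =
  fixes s t :: "'f::field"
  assumes st: "s * t = 1"
begin

lemma s_t: "s * (t * x) = x"
  using st by (simp flip: mult.assoc)

text \<open>
  The value of \<open>f \<cdot> B\<close> or \<open>f \<cdot> C\<close> at a monomial \<open>m\<close> is that of \<open>f\<close> at \<open>B m\<close> or \<open>C m\<close>, reordered.
  The argument \<open>n\<close> bounds the recursion depth; \<open>i + j + k\<close> suffices (\<open>fuel_stable\<close>).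
\<close>

fun act_B_fuel and act_C_fuel
  :: "'f \<Rightarrow> nat \<Rightarrow> 'f coord_fun \<Rightarrow> 'f coord_fun" where
  "act_B_fuel l n f 0 j k a b c = f 0 (Suc j) k a b c"
| "act_B_fuel l 0 f (Suc i) j k a b c = 0"
| "act_B_fuel l (Suc n) f (Suc i) j k a b c =
     s * act_B_fuel l n (\<lambda>i. f (Suc i)) i j k a b c + l * act_C_fuel l n f i j k a b c - f i j k a b (Suc c)"
| "act_C_fuel l n f 0 0 k a b c = f 0 0 (Suc k) a b c"
| "act_C_fuel l 0 f 0 (Suc j) k a b c = 0"
| "act_C_fuel l 0 f (Suc i) j k a b c = 0"
| "act_C_fuel l (Suc n) f 0 (Suc j) k a b c =
     s * act_C_fuel l n (\<lambda>i j k a b c. act_B_fuel l (Suc n) f i j k a b c) 0 j k a b c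
       + l * f 1 j k a b c - f 0 j k (Suc a) b c"
| "act_C_fuel l (Suc n) f (Suc i) j k a b c =
     t * (act_C_fuel l n (\<lambda>i. f (Suc i)) i j k a b c - l * act_B_fuel l n f i j k a b c + f i j k a (Suc b) c)"

text \<open>This is the common shape of the right-hand sides of the three relations: two ordinary
  summands, and one read after multiplication by a^x b^y c^z. Compatibility with it expresses
  linearity and the centrality of a, b, c at once.\<close>

definition fun_comb
  :: "'f \<Rightarrow> 'f coord_fun \<Rightarrow> 'f \<Rightarrow> 'f coord_fun \<Rightarrow> 'f \<Rightarrow> 'f coord_fun \<Rightarrow> nat \<Rightarrow> nat \<Rightarrow> nat \<Rightarrow> 'f coord_fun" where
  "fun_comb u f v g w h x y z i j k a b c =
     u * f i j k a b c + v * g i j k a b c + w * h i j k (a + x) (b + y) (c + z)"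

lemma fun_comb_Suc:
  "(\<lambda>i. fun_comb u f v g w h x y z (Suc i)) =
     fun_comb u (\<lambda>i. f (Suc i)) v (\<lambda>i. g (Suc i)) w (\<lambda>i. h (Suc i)) x y z"
  by (intro ext) (simp add: fun_comb_def)

lemma fuel_linear:
  "act_B_fuel l n (fun_comb u f v g w h x y z) =
     fun_comb u (act_B_fuel l n f) v (act_B_fuel l n g) w (act_B_fuel l n h) x y z"
  "act_C_fuel l n (fun_comb u f v g w h x y z) =
     fun_comb u (act_C_fuel l n f) v (act_C_fuel l n g) w (act_C_fuel l n h) x y z"
proof -
  define linear where "linear F \<longleftrightarrow> (\<forall>f g h. F (fun_comb u f v g w h x y z) = fun_comb u (F f) v (F g) w (F h) x y z)"
    for F :: "'f coord_fun \<Rightarrow> 'f coord_fun"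
  have linearD: "F (fun_comb u f v g w h x y z) = fun_comb u (F f) v (F g) w (F h) x y z" if "linear F" for F f g h
    using that unfolding linear_def by blast
  have B0: "linear (act_B_fuel l 0)"
    unfolding linear_def
  proof (intro allI ext)
    fix f g h i j k a b c
    show "act_B_fuel l 0 (fun_comb u f v g w h x y z) i j k a b c =
        fun_comb u (act_B_fuel l 0 f) v (act_B_fuel l 0 g) w (act_B_fuel l 0 h) x y z i j k a b c"
      by (cases i) (simp_all add: fun_comb_def)
  qed
  have C0: "linear (act_C_fuel l 0)"
    unfolding linear_def
  proof (intro allI ext)
    fix f g h i j k a b c
    show "act_C_fuel l 0 (fun_comb u f v g w h x y z) i j k a b c =
        fun_comb u (act_C_fuel l 0 f) v (act_C_fuel l 0 g) w (act_C_fuel l 0 h) x y z i j k a b c"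
      by (cases i; cases j) (simp_all add: fun_comb_def)
  qed
  \<comment> \<open>The case of B comes first, since the operator of C with bound
    \<open>Suc n\<close> calls that of B with the same bound.\<close>
  have B_Suc: "linear (act_B_fuel l (Suc n))" if "linear (act_B_fuel l n)" "linear (act_C_fuel l n)" for n
    unfolding linear_def
  proof (intro allI ext)
    fix f g h i j k a b c
    show "act_B_fuel l (Suc n) (fun_comb u f v g w h x y z) i j k a b c =
        fun_comb u (act_B_fuel l (Suc n) f) v (act_B_fuel l (Suc n) g) w (act_B_fuel l (Suc n) h) x y z i j k a b c"
      by (cases i) (simp_all add: fun_comb_Suc that[THEN linearD], simp_all add: fun_comb_def algebra_simps)
  qed
  have C_Suc: "linear (act_C_fuel l (Suc n))" if "linear (act_B_fuel l n)" "linear (act_C_fuel l n)" for n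
    unfolding linear_def
  proof (intro allI ext)
    fix f g h i j k a b c
    show "act_C_fuel l (Suc n) (fun_comb u f v g w h x y z) i j k a b c =
        fun_comb u (act_C_fuel l (Suc n) f) v (act_C_fuel l (Suc n) g) w (act_C_fuel l (Suc n) h) x y z i j k a b c"
      by (cases i; cases j)
        (simp_all add: fun_comb_Suc that[THEN linearD] linearD[OF B_Suc[OF that]], simp_all add: fun_comb_def algebra_simps)
  qed
  have "linear (act_B_fuel l n) \<and> linear (act_C_fuel l n)"
    by (induction n) (simp_all add: B0 C0 B_Suc C_Suc)
  then show "act_B_fuel l n (fun_comb u f v g w h x y z) =
     fun_comb u (act_B_fuel l n f) v (act_B_fuel l n g) w (act_B_fuel l n h) x y z"
    "act_C_fuel l n (fun_comb u f v g w h x y z) =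
     fun_comb u (act_C_fuel l n f) v (act_C_fuel l n g) w (act_C_fuel l n h) x y z"
    by (blast intro: linearD)+
qed

text \<open>The recursion for C passes the whole function f . B as an argument. To compare two such
  arguments it must be known at which points they are read: one letter raises the total exponent by
  at most one.\<close>

lemma fuel_local:
  assumes "\<And>i' j' k' a b c. i' + j' + k' \<le> Suc (i + j + k) \<Longrightarrow> f i' j' k' a b c = g i' j' k' a b c"
  shows "act_B_fuel l n f i j k a b c = act_B_fuel l n g i j k a b c"
    "act_C_fuel l n f i j k a b c = act_C_fuel l n g i j k a b c"
  using assms
proof (induction n arbitrary: f g i j k a b c)
  case 0
  { case 1 then show ?case by (cases i) auto }
  { case 2 then show ?case by (cases i; cases j) auto }
next
  case (Suc n)
  have B: "act_B_fuel l (Suc n) f i j k a b c = act_B_fuel l (Suc n) g i j k a b c"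
    if "\<And>i' j' k' a b c. i' + j' + k' \<le> Suc (i + j + k) \<Longrightarrow> f i' j' k' a b c = g i' j' k' a b c"
    for f g i j k a b c
  proof (cases i)
    case (Suc i0)
    have "act_B_fuel l n (\<lambda>i. f (Suc i)) i0 j k a b c = act_B_fuel l n (\<lambda>i. g (Suc i)) i0 j k a b c"
      by (rule Suc.IH(1)) (simp add: that Suc)
    moreover have "act_C_fuel l n f i0 j k a b c = act_C_fuel l n g i0 j k a b c"
      by (rule Suc.IH(2)) (simp add: that Suc)
    ultimately show ?thesis using Suc by (simp add: that)
  qed (simp add: that)
  { case 1 then show ?case by (rule B) }
  { case 2 show ?case
    proof (cases i)
      case (Suc i0)
      have "act_C_fuel l n (\<lambda>i. f (Suc i)) i0 j k a b c = act_C_fuel l n (\<lambda>i. g (Suc i)) i0 j k a b c"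
        by (rule Suc.IH(2)) (simp add: 2 Suc)
      moreover have "act_B_fuel l n f i0 j k a b c = act_B_fuel l n g i0 j k a b c"
        by (rule Suc.IH(1)) (simp add: 2 Suc)
      ultimately show ?thesis using Suc by (simp add: 2)
    next
      case 0
      show ?thesis
      proof (cases j)
        case (Suc j0)
        have "act_C_fuel l n (act_B_fuel l (Suc n) f) 0 j0 k a b c
            = act_C_fuel l n (act_B_fuel l (Suc n) g) 0 j0 k a b c"
          by (rule Suc.IH(2), rule B) (simp add: 2 Suc 0)
        then show ?thesis using Suc 0 by (simp add: 2)
      qed (simp add: 2 0)
    qed }
qed

lemma fuel_stable:
  assumes "i + j + k \<le> n"
  shows "act_B_fuel l (Suc n) f i j k a b c = act_B_fuel l n f i j k a b c"
    "act_C_fuel l (Suc n) f i j k a b c = act_C_fuel l n f i j k a b c"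
  using assms
proof (induction n arbitrary: f i j k a b c)
  case 0
  { case 1 then show ?case by simp }
  { case 2 then show ?case by simp }
next
  case (Suc n)
  have B: "act_B_fuel l (Suc (Suc n)) f i j k a b c = act_B_fuel l (Suc n) f i j k a b c"
    if "i + j + k \<le> Suc n" for f i j k a b c
    using that by (cases i) (simp_all add: Suc.IH)
  { case 1 then show ?case by (rule B) }
  { case 2 show ?case
    proof (cases i)
      case (Suc i0)
      then show ?thesis using 2 Suc.IH[of i0 j k]
        by (simp only: act_C_fuel.simps)
    next
      case 0
      show ?thesis
      proof (cases j)
        case (Suc j0)
        \<comment> \<open>The bound occurs twice, in the outer operator and in the function it is
          applied to. The induction hypothesis lowers the first, locality the second.\<close>
        have "act_C_fuel l (Suc n) (act_B_fuel l (Suc (Suc n)) f) 0 j0 k a b c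
            = act_C_fuel l n (act_B_fuel l (Suc (Suc n)) f) 0 j0 k a b c"
          by (rule Suc.IH(2)) (use 2 0 Suc in simp)
        also have "\<dots> = act_C_fuel l n (act_B_fuel l (Suc n) f) 0 j0 k a b c"
          by (rule fuel_local(2), rule B) (use 2 0 Suc in simp)
        finally show ?thesis using 0 Suc by (simp only: act_C_fuel.simps)
      qed (simp add: 0)
    qed }
qed

lemma fuel_stable_le:
  assumes "i + j + k \<le> n"
  shows "act_B_fuel l n f i j k a b c = act_B_fuel l (i + j + k) f i j k a b c"
    "act_C_fuel l n f i j k a b c = act_C_fuel l (i + j + k) f i j k a b c"
  using assms by (induction n rule: dec_induct) (simp_all add: fuel_stable del: act_B_fuel.simps act_C_fuel.simps)

section \<open>The operators and the three relations\<close>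

definition act_A :: "'f coord_fun \<Rightarrow> 'f coord_fun" where
  "act_A f = (\<lambda>i. f (Suc i))"

definition act_B :: "'f \<Rightarrow> 'f coord_fun \<Rightarrow> 'f coord_fun" where
  "act_B l f i j k a b c = act_B_fuel l (i + j + k) f i j k a b c"

definition act_C :: "'f \<Rightarrow> 'f coord_fun \<Rightarrow> 'f coord_fun" where
  "act_C l f i j k a b c = act_C_fuel l (i + j + k) f i j k a b c"

lemma act_A_apply: "act_A f i j k a b c = f (Suc i) j k a b c"
  by (simp add: act_A_def)

lemma act_B_rec:
  "act_B l f 0 j k a b c = f 0 (Suc j) k a b c"
  "act_B l f (Suc i) j k a b c = s * act_B l (act_A f) i j k a b c + l * act_C l f i j k a b c - f i j k a b (Suc c)"
  by (simp_all add: act_B_def act_C_def act_A_def)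

lemma act_C_rec:
  "act_C l f 0 0 k a b c = f 0 0 (Suc k) a b c"
  "act_C l f 0 (Suc j) k a b c = s * act_C l (act_B l f) 0 j k a b c + l * act_A f 0 j k a b c - f 0 j k (Suc a) b c"
  "act_C l f (Suc i) j k a b c = t * (act_C l (act_A f) i j k a b c - l * act_B l f i j k a b c + f i j k a (Suc b) c)"
proof -
  show "act_C l f 0 0 k a b c = f 0 0 (Suc k) a b c"
    by (simp add: act_C_def)
  show "act_C l f (Suc i) j k a b c = t * (act_C l (act_A f) i j k a b c - l * act_B l f i j k a b c + f i j k a (Suc b) c)"
    by (simp add: act_B_def act_C_def act_A_def)
  \<comment> \<open>The inner function has a fixed bound, whereas \<open>act_B\<close> takes the
    bound from the point. They agree at all points of total exponent at most
    \<open>Suc (j + k)\<close>, and no others are read.\<close>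
  have "act_C_fuel l (j + k) (act_B_fuel l (Suc (j + k)) f) 0 j k a b c = act_C_fuel l (j + k) (act_B l f) 0 j k a b c"
    by (rule fuel_local(2)) (auto simp: act_B_def intro: fuel_stable_le)
  then show "act_C l f 0 (Suc j) k a b c = s * act_C l (act_B l f) 0 j k a b c + l * act_A f 0 j k a b c - f 0 j k (Suc a) b c"
    by (simp add: act_C_def act_A_def)
qed

lemma act_linear:
  "act_A (fun_comb u f v g w h x y z) = fun_comb u (act_A f) v (act_A g) w (act_A h) x y z"
  "act_B l (fun_comb u f v g w h x y z) = fun_comb u (act_B l f) v (act_B l g) w (act_B l h) x y z"
  "act_C l (fun_comb u f v g w h x y z) = fun_comb u (act_C l f) v (act_C l g) w (act_C l h) x y z"
  by (intro ext, simp add: act_A_def act_B_def act_C_def fuel_linear fun_comb_def)+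

text \<open>The action is on the right, so \<open>act_A (act_B l f)\<close> is the functional f .
  BA. This relation and the next are the recursion equations at exponent
  \<open>Suc i\<close>.\<close>

lemma act_BA:
  "act_A (act_B l f) i j k a b c = s * act_B l (act_A f) i j k a b c + l * act_C l f i j k a b c - f i j k a b (Suc c)"
  by (simp add: act_A_apply act_B_rec)

lemma act_AC:
  "act_C l (act_A f) i j k a b c = s * act_A (act_C l f) i j k a b c + l * act_B l f i j k a b c - f i j k a (Suc b) c"
  by (simp add: act_A_apply act_C_rec s_t)

text \<open>For i = 0 this is the recursion. The induction step moves C and B past one A in both
  orders and compares the results, which is the resolution of the overlap CBA in the rewriting
  system BA, CA, CB -> AB, AC, BC.\<close>

lemma act_CB:
  "act_B l (act_C l f) i j k a b c = s * act_C l (act_B l f) i j k a b c + l * act_A f i j k a b c - f i j k (Suc a) b c"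
proof (induction i arbitrary: f)
  case 0
  show ?case by (simp add: act_B_rec act_C_rec)
next
  case (Suc i)
  \<comment> \<open>Stated for functions rather than values, so that the outer operator can be
    pushed through by linearity.\<close>
  have AC: "act_A (act_C l f) = fun_comb t (act_C l (act_A f)) (- t * l) (act_B l f) t f 0 1 0"
    by (intro ext) (simp add: act_A_apply act_C_rec fun_comb_def algebra_simps)
  have BA: "act_A (act_B l f) = fun_comb s (act_B l (act_A f)) l (act_C l f) (- 1) f 0 0 1"
    by (intro ext) (simp add: act_BA fun_comb_def)
  have B: "act_B l (act_A (act_C l f)) i j k a b c
      = t * act_B l (act_C l (act_A f)) i j k a b c - t * l * act_B l (act_B l f) i j k a b c + t * act_B l f i j k a (Suc b) c"
    unfolding AC act_linear by (simp add: fun_comb_def)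
  have C: "act_C l (act_A (act_B l f)) i j k a b c
      = s * act_C l (act_B l (act_A f)) i j k a b c + l * act_C l (act_C l f) i j k a b c - act_C l f i j k a b (Suc c)"
    unfolding BA act_linear by (simp add: fun_comb_def)
  show ?case
    unfolding act_B_rec(2) act_C_rec(3) B C Suc.IH
    by (simp add: right_diff_distrib distrib_left s_t act_A_apply act_C_rec(3) mult.assoc)
qed

end

section \<open>Degrees and leading terms\<close>

fun gen_count :: "gen \<Rightarrow> gen lie_monomial \<Rightarrow> nat" where
  "gen_count x (Letter y) = (if x = y then 1 else 0)"
| "gen_count x (Bracket U V) = gen_count x U + gen_count x V"

lemma lie_length_conv_gen_count: "lie_length T = gen_count gA T + gen_count gB T + gen_count gC T"
proof (induction T)
  case (Letter x) then show ?case by (cases x) auto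
qed simp

context aw_parameter
begin

section \<open>The grading at l = 0\<close>

definition agree_at :: "nat \<Rightarrow> nat \<Rightarrow> nat \<Rightarrow> 'f coord_fun \<Rightarrow> 'f coord_fun \<Rightarrow> bool" where
  "agree_at x y z f g \<longleftrightarrow>
     (\<forall>i j k a b c. i + b + c = x \<longrightarrow> j + a + c = y \<longrightarrow> k + a + b = z \<longrightarrow> f i j k a b c = g i j k a b c)"

lemma agree_atD:
  "agree_at x y z f g \<Longrightarrow> i + b + c = x \<Longrightarrow> j + a + c = y \<Longrightarrow> k + a + b = z \<Longrightarrow> f i j k a b c = g i j k a b c"
  unfolding agree_at_def by blast

lemma agree_at_shift: "agree_at (Suc x) y z f g \<Longrightarrow> agree_at x y z (\<lambda>i. f (Suc i)) (\<lambda>i. g (Suc i))"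
  unfolding agree_at_def by (metis add_Suc)

text \<open>Without the terms in l every relation is homogeneous, so f . B in multidegree (x, y, z)
  reads f in multidegree (x, y + 1, z) only, and similarly for C.\<close>

lemma fuel_homogeneous:
  "agree_at x (Suc y) z f g \<Longrightarrow> agree_at x y z (act_B_fuel 0 n f) (act_B_fuel 0 n g)"
  "agree_at x y (Suc z) f g \<Longrightarrow> agree_at x y z (act_C_fuel 0 n f) (act_C_fuel 0 n g)"
proof (induction n arbitrary: x y z f g)
  case 0
  have B: "act_B_fuel 0 0 f i j k a b c = act_B_fuel 0 0 g i j k a b c"
    if "agree_at (i + b + c) (Suc (j + a + c)) (k + a + b) f g" for f g i j k a b c
    by (cases i) (simp_all add: agree_atD[OF that])
  have C: "act_C_fuel 0 0 f i j k a b c = act_C_fuel 0 0 g i j k a b c"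
    if "agree_at (i + b + c) (j + a + c) (Suc (k + a + b)) f g" for f g i j k a b c
    by (cases i; cases j) (simp_all add: agree_atD[OF that])
  { case 1 then show ?case unfolding agree_at_def[of x y z] by (auto intro: B) }
  { case 2 then show ?case unfolding agree_at_def[of x y z] by (auto intro: C) }
next
  case (Suc n)
  have B: "act_B_fuel 0 (Suc n) f i j k a b c = act_B_fuel 0 (Suc n) g i j k a b c"
    if "agree_at (i + b + c) (Suc (j + a + c)) (k + a + b) f g" for f g i j k a b c
  proof (cases i)
    case (Suc i0)
    have "agree_at (i0 + b + c) (j + a + c) (k + a + b) (act_B_fuel 0 n (\<lambda>i. f (Suc i))) (act_B_fuel 0 n (\<lambda>i. g (Suc i)))"
      by (rule Suc.IH(1), rule agree_at_shift) (use that Suc in simp)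
    then have "act_B_fuel 0 n (\<lambda>i. f (Suc i)) i0 j k a b c = act_B_fuel 0 n (\<lambda>i. g (Suc i)) i0 j k a b c"
      by (rule agree_atD) simp_all
    then show ?thesis using Suc by (simp add: agree_atD[OF that])
  qed (simp add: agree_atD[OF that])
  have B': "agree_at x y z (act_B_fuel 0 (Suc n) f) (act_B_fuel 0 (Suc n) g)" if "agree_at x (Suc y) z f g" for x y z f g
    using that unfolding agree_at_def[of x y z] by (auto intro: B)
  have C: "act_C_fuel 0 (Suc n) f i j k a b c = act_C_fuel 0 (Suc n) g i j k a b c"
    if *: "agree_at (i + b + c) (j + a + c) (Suc (k + a + b)) f g" for f g i j k a b c
  proof (cases i)
    case (Suc i0)
    have "agree_at (i0 + b + c) (j + a + c) (k + a + b) (act_C_fuel 0 n (\<lambda>i. f (Suc i))) (act_C_fuel 0 n (\<lambda>i. g (Suc i)))"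
      by (rule Suc.IH(2), rule agree_at_shift) (use * Suc in simp)
    then have "act_C_fuel 0 n (\<lambda>i. f (Suc i)) i0 j k a b c = act_C_fuel 0 n (\<lambda>i. g (Suc i)) i0 j k a b c"
      by (rule agree_atD) simp_all
    then show ?thesis using Suc by (simp add: agree_atD[OF *])
  next
    case i: 0
    show ?thesis
    proof (cases j)
      case (Suc j0)
      have "agree_at (b + c) (j0 + a + c) (k + a + b) (act_C_fuel 0 n (act_B_fuel 0 (Suc n) f)) (act_C_fuel 0 n (act_B_fuel 0 (Suc n) g))"
        by (rule Suc.IH(2), rule B') (use * Suc i in simp)
      then have "act_C_fuel 0 n (act_B_fuel 0 (Suc n) f) 0 j0 k a b c = act_C_fuel 0 n (act_B_fuel 0 (Suc n) g) 0 j0 k a b c"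
        by (rule agree_atD) simp_all
      then show ?thesis using Suc i by (simp add: agree_atD[OF *])
    qed (simp add: i agree_atD[OF *])
  qed
  { case 1 then show ?case by (rule B') }
  { case 2 then show ?case unfolding agree_at_def[of x y z] by (auto intro: C) }
qed

lemma act_homogeneous:
  "agree_at (Suc x) y z f g \<Longrightarrow> agree_at x y z (act_A f) (act_A g)"
  "agree_at x (Suc y) z f g \<Longrightarrow> agree_at x y z (act_B 0 f) (act_B 0 g)"
  "agree_at x y (Suc z) f g \<Longrightarrow> agree_at x y z (act_C 0 f) (act_C 0 g)"
proof -
  show "agree_at (Suc x) y z f g \<Longrightarrow> agree_at x y z (act_A f) (act_A g)"
    unfolding act_A_def by (rule agree_at_shift)
  assume "agree_at x (Suc y) z f g"
  then show "agree_at x y z (act_B 0 f) (act_B 0 g)"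
    unfolding agree_at_def[of x y z] act_B_def by (auto intro: agree_atD[OF fuel_homogeneous(1)])
next
  assume "agree_at x y (Suc z) f g"
  then show "agree_at x y z (act_C 0 f) (act_C 0 g)"
    unfolding agree_at_def[of x y z] act_C_def by (auto intro: agree_atD[OF fuel_homogeneous(2)])
qed

section \<open>The filtration for general l\<close>

definition vanish_below :: "nat \<Rightarrow> 'f coord_fun \<Rightarrow> bool" where
  "vanish_below N f \<longleftrightarrow> (\<forall>i j k a b c. i + j + k + 2 * (a + b + c) < N \<longrightarrow> f i j k a b c = 0)"

definition agree_below :: "nat \<Rightarrow> 'f coord_fun \<Rightarrow> 'f coord_fun \<Rightarrow> bool" where
  "agree_below N f g \<longleftrightarrow> (\<forall>i j k a b c. i + j + k + 2 * (a + b + c) < N \<longrightarrow> f i j k a b c = g i j k a b c)"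

lemma vanish_belowD: "vanish_below N f \<Longrightarrow> i + j + k + 2 * (a + b + c) < N \<Longrightarrow> f i j k a b c = 0"
  unfolding vanish_below_def by blast

lemma agree_belowD: "agree_below N f g \<Longrightarrow> i + j + k + 2 * (a + b + c) < N \<Longrightarrow> f i j k a b c = g i j k a b c"
  unfolding agree_below_def by blast

lemma agree_below_at: "agree_below N f g \<Longrightarrow> x + y + z < N \<Longrightarrow> agree_at x y z f g"
  unfolding agree_at_def agree_below_def by auto

lemma vanish_below_shift: "vanish_below N f \<Longrightarrow> vanish_below (N - 1) (\<lambda>i. f (Suc i))"
  unfolding vanish_below_def by simp

text \<open>The two bounds differ by one. A letter costs one order of vanishing, but setting l to 0
  changes no value below N: a term with l trades two letters for one, hence reads a functional that
  vanishes below N - 1 at a point of degree one less.\<close>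

definition fuel_filt :: "'f \<Rightarrow> nat \<Rightarrow> nat \<Rightarrow> 'f coord_fun \<Rightarrow> bool" where
  "fuel_filt l n N f \<longleftrightarrow>
     vanish_below (N - 1) (act_B_fuel l n f) \<and> agree_below N (act_B_fuel l n f) (act_B_fuel 0 n f) \<and>
     vanish_below (N - 1) (act_C_fuel l n f) \<and> agree_below N (act_C_fuel l n f) (act_C_fuel 0 n f)"

lemma fuel_filtered: "vanish_below N f \<Longrightarrow> fuel_filt l n N f"
proof (induction n arbitrary: N f)
  case 0
  have B: "act_B_fuel l 0 f i j k a b c = act_B_fuel 0 0 f i j k a b c"
    "act_C_fuel l 0 f i j k a b c = act_C_fuel 0 0 f i j k a b c" for i j k a b c
    by (cases i; cases j; simp)+
  have "act_B_fuel 0 0 f i j k a b c = 0" "act_C_fuel 0 0 f i j k a b c = 0"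
    if "i + j + k + 2 * (a + b + c) < N - 1" for i j k a b c
    using that by (cases i; cases j; simp add: vanish_belowD[OF 0])+
  then show ?case
    by (simp add: B fuel_filt_def vanish_below_def agree_below_def del: One_nat_def)
next
  case (Suc n)
  have IH: "vanish_below (N - 1) (act_B_fuel l n f)" "agree_below N (act_B_fuel l n f) (act_B_fuel 0 n f)"
    "vanish_below (N - 1) (act_C_fuel l n f)" "agree_below N (act_C_fuel l n f) (act_C_fuel 0 n f)"
    if "vanish_below N f" for N f
    using Suc.IH[OF that] unfolding fuel_filt_def by simp_all
  have B: "(i + j + k + 2 * (a + b + c) < N - 1 \<longrightarrow> act_B_fuel l (Suc n) f i j k a b c = 0) \<and>
      (i + j + k + 2 * (a + b + c) < N \<longrightarrow> act_B_fuel l (Suc n) f i j k a b c = act_B_fuel 0 (Suc n) f i j k a b c)"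
    if f: "vanish_below N f" for N f i j k a b c
  proof (cases i)
    case (Suc i0)
    then show ?thesis
      by (auto simp: vanish_belowD[OF f] vanish_belowD[OF IH(1)[OF vanish_below_shift[OF f]]]
        agree_belowD[OF IH(2)[OF vanish_below_shift[OF f]]] vanish_belowD[OF IH(3)[OF f]])
  qed (simp add: vanish_belowD[OF f])
  have B': "vanish_below (N - 1) (act_B_fuel l (Suc n) f)" "agree_below N (act_B_fuel l (Suc n) f) (act_B_fuel 0 (Suc n) f)"
    if "vanish_below N f" for N f
    using B[OF that] unfolding vanish_below_def[of "N - 1"] agree_below_def by simp_all
  have C: "(i + j + k + 2 * (a + b + c) < N - 1 \<longrightarrow> act_C_fuel l (Suc n) f i j k a b c = 0) \<and>
      (i + j + k + 2 * (a + b + c) < N \<longrightarrow> act_C_fuel l (Suc n) f i j k a b c = act_C_fuel 0 (Suc n) f i j k a b c)"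
    if f: "vanish_below N f" for N f i j k a b c
  proof (cases i)
    case (Suc i0)
    then show ?thesis
      by (auto simp: vanish_belowD[OF f] vanish_belowD[OF IH(3)[OF vanish_below_shift[OF f]]]
        agree_belowD[OF IH(4)[OF vanish_below_shift[OF f]]] vanish_belowD[OF IH(1)[OF f]])
  next
    case i: 0
    show ?thesis
    proof (cases j)
      case (Suc j0)
      \<comment> \<open>The outer operator already has l = 0, so it is homogeneous and reads the
        inner function in a single multidegree, of total degree below N, where the two inner
        functions agree.\<close>
      have "act_C_fuel 0 n (act_B_fuel l (Suc n) f) 0 j0 k a b c = act_C_fuel 0 n (act_B_fuel 0 (Suc n) f) 0 j0 k a b c"
        if "i + j + k + 2 * (a + b + c) < N"
      proof -
        have "agree_at (b + c) (j0 + a + c) (Suc (k + a + b)) (act_B_fuel l (Suc n) f) (act_B_fuel 0 (Suc n) f)"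
          by (rule agree_below_at[OF B'(2)[OF f]]) (use that Suc i in simp)
        from fuel_homogeneous(2)[OF this] show ?thesis by (rule agree_atD) simp_all
      qed
      then show ?thesis using Suc i
        by (auto simp: vanish_belowD[OF f] vanish_belowD[OF IH(3)[OF B'(1)[OF f]]]
          agree_belowD[OF IH(4)[OF B'(1)[OF f]]])
    qed (simp add: i vanish_belowD[OF f])
  qed
  show ?case
    using B'[OF Suc.prems] C[OF Suc.prems]
    unfolding fuel_filt_def vanish_below_def[of "N - 1" "act_C_fuel _ _ _"] agree_below_def[of N "act_C_fuel _ _ _"] by simp
qed

lemma act_filtered:
  assumes "vanish_below N f"
  shows "vanish_below (N - 1) (act_A f)"
    "vanish_below (N - 1) (act_B l f)" "agree_below N (act_B l f) (act_B 0 f)"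
    "vanish_below (N - 1) (act_C l f)" "agree_below N (act_C l f) (act_C 0 f)"
proof -
  show "vanish_below (N - 1) (act_A f)"
    unfolding act_A_def using assms by (rule vanish_below_shift)
  have *: "vanish_below (N - 1) (act_B_fuel l n f)" "agree_below N (act_B_fuel l n f) (act_B_fuel 0 n f)"
    "vanish_below (N - 1) (act_C_fuel l n f)" "agree_below N (act_C_fuel l n f) (act_C_fuel 0 n f)" for n
    using fuel_filtered[OF assms, of l n] unfolding fuel_filt_def by simp_all
  show "vanish_below (N - 1) (act_B l f)" "agree_below N (act_B l f) (act_B 0 f)"
    "vanish_below (N - 1) (act_C l f)" "agree_below N (act_C l f) (act_C 0 f)"
    unfolding vanish_below_def[of "N - 1"] agree_below_def act_B_def act_C_def
    by (auto intro: vanish_belowD[OF *(1)] agree_belowD[OF *(2)] vanish_belowD[OF *(3)] agree_belowD[OF *(4)] simp del: One_nat_def)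
qed

section \<open>The action of Lie monomials\<close>

fun act_gen :: "'f \<Rightarrow> gen \<Rightarrow> 'f coord_fun \<Rightarrow> 'f coord_fun" where
  "act_gen l gA f = act_A f"
| "act_gen l gB f = act_B l f"
| "act_gen l gC f = act_C l f"

text \<open>The first summand is f . UV: in a right action the left factor acts first. The recursion
  follows the monomial itself, so leading terms can be computed without expanding commutators into
  words.\<close>

fun act_lie :: "'f \<Rightarrow> 'f coord_fun \<Rightarrow> gen lie_monomial \<Rightarrow> 'f coord_fun" where
  "act_lie l f (Letter x) = act_gen l x f"
| "act_lie l f (Bracket U V) =
     (\<lambda>i j k a b c. act_lie l (act_lie l f U) V i j k a b c - act_lie l (act_lie l f V) U i j k a b c)"

lemma act_lie_homogeneous:
  "agree_at (x + gen_count gA T) (y + gen_count gB T) (z + gen_count gC T) f g \<Longrightarrow>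
     agree_at x y z (act_lie 0 f T) (act_lie 0 g T)"
proof (induction T arbitrary: x y z f g)
  case (Letter u)
  then show ?case by (cases u) (simp_all add: act_homogeneous)
next
  case (Bracket U V)
  have "agree_at (x + gen_count gA V) (y + gen_count gB V) (z + gen_count gC V) (act_lie 0 f U) (act_lie 0 g U)"
    by (rule Bracket.IH(1)) (use Bracket.prems in \<open>simp add: ac_simps\<close>)
  from Bracket.IH(2)[OF this] have "agree_at x y z (act_lie 0 (act_lie 0 f U) V) (act_lie 0 (act_lie 0 g U) V)" .
  moreover have "agree_at (x + gen_count gA U) (y + gen_count gB U) (z + gen_count gC U) (act_lie 0 f V) (act_lie 0 g V)"
    by (rule Bracket.IH(2)) (use Bracket.prems in \<open>simp add: ac_simps\<close>)
  from Bracket.IH(1)[OF this] have "agree_at x y z (act_lie 0 (act_lie 0 f V) U) (act_lie 0 (act_lie 0 g V) U)" .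
  ultimately show ?case unfolding agree_at_def by simp
qed

lemma act_lie_agree_below:
  assumes "agree_below N f g"
  shows "agree_below (N - lie_length T) (act_lie 0 f T) (act_lie 0 g T)"
  unfolding agree_below_def
proof (intro allI impI)
  fix i j k a b c assume "i + j + k + 2 * (a + b + c) < N - lie_length T"
  then have "agree_at (i + b + c + gen_count gA T) (j + a + c + gen_count gB T) (k + a + b + gen_count gC T) f g"
    by (intro agree_below_at[OF assms]) (simp add: lie_length_conv_gen_count)
  from agree_atD[OF act_lie_homogeneous[OF this]]
  show "act_lie 0 f T i j k a b c = act_lie 0 g T i j k a b c" by simp
qed

text \<open>For one product UV, l is set to 0 in two stages: in V by the filtration, then in U,
  where homogeneity of V at l = 0 carries the agreement of the inner functionals outwards.\<close>

lemma act_lie_filtered_Bracket: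
  assumes "agree_below (Suc N - lie_length U) (act_lie l f U) (act_lie 0 f U)"
    and "vanish_below (N - lie_length U - lie_length V) (act_lie l (act_lie l f U) V)"
    and "agree_below (Suc (N - lie_length U) - lie_length V) (act_lie l (act_lie l f U) V) (act_lie 0 (act_lie l f U) V)"
  shows "vanish_below (N - (lie_length U + lie_length V)) (act_lie l (act_lie l f U) V)"
    and "agree_below (Suc N - (lie_length U + lie_length V)) (act_lie l (act_lie l f U) V) (act_lie 0 (act_lie 0 f U) V)"
proof -
  show "vanish_below (N - (lie_length U + lie_length V)) (act_lie l (act_lie l f U) V)"
    using assms(2) by simp
  have "agree_below (Suc N - lie_length U - lie_length V) (act_lie 0 (act_lie l f U) V) (act_lie 0 (act_lie 0 f U) V)"
    by (rule act_lie_agree_below) (rule assms(1))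
  with assms(3)
  show "agree_below (Suc N - (lie_length U + lie_length V)) (act_lie l (act_lie l f U) V) (act_lie 0 (act_lie 0 f U) V)"
    unfolding agree_below_def by simp
qed

definition act_lie_filt :: "'f \<Rightarrow> nat \<Rightarrow> 'f coord_fun \<Rightarrow> gen lie_monomial \<Rightarrow> bool" where
  "act_lie_filt l N f T \<longleftrightarrow> vanish_below (N - lie_length T) (act_lie l f T) \<and>
      agree_below (Suc N - lie_length T) (act_lie l f T) (act_lie 0 f T)"

lemma act_lie_filtD:
  assumes "act_lie_filt l N f T"
  shows "vanish_below (N - lie_length T) (act_lie l f T)"
    and "agree_below (Suc N - lie_length T) (act_lie l f T) (act_lie 0 f T)"
  using assms unfolding act_lie_filt_def by blast+

lemma act_lie_filt_Bracket:
  assumes U: "act_lie_filt l N f U" and V: "act_lie_filt l N f V"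
    and UV: "act_lie_filt l (N - lie_length U) (act_lie l f U) V"
    and VU: "act_lie_filt l (N - lie_length V) (act_lie l f V) U"
  shows "act_lie_filt l N f (Bracket U V)"
proof -
  note 1 = act_lie_filtered_Bracket[OF act_lie_filtD(2)[OF U] act_lie_filtD[OF UV]]
  note 2 = act_lie_filtered_Bracket[OF act_lie_filtD(2)[OF V] act_lie_filtD[OF VU]]
  show ?thesis
    unfolding act_lie_filt_def
  proof
    show "vanish_below (N - lie_length (Bracket U V)) (act_lie l f (Bracket U V))"
      using 1(1) 2(1) unfolding vanish_below_def by (simp add: add.commute)
    show "agree_below (Suc N - lie_length (Bracket U V)) (act_lie l f (Bracket U V)) (act_lie 0 f (Bracket U V))"
      using 1(2) 2(2) unfolding agree_below_def by (simp add: add.commute)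
  qed
qed

lemma act_lie_filt: "vanish_below N f \<Longrightarrow> act_lie_filt l N f T"
proof (induction T arbitrary: N f)
  case (Letter u)
  note * = act_filtered(1)[OF Letter.prems] act_filtered(2-5)[OF Letter.prems, where l = l]
  show ?case
  proof (cases u)
    case gA then show ?thesis using *(1) by (simp add: act_lie_filt_def agree_below_def)
  next
    case gB then show ?thesis using *(2,3) by (simp add: act_lie_filt_def)
  next
    case gC then show ?thesis using *(4,5) by (simp add: act_lie_filt_def)
  qed
next
  case (Bracket U V)
  note U = Bracket.IH(1)[OF Bracket.prems]
  note V = Bracket.IH(2)[OF Bracket.prems]
  show ?case
    by (rule act_lie_filt_Bracket[OF U V Bracket.IH(2)[OF act_lie_filtD(1)[OF U]] Bracket.IH(1)[OF act_lie_filtD(1)[OF V]]])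
qed

lemma act_lie_filtered:
  "vanish_below N f \<Longrightarrow> vanish_below (N - lie_length T) (act_lie l f T)"
  "vanish_below N f \<Longrightarrow> agree_below (Suc N - lie_length T) (act_lie l f T) (act_lie 0 f T)"
  using act_lie_filt[of N f l T] unfolding act_lie_filt_def by simp_all

end

section \<open>The action of the free algebra\<close>

fun word_letters :: "'x free_word \<Rightarrow> 'x list" where
  "word_letters (Word xs) = xs"

lemma word_letters_add: "word_letters (u + v) = word_letters u @ word_letters v"
  by (cases u; cases v) simp

lemma word_letters_zero [simp]: "word_letters 0 = []"
  by (simp add: zero_free_word_def)

lemma poly_mapping_single_add_induct [case_names single add]:
  fixes p :: "'a \<Rightarrow>\<^sub>0 'b::comm_monoid_add"
  assumes single: "\<And>k v. P (Poly_Mapping.single k v)"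
    and add: "\<And>p q. P p \<Longrightarrow> P q \<Longrightarrow> P (p + q)"
  shows "P p"
proof (induction p rule: update_induct)
  case const
  \<comment> \<open>The zero map is itself a \<open>single\<close> with value 0, so no base case has
    to be assumed.\<close>
  show ?case using single[of undefined 0] by simp
next
  case (update p k v)
  have "Poly_Mapping.update k v p = p + Poly_Mapping.single k v"
    using update.hyps(1)
    by (intro poly_mapping_eqI) (auto simp: lookup_update lookup_add lookup_single when_def in_keys_iff)
  then show ?case using add update.IH single by metis
qed

context aw_parameter
begin

text \<open>\<open>foldl\<close> lets the leftmost letter act first, as a right action
  requires.\<close>

definition act_word :: "'f \<Rightarrow> 'f coord_fun \<Rightarrow> gen list \<Rightarrow> 'f coord_fun" where
  "act_word l = foldl (\<lambda>f x. act_gen l x f)"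

definition act :: "'f \<Rightarrow> 'f coord_fun \<Rightarrow> 'f free_alg \<Rightarrow> 'f coord_fun" where
  "act l f p i j k a b c =
     (\<Sum>w\<in>Poly_Mapping.keys p. Poly_Mapping.lookup p w * act_word l f (word_letters w) i j k a b c)"

lemma act_superset:
  assumes "finite S" "Poly_Mapping.keys p \<subseteq> S"
  shows "act l f p i j k a b c = (\<Sum>w\<in>S. Poly_Mapping.lookup p w * act_word l f (word_letters w) i j k a b c)"
  unfolding act_def by (rule sum.mono_neutral_left) (use assms in \<open>auto simp: in_keys_iff\<close>)

lemma act_add: "act l f (p + q) i j k a b c = act l f p i j k a b c + act l f q i j k a b c"
proof -
  have "Poly_Mapping.keys (p + q) \<subseteq> Poly_Mapping.keys p \<union> Poly_Mapping.keys q"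
    by (rule keys_add)
  then show ?thesis
    by (subst (1 2 3) act_superset[of "Poly_Mapping.keys p \<union> Poly_Mapping.keys q"])
      (auto simp: lookup_add algebra_simps sum.distrib)
qed

lemma act_uminus: "act l f (- p) i j k a b c = - act l f p i j k a b c"
  unfolding act_def keys_def by (simp add: sum_negf)

lemma act_diff: "act l f (p - q) i j k a b c = act l f p i j k a b c - act l f q i j k a b c"
  using act_add[of l f p "- q"] act_uminus[of l f q] by simp

lemma act_single: "act l f (Poly_Mapping.single w u) i j k a b c = u * act_word l f (word_letters w) i j k a b c"
  by (cases "u = 0") (simp_all add: act_def)

lemma act_gen_linear:
  "act_gen l r (fun_comb u f v g w h x y z) = fun_comb u (act_gen l r f) v (act_gen l r g) w (act_gen l r h) x y z"
  by (cases r) (simp_all add: act_linear)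

lemma act_word_linear:
  "act_word l (fun_comb u f v g w h x y z) rs =
     fun_comb u (act_word l f rs) v (act_word l g rs) w (act_word l h rs) x y z"
proof (induction rs rule: rev_induct)
  case (snoc r rs)
  then show ?case by (simp add: act_word_def act_gen_linear)
qed (simp add: act_word_def)

lemma act_fun_comb:
  "act l (fun_comb u f v g w h x y z) p = fun_comb u (act l f p) v (act l g p) w (act l h p) x y z"
  by (intro ext)
    (simp add: act_def act_word_linear fun_comb_def sum_distrib_left sum.distrib algebra_simps)

lemma act_mult: "act l f (p * q) = act l (act l f p) q"
proof (induction p rule: poly_mapping_single_add_induct)
  case (single w u)
  show ?case
  proof (induction q rule: poly_mapping_single_add_induct)
    case (single w' u')
    \<comment> \<open>A scalar multiple is written as a \<open>fun_comb\<close> with two zero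
      weights, so that the general linearity statement applies.\<close>
    have f: "act l f (Poly_Mapping.single w u) = fun_comb u (act_word l f (word_letters w)) 0 f 0 f 0 0 0"
      by (intro ext) (simp add: act_single fun_comb_def)
    show ?case
      unfolding f act_fun_comb
      by (intro ext) (simp add: act_single fun_comb_def mult_single act_word_def word_letters_add)
  next
    case (add q q')
    then show ?case by (intro ext) (simp add: distrib_left act_add)
  qed
next
  case (add p p')
  have f: "act l f (p + p') = fun_comb 1 (act l f p) 1 (act l f p') 0 f 0 0 0"
    by (intro ext) (simp add: act_add fun_comb_def)
  show ?case
    unfolding f act_fun_comb
    by (intro ext) (simp add: distrib_right act_add fun_comb_def add.IH)
qed

lemma act_letter: "act l f (letter r) = act_gen l r f"
  by (intro ext) (simp add: letter_def act_single act_word_def)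

lemma act_const: "act l f (const u) = fun_comb u f 0 f 0 f 0 0 0"
  by (intro ext) (simp add: const_def act_single act_word_def fun_comb_def)

lemma act_const_mult: "act l f (const u * p) = fun_comb u (act l f p) 0 (act l f p) 0 (act l f p) 0 0 0"
  by (simp add: act_mult act_const act_fun_comb)

lemma act_zero_fun: "act l (\<lambda>i j k a b c. 0) p i j k a b c = 0"
proof -
  let ?z = "\<lambda>i j k a b c. 0 :: 'f"
  have z: "?z = fun_comb 0 ?z 0 ?z 0 ?z 0 0 0"
    by (intro ext) (simp add: fun_comb_def)
  show ?thesis by (subst z, subst act_fun_comb) (simp add: fun_comb_def)
qed

lemma act_zero [simp]: "act l f 0 i j k a b c = 0"
  by (simp add: act_def)

lemma act_lie_eval: "act l f (lie_eval T) = act_lie l f T"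
proof (induction T arbitrary: f)
  case (Letter r)
  show ?case by (simp add: act_letter)
next
  case (Bracket U V)
  show ?case by (intro ext) (simp add: commutator_def act_diff act_mult Bracket.IH)
qed

end

section \<open>The defining ideal acts by zero\<close>

lemma ring_of_type_algebra_simps [simp]:
  "carrier ring_of_type_algebra = UNIV"
  "x \<otimes>\<^bsub>ring_of_type_algebra\<^esub> y = x * y"
  "x \<oplus>\<^bsub>ring_of_type_algebra\<^esub> y = x + y"
  "\<one>\<^bsub>ring_of_type_algebra\<^esub> = 1"
  "\<zero>\<^bsub>ring_of_type_algebra\<^esub> = 0"
  by (simp_all add: ring_of_type_algebra_def)

lemma ring_ring_of_type_algebra: "ring (ring_of_type_algebra :: 'a::ring_1 ring)"
proof -
  have "\<exists>y. y + x = 0" "\<exists>y. x + y = 0" for x :: 'a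
    using left_minus right_minus by blast+
  then show ?thesis
    by unfold_locales (auto simp: Units_def algebra_simps)
qed

interpretation type_ring: ring "ring_of_type_algebra :: 'a::ring_1 ring"
  by (rule ring_ring_of_type_algebra)

lemma type_ring_a_inv [simp]: "\<ominus>\<^bsub>ring_of_type_algebra\<^esub> x = - (x::'a::ring_1)"
  by (rule type_ring.minus_equality) simp_all

lemma type_ring_idealI:
  fixes I :: "'a::ring_1 set"
  assumes "0 \<in> I" "\<And>x y. x \<in> I \<Longrightarrow> y \<in> I \<Longrightarrow> x + y \<in> I"
    and "\<And>x y. x \<in> I \<Longrightarrow> y * x \<in> I" "\<And>x y. x \<in> I \<Longrightarrow> x * y \<in> I"
  shows "ideal I ring_of_type_algebra"
proof (rule idealI)
  show "subgroup I (add_monoid ring_of_type_algebra)"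
  proof (rule type_ring.add.subgroupI)
    show "\<ominus>\<^bsub>ring_of_type_algebra\<^esub> x \<in> I" if "x \<in> I" for x
      using assms(3)[OF that, of "- 1"] by simp
  qed (use assms in auto)
qed (use assms ring_ring_of_type_algebra in auto)

lemma ideal_aw_ideal: "ideal (aw_ideal q) ring_of_type_algebra"
  unfolding aw_ideal_def by (rule type_ring.genideal_ideal) simp

lemma aw_ideal_add: "x \<in> aw_ideal q \<Longrightarrow> y \<in> aw_ideal q \<Longrightarrow> x + y \<in> aw_ideal q"
  using additive_subgroup.a_closed[OF ideal.axioms(1)[OF ideal_aw_ideal]] by fastforce

lemma aw_ideal_zero: "0 \<in> aw_ideal q"
  using additive_subgroup.zero_closed[OF ideal.axioms(1)[OF ideal_aw_ideal]] by fastforce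

lemma aw_ideal_mult: "x \<in> aw_ideal q \<Longrightarrow> y * x \<in> aw_ideal q" "x \<in> aw_ideal q \<Longrightarrow> x * y \<in> aw_ideal q"
  using ideal.I_l_closed[OF ideal_aw_ideal, of x q y] ideal.I_r_closed[OF ideal_aw_ideal, of x q y] by simp_all

lemma aw_ideal_uminus: "x \<in> aw_ideal q \<Longrightarrow> - x \<in> aw_ideal q"
  using aw_ideal_mult(1)[of x q "- 1"] by simp

lemma aw_ideal_diff: "x \<in> aw_ideal q \<Longrightarrow> y \<in> aw_ideal q \<Longrightarrow> x - y \<in> aw_ideal q"
  using aw_ideal_add[OF _ aw_ideal_uminus] by fastforce

lemma aw_ideal_generators:
  "\<delta> \<in> {aw_alpha q, aw_beta q, aw_gamma q} \<Longrightarrow> commutator (letter x) \<delta> \<in> aw_ideal q"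
  unfolding aw_ideal_def by (rule subsetD[OF type_ring.genideal_self]) auto

text \<open>Each of \<alpha>, \<beta>, \<gamma> acts as a multiple of the shift of one central
  exponent, and such shifts commute with the operators of the letters.\<close>

lemma (in aw_parameter) act_aw_ideal:
  assumes q: "q \<noteq> 0" "q ^ 4 \<noteq> 1" "s = q ^ 2" and p: "p \<in> aw_ideal q"
  shows "act (q ^ 3 - inverse q) f p = (\<lambda>i j k a b c. 0)"
proof -
  define l where "l = q ^ 3 - inverse q"
  have q2: "q - inverse q \<noteq> 0"
    using q by (auto simp: field_simps power2_eq_square power4_eq_xxxx)
  \<comment> \<open>This is 1 / (q^2 - 1), the reciprocal of the factor between \<alpha> and
    a.\<close>
  define u where "u = inverse q * inverse (q - inverse q)"
  \<comment> \<open>Because of this value of l, the linear term created by reordering CB cancels (q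
    + 1/q) A in \<alpha>; likewise for \<beta> and \<gamma>.\<close>
  have lq: "inverse (q - inverse q) * (inverse q * l) = q + inverse q"
    using q(1) q2 unfolding l_def by (simp add: field_simps power2_eq_square power3_eq_cube)
  have qs: "q * x = inverse q * (s * x)" for x
    using q(1) by (simp add: q(3) power2_eq_square)
  have \<alpha>: "act l f (aw_alpha q) = fun_comb 0 f 0 f u f 1 0 0" for f
  proof (intro ext)
    fix i j k a b c
    have "act l f (aw_alpha q) i j k a b c = (q + inverse q) * act_gen l gA f i j k a b c
        + inverse (q - inverse q) * (q * act_gen l gC (act_gen l gB f) i j k a b c
            - inverse q * act_gen l gB (act_gen l gC f) i j k a b c)"
      by (simp add: aw_alpha_def act_add act_diff act_const_mult act_mult act_letter act_const act_gen_linear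
          fun_comb_def mult.assoc right_diff_distrib mult.left_commute[of _ "inverse (q - inverse q)"] del: act_gen.simps)
    then show "act l f (aw_alpha q) i j k a b c = fun_comb 0 f 0 f u f 1 0 0 i j k a b c"
      unfolding act_gen.simps act_CB qs lq[symmetric] u_def by (simp add: algebra_simps fun_comb_def)
  qed
  have \<beta>: "act l f (aw_beta q) = fun_comb 0 f 0 f u f 0 1 0" for f
  proof (intro ext)
    fix i j k a b c
    have "act l f (aw_beta q) i j k a b c = (q + inverse q) * act_gen l gB f i j k a b c
        + inverse (q - inverse q) * (q * act_gen l gA (act_gen l gC f) i j k a b c
            - inverse q * act_gen l gC (act_gen l gA f) i j k a b c)"
      by (simp add: aw_beta_def act_add act_diff act_const_mult act_mult act_letter act_const act_gen_linear
          fun_comb_def mult.assoc right_diff_distrib mult.left_commute[of _ "inverse (q - inverse q)"] del: act_gen.simps)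
    then show "act l f (aw_beta q) i j k a b c = fun_comb 0 f 0 f u f 0 1 0 i j k a b c"
      unfolding act_gen.simps act_AC qs lq[symmetric] u_def by (simp add: algebra_simps fun_comb_def)
  qed
  have \<gamma>: "act l f (aw_gamma q) = fun_comb 0 f 0 f u f 0 0 1" for f
  proof (intro ext)
    fix i j k a b c
    have "act l f (aw_gamma q) i j k a b c = (q + inverse q) * act_gen l gC f i j k a b c
        + inverse (q - inverse q) * (q * act_gen l gB (act_gen l gA f) i j k a b c
            - inverse q * act_gen l gA (act_gen l gB f) i j k a b c)"
      by (simp add: aw_gamma_def act_add act_diff act_const_mult act_mult act_letter act_const act_gen_linear
          fun_comb_def mult.assoc right_diff_distrib mult.left_commute[of _ "inverse (q - inverse q)"] del: act_gen.simps)
    then show "act l f (aw_gamma q) i j k a b c = fun_comb 0 f 0 f u f 0 0 1 i j k a b c"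
      unfolding act_gen.simps act_BA qs lq[symmetric] u_def by (simp add: algebra_simps fun_comb_def)
  qed
  have comm: "act l f (commutator (letter r) d) = (\<lambda>i j k a b c. 0)"
    if "\<And>f. act l f d = fun_comb 0 f 0 f u f x y z" for r d f x y z
    by (intro ext) (simp add: commutator_def act_diff act_mult act_letter that act_gen_linear fun_comb_def)
  \<comment> \<open>Quantifying over all functionals makes K two-sided: a factor on the left only
    changes the functional, and a factor on the right acts on the zero functional.\<close>
  define K where "K = {p. \<forall>f i j k a b c. act l f p i j k a b c = 0}"
  have "ideal K ring_of_type_algebra"
  proof (rule type_ring_idealI)
    fix p p' assume p: "p \<in> K"
    show "p' * p \<in> K" using p by (simp add: K_def act_mult)
    have "act l f p = (\<lambda>i j k a b c. 0)" for f
      using p by (intro ext) (simp add: K_def)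
    then show "p * p' \<in> K" by (simp add: K_def act_mult act_zero_fun)
  qed (simp_all add: K_def act_add)
  then have "aw_ideal q \<subseteq> K"
    unfolding aw_ideal_def
    by (rule type_ring.genideal_minimal) (auto simp: K_def comm[OF \<alpha>] comm[OF \<beta>] comm[OF \<gamma>])
  with p show ?thesis unfolding K_def l_def[symmetric] by (intro ext) blast
qed

section \<open>Relations in the Askey-Wilson algebra\<close>

lemma const_mult_const: "const u * const v = const (u * v)"
  by (simp add: const_def mult_single)

lemma const_add: "const (u + v) = const u + const v"
  by (simp add: const_def single_add)

lemma const_one [simp]: "const 1 = 1"
  by (simp add: const_def)

lemma const_zero [simp]: "const 0 = 0"
  by (simp add: const_def)

lemma const_uminus: "const (- u) = - const u"
  by (simp add: const_def single_uminus)

lemma const_commute: "p * const u = const u * p"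
proof (induction p rule: poly_mapping_single_add_induct)
  case (single k v)
  show ?case by (simp add: const_def mult_single mult.commute)
qed (simp add: distrib_left distrib_right)

definition word_prod :: "gen list \<Rightarrow> 'f::field free_alg" where
  "word_prod w = prod_list (map letter w)"

lemma word_prod_simps [simp]:
  "word_prod [] = 1" "word_prod (x # w) = letter x * word_prod w"
  by (simp_all add: word_prod_def)

lemma word_prod_append: "word_prod (u @ v) = word_prod u * word_prod v"
  by (simp add: word_prod_def)

lemma single_conv_word_prod: "Poly_Mapping.single (Word w) u = const u * word_prod w"
proof (induction w arbitrary: u)
  case Nil
  show ?case by (simp add: const_def zero_free_word_def)
next
  case (Cons x w)
  have "Poly_Mapping.single (Word (x # w)) u = Poly_Mapping.single (Word [x]) 1 * Poly_Mapping.single (Word w) u"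
    by (simp add: mult_single)
  then show ?case
    by (simp add: Cons.IH letter_def[symmetric] const_commute mult.assoc[symmetric])
qed

text \<open>Centrality is imposed on the three letters only. The Leibniz rule extends it to words,
  and additivity to all elements.\<close>

lemma aw_central:
  assumes d: "d \<in> {aw_alpha q, aw_beta q, aw_gamma q}"
  shows "d * p - p * d \<in> aw_ideal q"
proof (induction p rule: poly_mapping_single_add_induct)
  case (single k u)
  obtain w where k: "k = Word w" by (cases k)
  have "d * word_prod w - word_prod w * d \<in> aw_ideal q"
  proof (induction w)
    case (Cons x w)
    have "d * (letter x * word_prod w) - letter x * word_prod w * d =
        letter x * (d * word_prod w - word_prod w * d) - commutator (letter x) d * word_prod w"
      by (simp add: commutator_def algebra_simps)
    then show ?case
      using aw_ideal_diff[OF aw_ideal_mult(1)[OF Cons.IH] aw_ideal_mult(2)[OF aw_ideal_generators[OF d]]]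
      by simp
  qed (simp add: aw_ideal_zero)
  from aw_ideal_mult(1)[OF this, of "const u"] show ?case
    unfolding k single_conv_word_prod by (simp add: right_diff_distrib mult.assoc[symmetric] const_commute)
next
  case (add p p')
  from aw_ideal_add[OF this] show ?case by (simp add: algebra_simps)
qed

text \<open>Relations in the Askey-Wilson algebra are checked by applying the linear functionals that
  vanish on the ideal: these separate points, and take the computation into the base field.\<close>

locale aw_functional =
  fixes q :: "'f::field" and f :: "'f free_alg \<Rightarrow> 'f"
  assumes q: "q \<noteq> 0" "q ^ 4 \<noteq> 1"
    and f_add: "f (p + p') = f p + f p'"
    and f_scale: "f (const u * p) = u * f p"
    and f_ideal: "p \<in> aw_ideal q \<Longrightarrow> f p = 0"
begin

definition "s = q ^ 2"
definition "l = q ^ 3 - inverse q"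

lemma s_nonzero: "s \<noteq> 0"
  using q by (simp add: s_def)

lemma f_uminus: "f (- p) = - f p"
  using f_scale[of "- 1" p] by (simp add: const_uminus)

lemma f_diff: "f (p - p') = f p - f p'"
  using f_add[of p "- p'"] by (simp add: f_uminus)

lemma f_cong: "p - p' \<in> aw_ideal q \<Longrightarrow> f p = f p'"
  using f_ideal[of "p - p'"] by (simp add: f_diff)

text \<open>With this factor the reversed product CB enters a with coefficient -1, so the relation
  can be solved for it without division.\<close>

definition "a = const (q ^ 2 - 1) * aw_alpha q"
definition "b = const (q ^ 2 - 1) * aw_beta q"
definition "c = const (q ^ 2 - 1) * aw_gamma q"

lemma q2: "q - inverse q \<noteq> 0" "q ^ 2 - 1 \<noteq> 0"
  using q by (auto simp: field_simps power2_eq_square power4_eq_xxxx)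

lemma scaled_central_element:
  fixes x y z :: "'f free_alg"
  shows "const (q ^ 2 - 1) * (const (q + inverse q) * z
     + const (inverse (q - inverse q)) * (const q * x - const (inverse q) * y))
   = const s * x + const l * z - y"
proof -
  have 1: "(q ^ 2 - 1) * (q + inverse q) = l"
    using q by (simp add: l_def field_simps power2_eq_square power3_eq_cube)
  have "(q ^ 2 - 1) * inverse (q - inverse q) = q"
    using q q2 by (simp add: field_simps power2_eq_square)
  then have 2: "(q ^ 2 - 1) * inverse (q - inverse q) * q = s" "(q ^ 2 - 1) * inverse (q - inverse q) * inverse q = 1"
    using q by (simp_all add: s_def power2_eq_square)
  have "const u * (const v * z + const w * (const r * x - const r' * y)) =
      const (u * w * r) * x + const (u * v) * z - const (u * w * r') * y" for u v w r r' :: 'f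
    by (simp add: distrib_left right_diff_distrib mult.assoc[symmetric] const_mult_const)
  then show ?thesis by (simp only: 1 2) simp
qed

lemma letter_relations:
  "letter gC * letter gB = const s * (letter gB * letter gC) + const l * letter gA - a"
  "letter gA * letter gC = const s * (letter gC * letter gA) + const l * letter gB - b"
  "letter gB * letter gA = const s * (letter gA * letter gB) + const l * letter gC - c"
  unfolding a_def b_def c_def aw_alpha_def aw_beta_def aw_gamma_def mult.assoc scaled_central_element by simp_all

lemma central:
  assumes "d \<in> {a, b, c}"
  shows "d * p - p * d \<in> aw_ideal q"
proof -
  obtain d' where d': "d' \<in> {aw_alpha q, aw_beta q, aw_gamma q}" and d: "d = const (q ^ 2 - 1) * d'"
    using assms unfolding a_def b_def c_def by blast
  from aw_ideal_mult(1)[OF aw_central[OF d', of p], of "const (q ^ 2 - 1)"] show ?thesis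
    unfolding d by (simp add: right_diff_distrib mult.assoc[symmetric] const_commute)
qed

section \<open>Sorting words under a functional\<close>

text \<open>The central factors are collected on the right as exponents, so sorting concerns the
  word alone and the values at sorted words become atoms of a polynomial identity in the
  field.\<close>

definition F :: "gen list \<Rightarrow> nat \<Rightarrow> nat \<Rightarrow> nat \<Rightarrow> 'f" where
  "F w i j k = f (word_prod w * (a ^ i * (b ^ j * c ^ k)))"

lemma F_central:
  "f (word_prod u * (a * (word_prod v * (a ^ i * (b ^ j * c ^ k))))) = F (u @ v) (Suc i) j k"
  "f (word_prod u * (b * (word_prod v * (a ^ i * (b ^ j * c ^ k))))) = F (u @ v) i (Suc j) k"
  "f (word_prod u * (c * (word_prod v * (a ^ i * (b ^ j * c ^ k))))) = F (u @ v) i j (Suc k)"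
proof -
  have *: "f (x * (d * (y * z))) = f (x * (y * (d * z)))" if "d \<in> {a, b, c}" for d x y z
  proof (rule f_cong)
    have "x * (d * (y * z)) - x * (y * (d * z)) = x * ((d * y - y * d) * z)"
      by (simp add: algebra_simps)
    then show "x * (d * (y * z)) - x * (y * (d * z)) \<in> aw_ideal q"
      using central[OF that, of y] by (simp add: aw_ideal_mult)
  qed
  show "f (word_prod u * (a * (word_prod v * (a ^ i * (b ^ j * c ^ k))))) = F (u @ v) (Suc i) j k"
    by (subst *) (simp_all add: F_def word_prod_append mult.assoc)
  show "f (word_prod u * (b * (word_prod v * (a ^ i * (b ^ j * c ^ k))))) = F (u @ v) i (Suc j) k"
    using *[of b "word_prod u" "word_prod v * a ^ i" "b ^ j * c ^ k"]
    by (simp add: F_def word_prod_append mult.assoc)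
  show "f (word_prod u * (c * (word_prod v * (a ^ i * (b ^ j * c ^ k))))) = F (u @ v) i j (Suc k)"
    using *[of c "word_prod u" "word_prod v * a ^ i * b ^ j" "c ^ k"]
    by (simp add: F_def word_prod_append mult.assoc)
qed

lemma F_split: "F (u @ x # y # v) i j k = f (word_prod u * (letter x * letter y * (word_prod v * (a ^ i * (b ^ j * c ^ k)))))"
  by (simp add: F_def word_prod_append mult.assoc)

lemma F_const: "f (x * (const r * y)) = r * f (x * y)"
  using f_scale[of r "x * y"] const_commute[of x r] by (metis mult.assoc)

text \<open>Each rule turns a descending pair into an ascending one. The defining relation for A and
  C expresses AC by CA, hence the division by s in the third rule.\<close>

lemma F_swap:
  "F (u @ gB # gA # v) i j k = s * F (u @ gA # gB # v) i j k + l * F (u @ gC # v) i j k - F (u @ v) i j (Suc k)"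
  "F (u @ gC # gB # v) i j k = s * F (u @ gB # gC # v) i j k + l * F (u @ gA # v) i j k - F (u @ v) (Suc i) j k"
  "F (u @ gC # gA # v) i j k = (F (u @ gA # gC # v) i j k - l * F (u @ gB # v) i j k + F (u @ v) i (Suc j) k) / s"
proof -
  let ?m = "word_prod v * (a ^ i * (b ^ j * c ^ k))"
  have 0: "f (word_prod u * (letter x * ?m)) = F (u @ x # v) i j k" for x
    by (simp add: F_def word_prod_append mult.assoc)
  have 1: "f (word_prod u * (letter x * (letter y * ?m))) = F (u @ x # y # v) i j k" for x y
    by (simp add: F_def word_prod_append mult.assoc)
  show "F (u @ gB # gA # v) i j k = s * F (u @ gA # gB # v) i j k + l * F (u @ gC # v) i j k - F (u @ v) i j (Suc k)"
    unfolding F_split[of u gB gA] letter_relations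
    by (simp only: distrib_left distrib_right left_diff_distrib right_diff_distrib mult.assoc f_add f_diff F_const F_central 0 1)
  show "F (u @ gC # gB # v) i j k = s * F (u @ gB # gC # v) i j k + l * F (u @ gA # v) i j k - F (u @ v) (Suc i) j k"
    unfolding F_split[of u gC gB] letter_relations
    by (simp only: distrib_left distrib_right left_diff_distrib right_diff_distrib mult.assoc f_add f_diff F_const F_central 0 1)
  have "F (u @ gA # gC # v) i j k = s * F (u @ gC # gA # v) i j k + l * F (u @ gB # v) i j k - F (u @ v) i (Suc j) k"
    unfolding F_split[of u gA gC] letter_relations
    by (simp only: distrib_left distrib_right left_diff_distrib right_diff_distrib mult.assoc f_add f_diff F_const F_central 0 1)
  then show "F (u @ gC # gA # v) i j k = (F (u @ gA # gC # v) i j k - l * F (u @ gB # v) i j k + F (u @ v) i (Suc j) k) / s"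
    using s_nonzero by simp
qed

text \<open>Prefixes of length up to 3 reach every adjacent pair of a word of length 5.\<close>

lemmas F_sort =
  F_swap[of "[]", simplified] F_swap[of "[x]" for x, simplified]
  F_swap[of "[x, y]" for x y, simplified] F_swap[of "[x, y, z]" for x y z, simplified]

lemma f_word:
  "f (letter x * letter y) = F [x, y] 0 0 0"
  "f (letter x * (letter y * letter z)) = F [x, y, z] 0 0 0"
  "f (letter x * (letter y * (letter z * letter u))) = F [x, y, z, u] 0 0 0"
  "f (letter x * (letter y * (letter z * (letter u * letter v)))) = F [x, y, z, u, v] 0 0 0"
  by (simp_all add: F_def)

lemmas f_expand = left_normed_def commutator_def left_diff_distrib right_diff_distrib mult.assoc f_diff f_uminus f_word

section \<open>Identities between brackets\<close>

abbreviation "m w \<equiv> f (lie_eval (left_normed w))"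
abbreviation "mm v w \<equiv> f (lie_eval (Bracket (left_normed v) (left_normed w)))"

text \<open>Put X = [BA] and Y = [CA]. By the Jacobi identity the left-hand side is [[X,Y],A].
  Commuting the relations for BA and AC with A gives XA = sAX + lY and AY = sYA + lX. Hence XY and
  YX commute with A up to (l/s) (Y^2 - X^2) and l (Y^2 - X^2), and the difference of these is the
  right-hand side.\<close>

lemma square_relation_A:
  "mm [gB, gA, gA] [gC, gA] - mm [gC, gA, gA] [gB, gA] =
     l * (1 - 1 / s) * (f (lie_eval (left_normed [gB, gA]) * lie_eval (left_normed [gB, gA])) - f (lie_eval (left_normed [gC, gA]) * lie_eval (left_normed [gC, gA])))"
  \<comment> \<open>Brackets become words, words become sorted words, and what remains is a
    polynomial identity in s, l and the values \<open>F\<close>. The cancellation rules are removed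
    because they would turn the equation into a disjunction.\<close>
  by (simp add: f_expand, simp only: F_sort,
      simp add: s_nonzero divide_simps del: mult_cancel_left mult_cancel_right,
      Groebner_Basis.algebra)

text \<open>The relations are invariant under A -> B -> C -> A, which sends [BA] to [CB] and [CA] to
  -[BA]. The identity for A becomes this one, and a further rotation gives the one for C.\<close>

lemma square_relation_B:
  "mm [gB, gA, gB] [gC, gB] - mm [gC, gB, gB] [gB, gA] =
     l * (1 - 1 / s) * (f (lie_eval (left_normed [gC, gB]) * lie_eval (left_normed [gC, gB])) - f (lie_eval (left_normed [gB, gA]) * lie_eval (left_normed [gB, gA])))"
  by (simp add: f_expand, simp only: F_sort,
      simp add: s_nonzero divide_simps del: mult_cancel_left mult_cancel_right,
      Groebner_Basis.algebra)

lemma square_relation_C: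
  "mm [gC, gA, gC] [gC, gB] - mm [gC, gB, gC] [gC, gA] =
     l * (1 - 1 / s) * (f (lie_eval (left_normed [gC, gA]) * lie_eval (left_normed [gC, gA])) - f (lie_eval (left_normed [gC, gB]) * lie_eval (left_normed [gC, gB])))"
  by (simp add: f_expand, simp only: F_sort,
      simp add: s_nonzero divide_simps del: mult_cancel_left mult_cancel_right,
      Groebner_Basis.algebra)

text \<open>The terms of length 5 all have multidegree (2,2,1). Those with the factor l have length
  4 and the multidegrees (3,1,0), (1,3,0), (1,1,2), obtained by trading two distinct letters for the
  third, as the relations do.\<close>

lemma relation_BAABC:
  "2 * (s + 1) ^ 2 * m [gB, gA, gA, gB, gC] =
     2 * (s + 1) * l * (m [gB, gA, gA, gA] - m [gB, gA, gB, gB] - m [gB, gA, gC, gC] + 2 * m [gC, gA, gB, gC])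
     - (2 * s ^ 2 + 5 * s + 2) * (mm [gB, gA, gA] [gC, gB] + mm [gB, gA, gB] [gC, gA])
     + (s ^ 2 + 3 * s + 1) * (2 * mm [gC, gA, gB] [gB, gA] - mm [gB, gA, gC] [gB, gA])"
  by (simp add: f_expand, simp only: F_sort,
      simp add: s_nonzero divide_simps del: mult_cancel_left mult_cancel_right,
      Groebner_Basis.algebra)

text \<open>Again one multidegree, (1,2,2), with corrections in (2,1,1), (0,3,1) and (0,1,3). The
  coefficient s on the left is a unit.\<close>

lemma relation_CBB_CA:
  "s * mm [gC, gB, gB] [gC, gA] =
     2 * (s + 1) * l * (m [gB, gA, gA, gC] + m [gC, gA, gA, gB] - m [gC, gB, gB, gB] + m [gC, gB, gC, gC])
     - (3 * s ^ 2 + 5 * s + 3) * mm [gB, gA, gC] [gC, gB] + (s ^ 2 + 3 * s + 1) * mm [gC, gA, gB] [gC, gB]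
     + (2 * s ^ 2 + 3 * s + 2) * mm [gC, gB, gC] [gB, gA] + 2 * (s + 1) ^ 2 * (m [gC, gA, gB, gB, gC] - m [gB, gA, gB, gC, gC])"
  by (simp add: f_expand, simp only: F_sort,
      simp add: s_nonzero divide_simps del: mult_cancel_left mult_cancel_right,
      Groebner_Basis.algebra)

lemma relation_CAA_CB:
  "s * mm [gC, gA, gA] [gC, gB] =
     2 * (s + 1) * l * (2 * m [gB, gA, gB, gC] - 2 * mm [gC, gB] [gB, gA] + m [gC, gA, gA, gA] - m [gC, gA, gB, gB] - m [gC, gA, gC, gC])
     - 2 * (s ^ 2 + 3 * s + 1) * mm [gB, gA, gC] [gC, gA] + (s ^ 2 + 3 * s + 1) * mm [gC, gA, gB] [gC, gA]
     + (2 * s ^ 2 + 5 * s + 2) * mm [gC, gA, gC] [gB, gA] + 2 * (s + 1) ^ 2 * m [gC, gA, gA, gB, gC]"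
  by (simp add: f_expand, simp only: F_sort,
      simp add: s_nonzero divide_simps del: mult_cancel_left mult_cancel_right,
      Groebner_Basis.algebra)

text \<open>Unlike the other three, this relation mixes the multidegrees (1,1,3), (3,1,1) and
  (1,3,1) and has no terms of length 4.\<close>

lemma relation_CAC_CB:
  "mm [gC, gA, gC] [gC, gB] = mm [gC, gB, gC] [gC, gA] + mm [gC, gA, gA] [gB, gA] - mm [gB, gA, gA] [gC, gA] + mm [gC, gB, gB] [gB, gA] - mm [gB, gA, gB] [gC, gB]"
proof -
  \<comment> \<open>The right-hand sides of the three square relations add up to zero.\<close>
  have "k * (x - y) + k * (z - x) + k * (y - z) = 0" for k x y z :: 'f
    by (simp add: algebra_simps)
  from this[of "l * (1 - 1 / s)" "f (lie_eval (left_normed [gB, gA]) * lie_eval (left_normed [gB, gA]))"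
      "f (lie_eval (left_normed [gC, gA]) * lie_eval (left_normed [gC, gA]))"
      "f (lie_eval (left_normed [gC, gB]) * lie_eval (left_normed [gC, gB]))"] show ?thesis
    unfolding square_relation_A[symmetric] square_relation_B[symmetric] square_relation_C[symmetric]
    by Groebner_Basis.algebra
qed

end

lemma aw_functionals_separate:
  fixes p :: "'f::field free_alg"
  assumes q: "q \<noteq> 0" "q ^ 4 \<noteq> 1" and p: "\<And>f. aw_functional q f \<Longrightarrow> f p = 0"
  shows "p \<in> aw_ideal q"
proof (rule ccontr)
  assume "p \<notin> aw_ideal q"
  interpret V: vector_space "\<lambda>(u::'f) (x::'f free_alg). const u * x"
    by unfold_locales (simp_all add: distrib_left distrib_right const_add const_mult_const mult.assoc[symmetric])
  interpret W: vector_space "(*) :: 'f \<Rightarrow> 'f \<Rightarrow> 'f"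
    by unfold_locales (simp_all add: algebra_simps)
  interpret VW: vector_space_pair "\<lambda>(u::'f) (x::'f free_alg). const u * x" "(*) :: 'f \<Rightarrow> 'f \<Rightarrow> 'f" ..
  have "V.subspace (aw_ideal q)"
    by (intro V.subspaceI aw_ideal_zero aw_ideal_add aw_ideal_mult(1))
  then have span: "V.span (aw_ideal q) = aw_ideal q"
    by (simp add: V.span_eq_iff)
  obtain B where B: "B \<subseteq> aw_ideal q" "V.independent B" "aw_ideal q \<subseteq> V.span B"
    using V.maximal_independent_subset by blast
  have "p \<notin> V.span B"
    using \<open>p \<notin> aw_ideal q\<close> V.span_mono[OF B(1)] span by blast
  then have "V.independent (insert p B)"
    using B(2) by (simp add: V.independent_insert)
  \<comment> \<open>The separating functional: 1 at p and 0 on a basis of the ideal, hence on the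
    whole ideal.\<close>
  from VW.linear_independent_extend[OF this, of "\<lambda>x. if x = p then 1 else 0"]
  obtain g where g: "Vector_Spaces.linear (\<lambda>(u::'f) (x::'f free_alg). const u * x) (*) g"
    and gB: "\<forall>x\<in>insert p B. g x = (if x = p then 1 else 0)" by blast
  interpret g: Vector_Spaces.linear "\<lambda>(u::'f) (x::'f free_alg). const u * x" "(*)" g by (rule g)
  have "p \<notin> B" using \<open>p \<notin> V.span B\<close> V.span_base by blast
  then have "g x = 0" if "x \<in> B" for x using gB that by auto
  then have "g x = 0" if "x \<in> V.span B" for x
    using VW.linear_eq_0_on_span[OF g _ that] by blast
  then have "aw_functional q g"
    using q B(3) by unfold_locales (auto simp: g.add g.scale)
  from p[OF this] gB show False by simp
qed

section \<open>Leading terms of the Hall elements\<close>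

abbreviation has_degree :: "nat \<Rightarrow> nat \<Rightarrow> nat \<Rightarrow> gen lie_monomial \<Rightarrow> bool" where
  "has_degree x y z T \<equiv> gen_count gA T = x \<and> gen_count gB T = y \<and> gen_count gC T = z"

context aw_parameter
begin

lemma s_nonzero: "s \<noteq> 0"
  using st by auto

lemma t_conv: "t = 1 / s"
  using st s_nonzero by (simp add: field_simps)

text \<open>Exponent zero stands for the monomial 1, so this is the value of f at the element
  computed with l = 0.\<close>

abbreviation leading :: "gen lie_monomial \<Rightarrow> 'f coord_fun \<Rightarrow> 'f" where
  "leading T f \<equiv> act_lie 0 f T 0 0 0 0 0 0"

lemmas act_graded_simps = left_normed_def act_A_apply act_B_rec act_C_rec

text \<open>These tables list PBW coordinates: the factor of \<open>f i j k a b c\<close> is the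
  coefficient of A^i B^j C^k a^a b^b c^c in the leading term. In length n at least 2, a monomial
  with m central factors has a coefficient divisible by (s - 1)^(n - 1 - m).\<close>

lemma leading_1:
  "leading (Letter gA) f =
     f 1 0 0 0 0 0"
  "leading (Letter gB) f =
     f 0 1 0 0 0 0"
  "leading (Letter gC) f =
     f 0 0 1 0 0 0"
  by (simp_all add: act_graded_simps eval_nat_numeral, (simp_all add: t_conv s_nonzero field_simps)?)

lemma leading_2:
  "leading (left_normed [gB,gA]) f =
     - (f 0 0 0 0 0 1) + (s-1)*f 1 1 0 0 0 0"
  "leading (left_normed [gC,gA]) f =
     t*f 0 0 0 0 1 0 - (s-1)*t*f 1 0 1 0 0 0"
  "leading (left_normed [gC,gB]) f =
     - (f 0 0 0 1 0 0) + (s-1)*f 0 1 1 0 0 0"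
  by (simp_all add: act_graded_simps eval_nat_numeral, (simp_all add: t_conv s_nonzero field_simps)?)

lemma leading_3:
  "leading (left_normed [gB,gA,gA]) f =
     - ((s-1)*f 1 0 0 0 0 1) + (s-1)^2*f 2 1 0 0 0 0"
  "leading (left_normed [gB,gA,gB]) f =
     (s-1)*f 0 1 0 0 0 1 - (s-1)^2*f 1 2 0 0 0 0"
  "leading (left_normed [gB,gA,gC]) f =
     - ((s-1)*t*f 0 1 0 0 1 0) + (s-1)*t*f 1 0 0 1 0 0"
  "leading (left_normed [gC,gA,gA]) f =
     - ((s-1)*t^2*f 1 0 0 0 1 0) + (s-1)^2*t^2*f 2 0 1 0 0 0"
  "leading (left_normed [gC,gA,gB]) f =
     - ((s-1)*t*f 0 0 1 0 0 1) + (s-1)*t*f 1 0 0 1 0 0"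
  "leading (left_normed [gC,gA,gC]) f =
     (s-1)*t^2*f 0 0 1 0 1 0 - (s-1)^2*t^2*f 1 0 2 0 0 0"
  "leading (left_normed [gC,gB,gB]) f =
     - ((s-1)*f 0 1 0 1 0 0) + (s-1)^2*f 0 2 1 0 0 0"
  "leading (left_normed [gC,gB,gC]) f =
     (s-1)*f 0 0 1 1 0 0 - (s-1)^2*f 0 1 2 0 0 0"
  by (simp_all add: act_graded_simps eval_nat_numeral, (simp_all add: t_conv s_nonzero field_simps)?)

lemma leading_4:
  "leading (Bracket (left_normed [gC,gA]) (left_normed [gB,gA])) f =
     - ((s-1)^2*t*f 1 0 1 0 0 1) - (s-1)^2*t^2*f 1 1 0 0 1 0 + (s-1)^2*t^2*f 2 0 0 1 0 0 + (s-1)^3*t*f 2 1 1 0 0 0"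
  "leading (Bracket (left_normed [gC,gB]) (left_normed [gB,gA])) f =
     (s-1)^2*t*f 0 0 0 1 0 1 - (s-1)^2*f 0 1 1 0 0 1 + (s-1)^2*t*f 0 2 0 0 1 0 - (s-1)^2*f 1 1 0 1 0 0 + (s-1)^3*f 1 2 1 0 0 0"
  "leading (Bracket (left_normed [gC,gB]) (left_normed [gC,gA])) f =
     (s-1)^2*t^2*f 0 0 2 0 0 1 - (s-1)^2*t^2*f 0 1 1 0 1 0 - (s-1)^2*t*f 1 0 1 1 0 0 + (s-1)^3*t*f 1 1 2 0 0 0"
  "leading (left_normed [gB,gA,gA,gA]) f =
     - ((s-1)^2*f 2 0 0 0 0 1) + (s-1)^3*f 3 1 0 0 0 0"
  "leading (left_normed [gB,gA,gA,gB]) f =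
     - ((s-1)*f 0 0 0 0 0 2) + (s-1)^2*(s + 2)*f 1 1 0 0 0 1 - (s-1)^3*(s + 1)*f 2 2 0 0 0 0"
  "leading (left_normed [gB,gA,gA,gC]) f =
     (s-1)*t*f 0 0 0 0 1 1 - (s-1)^2*t*f 1 0 1 0 0 1 - (s-1)^2*(t + t^2)*f 1 1 0 0 1 0 + (s-1)^2*t^2*f 2 0 0 1 0 0 + (s-1)^3*t*f 2 1 1 0 0 0"
  "leading (left_normed [gB,gA,gB,gB]) f =
     - ((s-1)^2*f 0 2 0 0 0 1) + (s-1)^3*f 1 3 0 0 0 0"
  "leading (left_normed [gB,gA,gB,gC]) f =
     (s-1)*f 0 0 0 1 0 1 - (s-1)^2*f 0 1 1 0 0 1 + (s-1)^2*t*f 0 2 0 0 1 0 - (s-1)^2*(1 + t)*f 1 1 0 1 0 0 + (s-1)^3*f 1 2 1 0 0 0"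
  "leading (left_normed [gB,gA,gC,gC]) f =
     - ((s-1)*(t + t^2)*f 0 0 0 1 1 0) + (s-1)^2*t*f 0 1 1 0 1 0 + (s-1)^2*t^2*f 1 0 1 1 0 0"
  "leading (left_normed [gC,gA,gA,gA]) f =
     (s-1)^2*t^3*f 2 0 0 0 1 0 - (s-1)^3*t^3*f 3 0 1 0 0 0"
  "leading (left_normed [gC,gA,gA,gB]) f =
     - ((s-1)*t^2*f 0 0 0 0 1 1) + (s-1)^2*(t + t^2)*f 1 0 1 0 0 1 + (s-1)^2*t^2*f 1 1 0 0 1 0 - (s-1)^2*t^2*f 2 0 0 1 0 0 - (s-1)^3*t*f 2 1 1 0 0 0"
  "leading (left_normed [gC,gA,gA,gC]) f =
     (s-1)*t^3*f 0 0 0 0 2 0 - (s-1)^2*(2*t^3 + t^4)*f 1 0 1 0 1 0 + (s-1)^3*(t^3 + t^4)*f 2 0 2 0 0 0"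
  "leading (left_normed [gC,gA,gB,gB]) f =
     (s-1)*2*t*f 0 0 0 1 0 1 - (s-1)^2*t*f 0 1 1 0 0 1 - (s-1)^2*t*f 1 1 0 1 0 0"
  "leading (left_normed [gC,gA,gB,gC]) f =
     - ((s-1)*t^2*f 0 0 0 1 1 0) + (s-1)^2*t^2*f 1 0 1 1 0 0"
  "leading (left_normed [gC,gA,gC,gC]) f =
     (s-1)^2*t^3*f 0 0 2 0 1 0 - (s-1)^3*t^3*f 1 0 3 0 0 0"
  "leading (left_normed [gC,gB,gB,gB]) f =
     - ((s-1)^2*f 0 2 0 1 0 0) + (s-1)^3*f 0 3 1 0 0 0"
  "leading (left_normed [gC,gB,gB,gC]) f =
     - ((s-1)*f 0 0 0 2 0 0) + (s-1)^2*(s + 2)*f 0 1 1 1 0 0 - (s-1)^3*(s + 1)*f 0 2 2 0 0 0"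
  "leading (left_normed [gC,gB,gC,gC]) f =
     - ((s-1)^2*f 0 0 2 1 0 0) + (s-1)^3*f 0 1 3 0 0 0"
  by (simp_all add: act_graded_simps eval_nat_numeral, (simp_all add: t_conv s_nonzero field_simps)?)

lemma leading_5:
  "leading (Bracket (left_normed [gB,gA,gA]) (left_normed [gB,gA])) f =
     - ((s-1)^2*f 1 0 0 0 0 2) + (s-1)^3*(s + 1)*f 2 1 0 0 0 1 - (s-1)^4*s*f 3 2 0 0 0 0"
  "leading (Bracket (left_normed [gB,gA,gA]) (left_normed [gC,gA])) f =
     - ((s-1)^2*t^2*f 1 0 0 0 1 1) + (s-1)^3*(t + t^2)*f 2 0 1 0 0 1 + (s-1)^3*(t^2 + t^3)*f 2 1 0 0 1 0 - (s-1)^3*t^3*f 3 0 0 1 0 0 - (s-1)^4*(t + t^2)*f 3 1 1 0 0 0"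
  "leading (Bracket (left_normed [gB,gA,gA]) (left_normed [gC,gB])) f =
     - ((s-1)^2*t*f 0 0 1 0 0 2) + (s-1)^2*(1 + t - t^2)*f 0 1 0 0 1 1 - (s-1)^3*(t + t^2)*f 1 0 0 1 0 1 + (s-1)^3*(1 + t)*f 1 1 1 0 0 1 - (s-1)^3*(1 + t)*f 1 2 0 0 1 0 + (s-1)^3*f 2 1 0 1 0 0 - (s-1)^4*f 2 2 1 0 0 0"
  "leading (Bracket (left_normed [gB,gA,gB]) (left_normed [gB,gA])) f =
     - ((s-1)^2*f 0 1 0 0 0 2) + (s-1)^3*(s + 1)*f 1 2 0 0 0 1 - (s-1)^4*s*f 2 3 0 0 0 0"
  "leading (Bracket (left_normed [gB,gA,gB]) (left_normed [gC,gA])) f =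
     (s-1)^2*t*f 0 0 1 0 0 2 - (s-1)^2*t*f 1 0 0 1 0 1 - (s-1)^3*(1 + t)*f 1 1 1 0 0 1 - (s-1)^3*t^2*f 1 2 0 0 1 0 + (s-1)^3*(t + t^2)*f 2 1 0 1 0 0 + (s-1)^4*f 2 2 1 0 0 0"
  "leading (Bracket (left_normed [gB,gA,gB]) (left_normed [gC,gB])) f =
     (s-1)^2*(s + 1 - t)*f 0 1 0 1 0 1 - (s-1)^3*(s + 1)*f 0 2 1 0 0 1 + (s-1)^3*t*f 0 3 0 0 1 0 - (s-1)^3*(s + 1)*f 1 2 0 1 0 0 + (s-1)^4*(s + 1)*f 1 3 1 0 0 0"
  "leading (Bracket (left_normed [gB,gA,gC]) (left_normed [gB,gA])) f =
     (s-1)^2*t*f 0 1 0 0 1 1 + (s-1)^2*t*f 1 0 0 1 0 1 - (s-1)^3*t*f 1 2 0 0 1 0 - (s-1)^3*t*f 2 1 0 1 0 0"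
  "leading (Bracket (left_normed [gB,gA,gC]) (left_normed [gC,gA])) f =
     - ((s-1)^2*t^2*f 0 0 1 0 1 1) + (s-1)^2*(t^2 + t^3)*f 1 0 0 1 1 0 - (s-1)^3*t^3*f 2 0 1 1 0 0"
  "leading (Bracket (left_normed [gB,gA,gC]) (left_normed [gC,gB])) f =
     (s-1)^2*t^2*f 0 0 1 1 0 1 - (s-1)^2*(t + t^2)*f 0 1 0 1 1 0 + (s-1)^3*t*f 0 2 1 0 1 0"
  "leading (Bracket (left_normed [gC,gA,gA]) (left_normed [gB,gA])) f =
     - ((s-1)^2*t^2*f 1 0 0 0 1 1) + (s-1)^3*(t + t^2)*f 2 0 1 0 0 1 + (s-1)^3*(t^2 + t^3)*f 2 1 0 0 1 0 - (s-1)^3*t^3*f 3 0 0 1 0 0 - (s-1)^4*(t + t^2)*f 3 1 1 0 0 0"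
  "leading (Bracket (left_normed [gC,gA,gA]) (left_normed [gC,gA])) f =
     - ((s-1)^2*t^4*f 1 0 0 0 2 0) + (s-1)^3*(t^4 + t^5)*f 2 0 1 0 1 0 - (s-1)^4*t^5*f 3 0 2 0 0 0"
  "leading (Bracket (left_normed [gC,gA,gB]) (left_normed [gB,gA])) f =
     - ((s-1)^2*t^2*f 0 1 0 0 1 1) + (s-1)^2*(t + t^2)*f 1 0 0 1 0 1 - (s-1)^3*t*f 2 1 0 1 0 0"
  "leading (Bracket (left_normed [gC,gA,gB]) (left_normed [gC,gA])) f =
     (s-1)^2*t^3*f 0 0 1 0 1 1 + (s-1)^2*t^3*f 1 0 0 1 1 0 - (s-1)^3*t^3*f 1 0 2 0 0 1 - (s-1)^3*t^3*f 2 0 1 1 0 0"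
  "leading (Bracket (left_normed [gC,gA,gB]) (left_normed [gC,gB])) f =
     (s-1)^2*(t + t^2)*f 0 0 1 1 0 1 - (s-1)^2*t^2*f 0 1 0 1 1 0 - (s-1)^3*t*f 0 1 2 0 0 1"
  "leading (Bracket (left_normed [gC,gA,gC]) (left_normed [gB,gA])) f =
     (s-1)^2*t^3*f 0 1 0 0 2 0 + (s-1)^2*(t^2 - t^3 - t^4)*f 1 0 0 1 1 0 - (s-1)^3*t^2*f 1 0 2 0 0 1 - (s-1)^3*(t^2 + t^3)*f 1 1 1 0 1 0 + (s-1)^3*(t^3 + t^4)*f 2 0 1 1 0 0 + (s-1)^4*t^2*f 2 1 2 0 0 0"
  "leading (Bracket (left_normed [gC,gA,gC]) (left_normed [gC,gA])) f =
     - ((s-1)^2*t^4*f 0 0 1 0 2 0) + (s-1)^3*(t^4 + t^5)*f 1 0 2 0 1 0 - (s-1)^4*t^5*f 2 0 3 0 0 0"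
  "leading (Bracket (left_normed [gC,gB,gB]) (left_normed [gB,gA])) f =
     (s-1)^2*(s + 1 - t)*f 0 1 0 1 0 1 - (s-1)^3*(s + 1)*f 0 2 1 0 0 1 + (s-1)^3*t*f 0 3 0 0 1 0 - (s-1)^3*(s + 1)*f 1 2 0 1 0 0 + (s-1)^4*(s + 1)*f 1 3 1 0 0 0"
  "leading (Bracket (left_normed [gC,gB,gB]) (left_normed [gC,gB])) f =
     - ((s-1)^2*f 0 1 0 2 0 0) + (s-1)^3*(s + 1)*f 0 2 1 1 0 0 - (s-1)^4*s*f 0 3 2 0 0 0"
  "leading (Bracket (left_normed [gC,gB,gC]) (left_normed [gB,gA])) f =
     - ((s-1)^3*(t + t^2)*f 0 0 1 1 0 1) + (s-1)^2*(1 + t - t^2)*f 0 1 0 1 1 0 + (s-1)^3*f 0 1 2 0 0 1 - (s-1)^3*(1 + t)*f 0 2 1 0 1 0 - (s-1)^2*t*f 1 0 0 2 0 0 + (s-1)^3*(1 + t)*f 1 1 1 1 0 0 - (s-1)^4*f 1 2 2 0 0 0"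
  "leading (Bracket (left_normed [gC,gB,gC]) (left_normed [gC,gA])) f =
     - ((s-1)^2*t^2*f 0 0 1 1 1 0) - (s-1)^3*t^3*f 0 0 3 0 0 1 + (s-1)^3*(t^2 + t^3)*f 0 1 2 0 1 0 + (s-1)^3*(t + t^2)*f 1 0 2 1 0 0 - (s-1)^4*(t + t^2)*f 1 1 3 0 0 0"
  "leading (Bracket (left_normed [gC,gB,gC]) (left_normed [gC,gB])) f =
     - ((s-1)^2*f 0 0 1 2 0 0) + (s-1)^3*(s + 1)*f 0 1 2 1 0 0 - (s-1)^4*s*f 0 2 3 0 0 0"
  "leading (left_normed [gB,gA,gA,gA,gA]) f =
     - ((s-1)^3*f 3 0 0 0 0 1) + (s-1)^4*f 4 1 0 0 0 0"
  "leading (left_normed [gB,gA,gA,gA,gB]) f =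
     - ((s-1)^2*(s + 1)*f 1 0 0 0 0 2) + (s-1)^3*(s^2 + 2*s + 2)*f 2 1 0 0 0 1 - (s-1)^4*(s^2 + s + 1)*f 3 2 0 0 0 0"
  "leading (left_normed [gB,gA,gA,gA,gC]) f =
     (s-1)^2*(t + t^2)*f 1 0 0 0 1 1 - (s-1)^3*(t + t^2)*f 2 0 1 0 0 1 - (s-1)^3*(t + t^2 + t^3)*f 2 1 0 0 1 0 + (s-1)^3*t^3*f 3 0 0 1 0 0 + (s-1)^4*(t + t^2)*f 3 1 1 0 0 0"
  "leading (left_normed [gB,gA,gA,gB,gB]) f =
     (s-1)^2*(s + 2)*f 0 1 0 0 0 2 - (s-1)^3*(s^2 + 3*s + 3)*f 1 2 0 0 0 1 + (s-1)^4*(s^2 + 2*s + 1)*f 2 3 0 0 0 0"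
  "leading (left_normed [gB,gA,gA,gC,gC]) f =
     (s-1)^2*t^2*f 0 0 1 0 1 1 + (s-1)^2*(t^2 + t^3)*f 0 1 0 0 2 0 - (s-1)^2*(t^2 + 2*t^3 + t^4)*f 1 0 0 1 1 0 - (s-1)^3*t^2*f 1 0 2 0 0 1 - (s-1)^3*(t^2 + t^3)*f 1 1 1 0 1 0 + (s-1)^3*(2*t^3 + t^4)*f 2 0 1 1 0 0 + (s-1)^4*t^2*f 2 1 2 0 0 0"
  "leading (left_normed [gB,gA,gB,gB,gB]) f =
     (s-1)^3*f 0 3 0 0 0 1 - (s-1)^4*f 1 4 0 0 0 0"
  "leading (left_normed [gB,gA,gB,gB,gC]) f =
     - ((s-1)^2*(s + 1)*f 0 1 0 1 0 1) + (s-1)^3*(s + 1)*f 0 2 1 0 0 1 - (s-1)^3*t*f 0 3 0 0 1 0 + (s-1)^3*(s + 1 + t)*f 1 2 0 1 0 0 - (s-1)^4*(s + 1)*f 1 3 1 0 0 0"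
  "leading (left_normed [gB,gA,gB,gC,gC]) f =
     - ((s-1)^2*f 0 0 1 1 0 1) + (s-1)^2*(1 + 2*t + t^2)*f 0 1 0 1 1 0 + (s-1)^3*f 0 1 2 0 0 1 - (s-1)^3*(1 + 2*t)*f 0 2 1 0 1 0 - (s-1)^2*(t + t^2)*f 1 0 0 2 0 0 + (s-1)^3*(1 + t)*f 1 1 1 1 0 0 - (s-1)^4*f 1 2 2 0 0 0"
  "leading (left_normed [gB,gA,gC,gC,gC]) f =
     (s-1)^3*(t^2 + t^3)*f 0 0 1 1 1 0 - (s-1)^3*t*f 0 1 2 0 1 0 + (s-1)^3*t^3*f 1 0 2 1 0 0"
  "leading (left_normed [gC,gA,gA,gA,gA]) f =
     - ((s-1)^3*t^4*f 3 0 0 0 1 0) + (s-1)^4*t^4*f 4 0 1 0 0 0"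
  "leading (left_normed [gC,gA,gA,gA,gB]) f =
     (s-1)^2*(t^2 + t^3)*f 1 0 0 0 1 1 - (s-1)^3*(t + t^2 + t^3)*f 2 0 1 0 0 1 - (s-1)^3*(t^2 + t^3)*f 2 1 0 0 1 0 + (s-1)^3*t^3*f 3 0 0 1 0 0 + (s-1)^4*(t + t^2)*f 3 1 1 0 0 0"
  "leading (left_normed [gC,gA,gA,gA,gC]) f =
     - ((s-1)^2*(t^4 + t^5)*f 1 0 0 0 2 0) + (s-1)^3*(2*t^4 + 2*t^5 + t^6)*f 2 0 1 0 1 0 - (s-1)^4*(t^4 + t^5 + t^6)*f 3 0 2 0 0 0"
  "leading (left_normed [gC,gA,gA,gB,gB]) f =
     (s-1)^2*(t + t^2)*f 0 0 1 0 0 2 + (s-1)^2*t^2*f 0 1 0 0 1 1 - (s-1)^2*(2*t + 2*t^2)*f 1 0 0 1 0 1 - (s-1)^3*(1 + t)*f 1 1 1 0 0 1 - (s-1)^3*t^2*f 1 2 0 0 1 0 + (s-1)^3*(2*t + t^2)*f 2 1 0 1 0 0 + (s-1)^4*f 2 2 1 0 0 0"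
  "leading (left_normed [gC,gA,gA,gB,gC]) f =
     - ((s-1)^2*(t^2 + t^3)*f 0 0 1 0 1 1) - (s-1)^2*t^3*f 0 1 0 0 2 0 + (s-1)^2*(2*t^3 + t^4)*f 1 0 0 1 1 0 + (s-1)^3*(t^2 + t^3)*f 1 0 2 0 0 1 + (s-1)^3*(t^2 + t^3)*f 1 1 1 0 1 0 - (s-1)^3*(2*t^3 + t^4)*f 2 0 1 1 0 0 - (s-1)^4*t^2*f 2 1 2 0 0 0"
  "leading (left_normed [gC,gA,gA,gC,gC]) f =
     (s-1)^2*(2*t^4 + t^5)*f 0 0 1 0 2 0 - (s-1)^3*(3*t^4 + 3*t^5 + t^6)*f 1 0 2 0 1 0 + (s-1)^4*(t^4 + 2*t^5 + t^6)*f 2 0 3 0 0 0"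
  "leading (left_normed [gC,gA,gB,gB,gB]) f =
     - ((s-1)^3*t*f 0 2 1 0 0 1) + (s-1)^3*t*f 1 2 0 1 0 0"
  "leading (left_normed [gC,gA,gB,gB,gC]) f =
     - ((s-1)^2*t*f 0 0 1 1 0 1) + (s-1)^2*t^2*f 0 1 0 1 1 0 + (s-1)^3*t*f 0 1 2 0 0 1 - (s-1)^2*t^2*f 1 0 0 2 0 0"
  "leading (left_normed [gC,gA,gB,gC,gC]) f =
     - ((s-1)^2*t^3*f 0 0 1 1 1 0) + (s-1)^3*t^3*f 1 0 2 1 0 0"
  "leading (left_normed [gC,gA,gC,gC,gC]) f =
     (s-1)^3*t^4*f 0 0 3 0 1 0 - (s-1)^4*t^4*f 1 0 4 0 0 0"
  "leading (left_normed [gC,gB,gB,gB,gB]) f =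
     - ((s-1)^3*f 0 3 0 1 0 0) + (s-1)^4*f 0 4 1 0 0 0"
  "leading (left_normed [gC,gB,gB,gB,gC]) f =
     - ((s-1)^2*(s + 1)*f 0 1 0 2 0 0) + (s-1)^3*(s^2 + 2*s + 2)*f 0 2 1 1 0 0 - (s-1)^4*(s^2 + s + 1)*f 0 3 2 0 0 0"
  "leading (left_normed [gC,gB,gB,gC,gC]) f =
     (s-1)^2*(s + 2)*f 0 0 1 2 0 0 - (s-1)^3*(s^2 + 3*s + 3)*f 0 1 2 1 0 0 + (s-1)^4*(s^2 + 2*s + 1)*f 0 2 3 0 0 0"
  "leading (left_normed [gC,gB,gC,gC,gC]) f =
     (s-1)^3*f 0 0 3 1 0 0 - (s-1)^4*f 0 1 4 0 0 0"
  by (simp_all add: act_graded_simps eval_nat_numeral, (simp_all add: t_conv s_nonzero field_simps)?)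

text \<open>In contrast to Hall elements of length 4, the purely central monomial has a coefficient
  without a factor s - 1; this tells squares from Lie elements.\<close>

lemma leading_square:
  "leading (left_normed [gB,gA]) (act_lie 0 f (left_normed [gB,gA])) =
     f 0 0 0 0 0 2 - (s-1)*(s + 1)*f 1 1 0 0 0 1 + (s-1)^2*s*f 2 2 0 0 0 0"
  "leading (left_normed [gC,gA]) (act_lie 0 f (left_normed [gC,gA])) =
     t^2*f 0 0 0 0 2 0 - (s-1)*(t^2 + t^3)*f 1 0 1 0 1 0 + (s-1)^2*t^3*f 2 0 2 0 0 0"
  "leading (left_normed [gC,gB]) (act_lie 0 f (left_normed [gC,gB])) =
     f 0 0 0 2 0 0 - (s-1)*(s + 1)*f 0 1 1 1 0 0 + (s-1)^2*s*f 0 2 2 0 0 0"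
  by (simp_all add: act_graded_simps eval_nat_numeral, (simp_all add: t_conv s_nonzero field_simps)?)

section \<open>Extracting leading relations by functionals of one multidegree\<close>

definition restrict_degree :: "nat \<Rightarrow> nat \<Rightarrow> nat \<Rightarrow> 'f coord_fun \<Rightarrow> 'f coord_fun" where
  "restrict_degree x y z f i j k a b c =
     (if i + b + c = x \<and> j + a + c = y \<and> k + a + b = z then f i j k a b c else 0)"

lemma restrict_degree:
  "agree_at x y z (restrict_degree x y z f) f"
  "(x', y', z') \<noteq> (x, y, z) \<Longrightarrow> agree_at x' y' z' (restrict_degree x y z f) (\<lambda>i j k a b c. 0)"
  "vanish_below (x + y + z) (restrict_degree x y z f)"
  by (auto simp: agree_at_def vanish_below_def restrict_degree_def)

lemma act_lie_zero_fun: "act_lie l (\<lambda>i j k a b c. 0) T = (\<lambda>i j k a b c. 0)"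
  by (intro ext) (simp add: act_lie_eval[symmetric] act_zero_fun)

lemma leading_restrict_degree:
  "leading T (restrict_degree x y z f) = (if has_degree x y z T then leading T f else 0)"
proof (cases "has_degree x y z T")
  case True
  with act_lie_homogeneous[of 0 T 0 0 "restrict_degree x y z f" f] restrict_degree(1)[of x y z f]
  have "agree_at 0 0 0 (act_lie 0 (restrict_degree x y z f) T) (act_lie 0 f T)" by auto
  from agree_atD[OF this] True show ?thesis by simp
next
  case False
  with act_lie_homogeneous[of 0 T 0 0 "restrict_degree x y z f" "\<lambda>i j k a b c. 0"]
    restrict_degree(2)[of "gen_count gA T" "gen_count gB T" "gen_count gC T" x y z f]
  have "agree_at 0 0 0 (act_lie 0 (restrict_degree x y z f) T) (act_lie 0 (\<lambda>i j k a b c. 0) T)" by auto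
  from agree_atD[OF this, of 0 0 0 0 0 0] False show ?thesis by (auto simp: act_lie_zero_fun)
qed

text \<open>The functional vanishes below N = x + y + z, so agreement of the actions for l and 0
  holds below \<open>Suc N - lie_length T\<close>. This is positive even for length N, so exponent
  zero is covered.\<close>

lemma act_lie_restrict_degree:
  assumes "lie_length T \<le> x + y + z"
  shows "act_lie l (restrict_degree x y z f) T 0 0 0 0 0 0 = (if has_degree x y z T then leading T f else 0)"
proof -
  have "act_lie l (restrict_degree x y z f) T 0 0 0 0 0 0 = leading T (restrict_degree x y z f)"
    using agree_belowD[OF act_lie_filtered(2)[OF restrict_degree(3)[of x y z f], of T l], of 0 0 0 0 0 0] assms
    by simp
  then show ?thesis by (simp only: leading_restrict_degree)
qed

text \<open>The remainder e is an arbitrary function of f. It makes room for the part of a relation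
  whose length exceeds x + y + z but whose value drops in degree.\<close>

lemma leading_relation:
  assumes rel: "\<And>f. (\<Sum>T\<leftarrow>Ts. u T * act_lie l f T 0 0 0 0 0 0) + e f = 0"
    and Ts: "\<And>T. T \<in> set Ts \<Longrightarrow> u T = 0 \<or> lie_length T \<le> x + y + z"
  shows "(\<Sum>T\<leftarrow>filter (has_degree x y z) Ts. u T * leading T f) + e (restrict_degree x y z f) = 0"
proof -
  have "u T * act_lie l (restrict_degree x y z f) T 0 0 0 0 0 0 = (if has_degree x y z T then u T * leading T f else 0)"
    if "T \<in> set Ts" for T
    using Ts[OF that] act_lie_restrict_degree[of T x y z l f] by auto
  then have "(\<Sum>T\<leftarrow>Ts. u T * act_lie l (restrict_degree x y z f) T 0 0 0 0 0 0)
      = (\<Sum>T\<leftarrow>Ts. if has_degree x y z T then u T * leading T f else 0)"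
    by (intro arg_cong[where f = sum_list] map_cong) simp_all
  also have "\<dots> = (\<Sum>T\<leftarrow>filter (has_degree x y z) Ts. u T * leading T f)"
    by (simp add: sum_list_map_filter')
  finally show ?thesis using rel[of "restrict_degree x y z f"] by simp
qed

text \<open>The same extraction for the associative product UV, needed for squares.\<close>

lemma act_lie_twice_restrict_degree:
  assumes "lie_length U + lie_length V \<le> x + y + z"
  shows "act_lie l (act_lie l (restrict_degree x y z f) U) V 0 0 0 0 0 0 =
     (if gen_count gA U + gen_count gA V = x \<and> gen_count gB U + gen_count gB V = y \<and> gen_count gC U + gen_count gC V = z
      then leading V (act_lie 0 f U) else 0)"
proof -
  let ?g = "restrict_degree x y z f"
  have U: "vanish_below (x + y + z - lie_length U) (act_lie l ?g U)"
    "agree_below (Suc (x + y + z) - lie_length U) (act_lie l ?g U) (act_lie 0 ?g U)"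
    by (intro act_lie_filtered restrict_degree(3))+
  note V = act_lie_filtered[OF U(1), where l = l and T = V]
  have "act_lie l (act_lie l ?g U) V 0 0 0 0 0 0 = leading V (act_lie 0 ?g U)"
    using agree_belowD[OF act_lie_filtered_Bracket(2)[OF U(2) V], of 0 0 0 0 0 0] assms by simp
  also have "\<dots> = (if gen_count gA U + gen_count gA V = x \<and> gen_count gB U + gen_count gB V = y
      \<and> gen_count gC U + gen_count gC V = z then leading V (act_lie 0 f U) else 0)"
  proof -
    let ?x = "gen_count gA V + gen_count gA U" and ?y = "gen_count gB V + gen_count gB U"
      and ?z = "gen_count gC V + gen_count gC U"
    have *: "leading V (act_lie 0 ?g U) = leading V (act_lie 0 h U)" if "agree_at ?x ?y ?z ?g h" for h
    proof -
      have "agree_at (gen_count gA V) (gen_count gB V) (gen_count gC V) (act_lie 0 ?g U) (act_lie 0 h U)"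
        by (rule act_lie_homogeneous) (rule that)
      then have "agree_at 0 0 0 (act_lie 0 (act_lie 0 ?g U) V) (act_lie 0 (act_lie 0 h U) V)"
        using act_lie_homogeneous[of 0 V 0 0 "act_lie 0 ?g U" "act_lie 0 h U"] by simp
      from agree_atD[OF this] show ?thesis by simp
    qed
    show ?thesis
    proof (cases "(?x, ?y, ?z) = (x, y, z)")
      case True
      then show ?thesis using *[of f] restrict_degree(1)[of x y z f] by (auto simp: add.commute)
    next
      case False
      then show ?thesis
        using *[OF restrict_degree(2)[OF False]] by (auto simp: act_lie_zero_fun add.commute)
    qed
  qed
  finally show ?thesis .
qed

definition coord :: "nat \<Rightarrow> nat \<Rightarrow> nat \<Rightarrow> nat \<Rightarrow> nat \<Rightarrow> nat \<Rightarrow> 'f coord_fun" where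
  "coord i j k a b c i' j' k' a' b' c' =
     (if i' = i \<and> j' = j \<and> k' = k \<and> a' = a \<and> b' = b \<and> c' = c then 1 else 0)"

text \<open>Here y is a relation evaluated at a coordinate functional, and v clears the powers of t
  = 1/s and the sign.\<close>

lemma clear_factor:
  assumes "y = 0" "s \<noteq> 1" "(s - 1) ^ n * e = v * y"
  shows "e = 0"
  using assms by simp

section \<open>Independence of leading terms, with the multidegree as suffix\<close>

lemma leading_independent_320:
  assumes "s \<noteq> 1"
    and rel: "\<And>f. x1 * leading (Bracket (left_normed [gB,gA,gA]) (left_normed [gB,gA])) f + x2 * leading (left_normed [gB,gA,gA,gA,gB]) f = 0"
  shows "x1 = 0 \<and> x2 = 0"
proof -
  \<comment> \<open>The coefficients at A c^2 and A^3 B^2 give a system of determinant 1.\<close>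
  have e1: "x1 + (s + 1) * x2 = 0"
    by (rule clear_factor[OF rel[of "coord 1 0 0 0 0 2"] assms(1), of 2 _ "- 1"])
      (simp only: leading_5, simp add: coord_def t_conv s_nonzero field_simps eval_nat_numeral)
  have e2: "s * x1 + (s ^ 2 + s + 1) * x2 = 0"
    by (rule clear_factor[OF rel[of "coord 3 2 0 0 0 0"] assms(1), of 4 _ "- 1"])
      (simp only: leading_5, simp add: coord_def t_conv s_nonzero field_simps eval_nat_numeral)
  have "x1 = 0"
    using e1 e2 by Groebner_Basis.algebra
  moreover have "x2 = 0"
    using e1 e2 by Groebner_Basis.algebra
  ultimately show ?thesis using s_nonzero assms by (simp add: add_eq_0_iff2)
qed

lemma leading_independent_230:
  assumes "s \<noteq> 1"
    and rel: "\<And>f. x1 * leading (Bracket (left_normed [gB,gA,gB]) (left_normed [gB,gA])) f + x2 * leading (left_normed [gB,gA,gA,gB,gB]) f = 0"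
  shows "x1 = 0 \<and> x2 = 0"
proof -
  have e1: "x1 - (s + 2) * x2 = 0"
    by (rule clear_factor[OF rel[of "coord 0 1 0 0 0 2"] assms(1), of 2 _ "- 1"])
      (simp only: leading_5, simp add: coord_def t_conv s_nonzero field_simps eval_nat_numeral)
  have e2: "s * x1 - (s ^ 2 + 2 * s + 1) * x2 = 0"
    by (rule clear_factor[OF rel[of "coord 2 3 0 0 0 0"] assms(1), of 4 _ "- 1"])
      (simp only: leading_5, simp add: coord_def t_conv s_nonzero field_simps eval_nat_numeral)
  have "x1 = 0"
    using e1 e2 by Groebner_Basis.algebra
  moreover have "x2 = 0"
    using e1 e2 by Groebner_Basis.algebra
  ultimately show ?thesis using s_nonzero assms by (simp add: add_eq_0_iff2)
qed

lemma leading_independent_302: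
  assumes "s \<noteq> 1"
    and rel: "\<And>f. x1 * leading (Bracket (left_normed [gC,gA,gA]) (left_normed [gC,gA])) f + x2 * leading (left_normed [gC,gA,gA,gA,gC]) f = 0"
  shows "x1 = 0 \<and> x2 = 0"
proof -
  have e1: "s * x1 + (s + 1) * x2 = 0"
    by (rule clear_factor[OF rel[of "coord 1 0 0 0 2 0"] assms(1), of 2 _ "- (s ^ 5)"])
      (simp only: leading_5, simp add: coord_def t_conv s_nonzero field_simps eval_nat_numeral)
  have e2: "s * x1 + (s ^ 2 + s + 1) * x2 = 0"
    by (rule clear_factor[OF rel[of "coord 3 0 2 0 0 0"] assms(1), of 4 _ "- (s ^ 6)"])
      (simp only: leading_5, simp add: coord_def t_conv s_nonzero field_simps eval_nat_numeral)
  \<comment> \<open>The determinant of the two equations is s^3.\<close>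
  have "s ^ 3 * x1 = 0"
    using e1 e2 by Groebner_Basis.algebra
  moreover have "s ^ 3 * x2 = 0"
    using e1 e2 by Groebner_Basis.algebra
  ultimately show ?thesis using s_nonzero assms by (simp add: add_eq_0_iff2)
qed

lemma leading_independent_203:
  assumes "s \<noteq> 1"
    and rel: "\<And>f. x1 * leading (Bracket (left_normed [gC,gA,gC]) (left_normed [gC,gA])) f + x2 * leading (left_normed [gC,gA,gA,gC,gC]) f = 0"
  shows "x1 = 0 \<and> x2 = 0"
proof -
  have e1: "s * x1 - (2 * s + 1) * x2 = 0"
    by (rule clear_factor[OF rel[of "coord 0 0 1 0 2 0"] assms(1), of 2 _ "- (s ^ 5)"])
      (simp only: leading_5, simp add: coord_def t_conv s_nonzero field_simps eval_nat_numeral)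
  have e2: "s * x1 - (s ^ 2 + 2 * s + 1) * x2 = 0"
    by (rule clear_factor[OF rel[of "coord 2 0 3 0 0 0"] assms(1), of 4 _ "- (s ^ 6)"])
      (simp only: leading_5, simp add: coord_def t_conv s_nonzero field_simps eval_nat_numeral)
  have "s ^ 3 * x1 = 0"
    using e1 e2 by Groebner_Basis.algebra
  moreover have "s ^ 3 * x2 = 0"
    using e1 e2 by Groebner_Basis.algebra
  ultimately show ?thesis using s_nonzero assms by (simp add: add_eq_0_iff2)
qed

lemma leading_independent_032:
  assumes "s \<noteq> 1"
    and rel: "\<And>f. x1 * leading (Bracket (left_normed [gC,gB,gB]) (left_normed [gC,gB])) f + x2 * leading (left_normed [gC,gB,gB,gB,gC]) f = 0"
  shows "x1 = 0 \<and> x2 = 0"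
proof -
  have e1: "x1 + (s + 1) * x2 = 0"
    by (rule clear_factor[OF rel[of "coord 0 1 0 2 0 0"] assms(1), of 2 _ "- 1"])
      (simp only: leading_5, simp add: coord_def t_conv s_nonzero field_simps eval_nat_numeral)
  have e2: "s * x1 + (s ^ 2 + s + 1) * x2 = 0"
    by (rule clear_factor[OF rel[of "coord 0 3 2 0 0 0"] assms(1), of 4 _ "- 1"])
      (simp only: leading_5, simp add: coord_def t_conv s_nonzero field_simps eval_nat_numeral)
  have "x1 = 0"
    using e1 e2 by Groebner_Basis.algebra
  moreover have "x2 = 0"
    using e1 e2 by Groebner_Basis.algebra
  ultimately show ?thesis using s_nonzero assms by (simp add: add_eq_0_iff2)
qed

lemma leading_independent_113:
  assumes "s \<noteq> 1"
    and rel: "\<And>f. x1 * leading (Bracket (left_normed [gC,gB,gC]) (left_normed [gC,gA])) f + x2 * leading (left_normed [gB,gA,gC,gC,gC]) f + x3 * leading (left_normed [gC,gA,gB,gC,gC]) f = 0"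
  shows "x1 = 0 \<and> x2 = 0 \<and> x3 = 0"
proof -
  have e1: "s * x1 - (s ^ 2 - 1) * x2 + x3 = 0"
    by (rule clear_factor[OF rel[of "coord 0 0 1 1 1 0"] assms(1), of 2 _ "- (s ^ 3)"])
      (simp only: leading_5, simp add: coord_def t_conv s_nonzero field_simps eval_nat_numeral)
  \<comment> \<open>Only [[CBC],[CA]] contains the monomial C^3 c.\<close>
  have e2: "x1 = 0"
    by (rule clear_factor[OF rel[of "coord 0 0 3 0 0 1"] assms(1), of 3 _ "- (s ^ 3)"])
      (simp only: leading_5, simp add: coord_def t_conv s_nonzero field_simps eval_nat_numeral)
  have e3: "(s + 1) * x1 - s ^ 2 * x2 = 0"
    by (rule clear_factor[OF rel[of "coord 0 1 2 0 1 0"] assms(1), of 3 _ "s ^ 3"])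
      (simp only: leading_5, simp add: coord_def t_conv s_nonzero field_simps eval_nat_numeral)
  have "s ^ 2 * x1 = 0"
    using e1 e2 e3 by Groebner_Basis.algebra
  moreover have "s ^ 2 * x2 = 0"
    using e1 e2 e3 by Groebner_Basis.algebra
  moreover have "s ^ 2 * x3 = 0"
    using e1 e2 e3 by Groebner_Basis.algebra
  ultimately show ?thesis using s_nonzero assms by (simp add: add_eq_0_iff2)
qed

lemma leading_independent_023:
  assumes "s \<noteq> 1"
    and rel: "\<And>f. x1 * leading (Bracket (left_normed [gC,gB,gC]) (left_normed [gC,gB])) f + x2 * leading (left_normed [gC,gB,gB,gC,gC]) f = 0"
  shows "x1 = 0 \<and> x2 = 0"
proof -
  have e1: "x1 - (s + 2) * x2 = 0"
    by (rule clear_factor[OF rel[of "coord 0 0 1 2 0 0"] assms(1), of 2 _ "- 1"])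
      (simp only: leading_5, simp add: coord_def t_conv s_nonzero field_simps eval_nat_numeral)
  have e2: "s * x1 - (s ^ 2 + 2 * s + 1) * x2 = 0"
    by (rule clear_factor[OF rel[of "coord 0 2 3 0 0 0"] assms(1), of 4 _ "- 1"])
      (simp only: leading_5, simp add: coord_def t_conv s_nonzero field_simps eval_nat_numeral)
  have "x1 = 0"
    using e1 e2 by Groebner_Basis.algebra
  moreover have "x2 = 0"
    using e1 e2 by Groebner_Basis.algebra
  ultimately show ?thesis using s_nonzero assms by (simp add: add_eq_0_iff2)
qed

lemma leading_independent_410:
  assumes "s \<noteq> 1"
    and rel: "\<And>f. x1 * leading (left_normed [gB,gA,gA,gA,gA]) f = 0"
  shows "x1 = 0"
proof -
  have e1: "x1 = 0"
    by (rule clear_factor[OF rel[of "coord 3 0 0 0 0 1"] assms(1), of 3 _ "- 1"])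
      (simp only: leading_5, simp add: coord_def t_conv s_nonzero field_simps eval_nat_numeral)
  from e1 show ?thesis using s_nonzero by simp
qed

lemma leading_independent_140:
  assumes "s \<noteq> 1"
    and rel: "\<And>f. x1 * leading (left_normed [gB,gA,gB,gB,gB]) f = 0"
  shows "x1 = 0"
proof -
  have e1: "x1 = 0"
    by (rule clear_factor[OF rel[of "coord 0 3 0 0 0 1"] assms(1), of 3 _ "1"])
      (simp only: leading_5, simp add: coord_def t_conv s_nonzero field_simps eval_nat_numeral)
  from e1 show ?thesis using s_nonzero by simp
qed

lemma leading_independent_401:
  assumes "s \<noteq> 1"
    and rel: "\<And>f. x1 * leading (left_normed [gC,gA,gA,gA,gA]) f = 0"
  shows "x1 = 0"
proof -
  have e1: "x1 = 0"
    by (rule clear_factor[OF rel[of "coord 3 0 0 0 1 0"] assms(1), of 3 _ "- (s ^ 4)"])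
      (simp only: leading_5, simp add: coord_def t_conv s_nonzero field_simps eval_nat_numeral)
  from e1 show ?thesis using s_nonzero by simp
qed

lemma leading_independent_104:
  assumes "s \<noteq> 1"
    and rel: "\<And>f. x1 * leading (left_normed [gC,gA,gC,gC,gC]) f = 0"
  shows "x1 = 0"
proof -
  have e1: "x1 = 0"
    by (rule clear_factor[OF rel[of "coord 0 0 3 0 1 0"] assms(1), of 3 _ "s ^ 4"])
      (simp only: leading_5, simp add: coord_def t_conv s_nonzero field_simps eval_nat_numeral)
  from e1 show ?thesis using s_nonzero by simp
qed

lemma leading_independent_041:
  assumes "s \<noteq> 1"
    and rel: "\<And>f. x1 * leading (left_normed [gC,gB,gB,gB,gB]) f = 0"
  shows "x1 = 0"
proof -
  have e1: "x1 = 0"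
    by (rule clear_factor[OF rel[of "coord 0 3 0 1 0 0"] assms(1), of 3 _ "- 1"])
      (simp only: leading_5, simp add: coord_def t_conv s_nonzero field_simps eval_nat_numeral)
  from e1 show ?thesis using s_nonzero by simp
qed

lemma leading_independent_014:
  assumes "s \<noteq> 1"
    and rel: "\<And>f. x1 * leading (left_normed [gC,gB,gC,gC,gC]) f = 0"
  shows "x1 = 0"
proof -
  have e1: "x1 = 0"
    by (rule clear_factor[OF rel[of "coord 0 0 3 1 0 0"] assms(1), of 3 _ "1"])
      (simp only: leading_5, simp add: coord_def t_conv s_nonzero field_simps eval_nat_numeral)
  from e1 show ?thesis using s_nonzero by simp
qed

lemma leading_independent_211:
  assumes "s \<noteq> 1"
    and rel: "\<And>f. x1 * leading (Bracket (left_normed [gC,gA]) (left_normed [gB,gA])) f + x2 * leading (left_normed [gB,gA,gA,gC]) f + x3 * leading (left_normed [gC,gA,gA,gB]) f = 0"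
  shows "x1 = 0 \<and> x2 = 0 \<and> x3 = 0"
proof -
  have e1: "s * x2 - x3 = 0"
    by (rule clear_factor[OF rel[of "coord 0 0 0 0 1 1"] assms(1), of 1 _ "s ^ 2"])
      (simp only: leading_4, simp add: coord_def t_conv s_nonzero field_simps eval_nat_numeral)
  have e2: "s * x1 + s * x2 - (s + 1) * x3 = 0"
    by (rule clear_factor[OF rel[of "coord 1 0 1 0 0 1"] assms(1), of 2 _ "- (s ^ 2)"])
      (simp only: leading_4, simp add: coord_def t_conv s_nonzero field_simps eval_nat_numeral)
  have e3: "x1 + x2 - x3 = 0"
    by (rule clear_factor[OF rel[of "coord 2 0 0 1 0 0"] assms(1), of 2 _ "s ^ 2"])
      (simp only: leading_4, simp add: coord_def t_conv s_nonzero field_simps eval_nat_numeral)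
  have "s * x1 = 0"
    using e1 e2 e3 by Groebner_Basis.algebra
  moreover have "s * x2 = 0"
    using e1 e2 e3 by Groebner_Basis.algebra
  moreover have "s * x3 = 0"
    using e1 e2 e3 by Groebner_Basis.algebra
  ultimately show ?thesis using s_nonzero assms by (simp add: add_eq_0_iff2)
qed

lemma leading_independent_121:
  assumes "s \<noteq> 1"
    and rel: "\<And>f. x1 * leading (Bracket (left_normed [gC,gB]) (left_normed [gB,gA])) f + x2 * leading (left_normed [gB,gA,gB,gC]) f + x3 * leading (left_normed [gC,gA,gB,gB]) f = 0"
  shows "x1 = 0 \<and> x2 = 0 \<and> x3 = 0"
proof -
  have e1: "(s - 1) * x1 + s * x2 + 2 * x3 = 0"
    by (rule clear_factor[OF rel[of "coord 0 0 0 1 0 1"] assms(1), of 1 _ "s"])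
      (simp only: leading_4, simp add: coord_def t_conv s_nonzero field_simps eval_nat_numeral)
  have e2: "s * x1 + s * x2 + x3 = 0"
    by (rule clear_factor[OF rel[of "coord 0 1 1 0 0 1"] assms(1), of 2 _ "- s"])
      (simp only: leading_4, simp add: coord_def t_conv s_nonzero field_simps eval_nat_numeral)
  have e3: "x1 + x2 = 0"
    by (rule clear_factor[OF rel[of "coord 0 2 0 0 1 0"] assms(1), of 2 _ "s"])
      (simp only: leading_4, simp add: coord_def t_conv s_nonzero field_simps eval_nat_numeral)
  have "x1 = 0"
    using e1 e2 e3 by Groebner_Basis.algebra
  moreover have "x2 = 0"
    using e1 e2 e3 by Groebner_Basis.algebra
  moreover have "x3 = 0"
    using e1 e2 e3 by Groebner_Basis.algebra
  ultimately show ?thesis using s_nonzero assms by (simp add: add_eq_0_iff2)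
qed

lemma leading_independent_112:
  assumes "s \<noteq> 1"
    and rel: "\<And>f. x1 * leading (Bracket (left_normed [gC,gB]) (left_normed [gC,gA])) f + x2 * leading (left_normed [gB,gA,gC,gC]) f + x3 * leading (left_normed [gC,gA,gB,gC]) f = 0"
  shows "x1 = 0 \<and> x2 = 0 \<and> x3 = 0"
proof -
  have e1: "(s + 1) * x2 + x3 = 0"
    by (rule clear_factor[OF rel[of "coord 0 0 0 1 1 0"] assms(1), of 1 _ "- (s ^ 2)"])
      (simp only: leading_4, simp add: coord_def t_conv s_nonzero field_simps eval_nat_numeral)
  have e2: "x1 = 0"
    by (rule clear_factor[OF rel[of "coord 0 0 2 0 0 1"] assms(1), of 2 _ "s ^ 2"])
      (simp only: leading_4, simp add: coord_def t_conv s_nonzero field_simps eval_nat_numeral)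
  have e3: "x1 - s * x2 = 0"
    by (rule clear_factor[OF rel[of "coord 0 1 1 0 1 0"] assms(1), of 2 _ "- (s ^ 2)"])
      (simp only: leading_4, simp add: coord_def t_conv s_nonzero field_simps eval_nat_numeral)
  have "s * x1 = 0"
    using e1 e2 e3 by Groebner_Basis.algebra
  moreover have "s * x2 = 0"
    using e1 e2 e3 by Groebner_Basis.algebra
  moreover have "s * x3 = 0"
    using e1 e2 e3 by Groebner_Basis.algebra
  ultimately show ?thesis using s_nonzero assms by (simp add: add_eq_0_iff2)
qed

lemma leading_independent_310:
  assumes "s \<noteq> 1"
    and rel: "\<And>f. x1 * leading (left_normed [gB,gA,gA,gA]) f = 0"
  shows "x1 = 0"
proof -
  have e1: "x1 = 0"
    by (rule clear_factor[OF rel[of "coord 2 0 0 0 0 1"] assms(1), of 2 _ "- 1"])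
      (simp only: leading_4, simp add: coord_def t_conv s_nonzero field_simps eval_nat_numeral)
  from e1 show ?thesis using s_nonzero by simp
qed

lemma leading_independent_220:
  assumes "s \<noteq> 1"
    and rel: "\<And>f. x1 * leading (left_normed [gB,gA,gA,gB]) f = 0"
  shows "x1 = 0"
proof -
  have e1: "x1 = 0"
    by (rule clear_factor[OF rel[of "coord 0 0 0 0 0 2"] assms(1), of 1 _ "- 1"])
      (simp only: leading_4, simp add: coord_def t_conv s_nonzero field_simps eval_nat_numeral)
  from e1 show ?thesis using s_nonzero by simp
qed

lemma leading_independent_130:
  assumes "s \<noteq> 1"
    and rel: "\<And>f. x1 * leading (left_normed [gB,gA,gB,gB]) f = 0"
  shows "x1 = 0"
proof -
  have e1: "x1 = 0"
    by (rule clear_factor[OF rel[of "coord 0 2 0 0 0 1"] assms(1), of 2 _ "- 1"])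
      (simp only: leading_4, simp add: coord_def t_conv s_nonzero field_simps eval_nat_numeral)
  from e1 show ?thesis using s_nonzero by simp
qed

lemma leading_independent_301:
  assumes "s \<noteq> 1"
    and rel: "\<And>f. x1 * leading (left_normed [gC,gA,gA,gA]) f = 0"
  shows "x1 = 0"
proof -
  have e1: "x1 = 0"
    by (rule clear_factor[OF rel[of "coord 2 0 0 0 1 0"] assms(1), of 2 _ "s ^ 3"])
      (simp only: leading_4, simp add: coord_def t_conv s_nonzero field_simps eval_nat_numeral)
  from e1 show ?thesis using s_nonzero by simp
qed

lemma leading_independent_202:
  assumes "s \<noteq> 1"
    and rel: "\<And>f. x1 * leading (left_normed [gC,gA,gA,gC]) f = 0"
  shows "x1 = 0"
proof -
  have e1: "x1 = 0"
    by (rule clear_factor[OF rel[of "coord 0 0 0 0 2 0"] assms(1), of 1 _ "s ^ 3"])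
      (simp only: leading_4, simp add: coord_def t_conv s_nonzero field_simps eval_nat_numeral)
  from e1 show ?thesis using s_nonzero by simp
qed

lemma leading_independent_103:
  assumes "s \<noteq> 1"
    and rel: "\<And>f. x1 * leading (left_normed [gC,gA,gC,gC]) f = 0"
  shows "x1 = 0"
proof -
  have e1: "x1 = 0"
    by (rule clear_factor[OF rel[of "coord 0 0 2 0 1 0"] assms(1), of 2 _ "s ^ 3"])
      (simp only: leading_4, simp add: coord_def t_conv s_nonzero field_simps eval_nat_numeral)
  from e1 show ?thesis using s_nonzero by simp
qed

lemma leading_independent_031:
  assumes "s \<noteq> 1"
    and rel: "\<And>f. x1 * leading (left_normed [gC,gB,gB,gB]) f = 0"
  shows "x1 = 0"
proof -
  have e1: "x1 = 0"
    by (rule clear_factor[OF rel[of "coord 0 2 0 1 0 0"] assms(1), of 2 _ "- 1"])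
      (simp only: leading_4, simp add: coord_def t_conv s_nonzero field_simps eval_nat_numeral)
  from e1 show ?thesis using s_nonzero by simp
qed

lemma leading_independent_022:
  assumes "s \<noteq> 1"
    and rel: "\<And>f. x1 * leading (left_normed [gC,gB,gB,gC]) f = 0"
  shows "x1 = 0"
proof -
  have e1: "x1 = 0"
    by (rule clear_factor[OF rel[of "coord 0 0 0 2 0 0"] assms(1), of 1 _ "- 1"])
      (simp only: leading_4, simp add: coord_def t_conv s_nonzero field_simps eval_nat_numeral)
  from e1 show ?thesis using s_nonzero by simp
qed

lemma leading_independent_013:
  assumes "s \<noteq> 1"
    and rel: "\<And>f. x1 * leading (left_normed [gC,gB,gC,gC]) f = 0"
  shows "x1 = 0"
proof -
  have e1: "x1 = 0"
    by (rule clear_factor[OF rel[of "coord 0 0 2 1 0 0"] assms(1), of 2 _ "- 1"])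
      (simp only: leading_4, simp add: coord_def t_conv s_nonzero field_simps eval_nat_numeral)
  from e1 show ?thesis using s_nonzero by simp
qed

lemma leading_independent_210:
  assumes "s \<noteq> 1"
    and rel: "\<And>f. x1 * leading (left_normed [gB,gA,gA]) f = 0"
  shows "x1 = 0"
proof -
  have e1: "x1 = 0"
    by (rule clear_factor[OF rel[of "coord 1 0 0 0 0 1"] assms(1), of 1 _ "- 1"])
      (simp only: leading_3, simp add: coord_def t_conv s_nonzero field_simps eval_nat_numeral)
  from e1 show ?thesis using s_nonzero by simp
qed

lemma leading_independent_120:
  assumes "s \<noteq> 1"
    and rel: "\<And>f. x1 * leading (left_normed [gB,gA,gB]) f = 0"
  shows "x1 = 0"
proof -
  have e1: "x1 = 0"
    by (rule clear_factor[OF rel[of "coord 0 1 0 0 0 1"] assms(1), of 1 _ "1"])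
      (simp only: leading_3, simp add: coord_def t_conv s_nonzero field_simps eval_nat_numeral)
  from e1 show ?thesis using s_nonzero by simp
qed

lemma leading_independent_111:
  assumes "s \<noteq> 1"
    and rel: "\<And>f. x1 * leading (left_normed [gB,gA,gC]) f + x2 * leading (left_normed [gC,gA,gB]) f = 0"
  shows "x1 = 0 \<and> x2 = 0"
proof -
  have e1: "x2 = 0"
    by (rule clear_factor[OF rel[of "coord 0 0 1 0 0 1"] assms(1), of 1 _ "- s"])
      (simp only: leading_3, simp add: coord_def t_conv s_nonzero field_simps eval_nat_numeral)
  have e2: "x1 = 0"
    by (rule clear_factor[OF rel[of "coord 0 1 0 0 1 0"] assms(1), of 1 _ "- s"])
      (simp only: leading_3, simp add: coord_def t_conv s_nonzero field_simps eval_nat_numeral)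
  from e1 e2 show ?thesis by simp
qed

lemma leading_independent_201:
  assumes "s \<noteq> 1"
    and rel: "\<And>f. x1 * leading (left_normed [gC,gA,gA]) f = 0"
  shows "x1 = 0"
proof -
  have e1: "x1 = 0"
    by (rule clear_factor[OF rel[of "coord 1 0 0 0 1 0"] assms(1), of 1 _ "- (s ^ 2)"])
      (simp only: leading_3, simp add: coord_def t_conv s_nonzero field_simps eval_nat_numeral)
  from e1 show ?thesis using s_nonzero by simp
qed

lemma leading_independent_102:
  assumes "s \<noteq> 1"
    and rel: "\<And>f. x1 * leading (left_normed [gC,gA,gC]) f = 0"
  shows "x1 = 0"
proof -
  have e1: "x1 = 0"
    by (rule clear_factor[OF rel[of "coord 0 0 1 0 1 0"] assms(1), of 1 _ "s ^ 2"])
      (simp only: leading_3, simp add: coord_def t_conv s_nonzero field_simps eval_nat_numeral)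
  from e1 show ?thesis using s_nonzero by simp
qed

lemma leading_independent_021:
  assumes "s \<noteq> 1"
    and rel: "\<And>f. x1 * leading (left_normed [gC,gB,gB]) f = 0"
  shows "x1 = 0"
proof -
  have e1: "x1 = 0"
    by (rule clear_factor[OF rel[of "coord 0 1 0 1 0 0"] assms(1), of 1 _ "- 1"])
      (simp only: leading_3, simp add: coord_def t_conv s_nonzero field_simps eval_nat_numeral)
  from e1 show ?thesis using s_nonzero by simp
qed

lemma leading_independent_012:
  assumes "s \<noteq> 1"
    and rel: "\<And>f. x1 * leading (left_normed [gC,gB,gC]) f = 0"
  shows "x1 = 0"
proof -
  have e1: "x1 = 0"
    by (rule clear_factor[OF rel[of "coord 0 0 1 1 0 0"] assms(1), of 1 _ "1"])
      (simp only: leading_3, simp add: coord_def t_conv s_nonzero field_simps eval_nat_numeral)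
  from e1 show ?thesis using s_nonzero by simp
qed

lemma leading_independent_110:
  assumes "s \<noteq> 1"
    and rel: "\<And>f. x1 * leading (left_normed [gB,gA]) f = 0"
  shows "x1 = 0"
proof -
  have e1: "x1 = 0"
    by (rule clear_factor[OF rel[of "coord 0 0 0 0 0 1"] assms(1), of 0 _ "- 1"])
      (simp only: leading_2, simp add: coord_def t_conv s_nonzero field_simps eval_nat_numeral)
  from e1 show ?thesis using s_nonzero by simp
qed

lemma leading_independent_101:
  assumes "s \<noteq> 1"
    and rel: "\<And>f. x1 * leading (left_normed [gC,gA]) f = 0"
  shows "x1 = 0"
proof -
  have e1: "x1 = 0"
    by (rule clear_factor[OF rel[of "coord 0 0 0 0 1 0"] assms(1), of 0 _ "s"])
      (simp only: leading_2, simp add: coord_def t_conv s_nonzero field_simps eval_nat_numeral)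
  from e1 show ?thesis using s_nonzero by simp
qed

lemma leading_independent_011:
  assumes "s \<noteq> 1"
    and rel: "\<And>f. x1 * leading (left_normed [gC,gB]) f = 0"
  shows "x1 = 0"
proof -
  have e1: "x1 = 0"
    by (rule clear_factor[OF rel[of "coord 0 0 0 1 0 0"] assms(1), of 0 _ "- 1"])
      (simp only: leading_2, simp add: coord_def t_conv s_nonzero field_simps eval_nat_numeral)
  from e1 show ?thesis using s_nonzero by simp
qed

lemma leading_independent_100:
  assumes "s \<noteq> 1"
    and rel: "\<And>f. x1 * leading (Letter gA) f = 0"
  shows "x1 = 0"
proof -
  have e1: "x1 = 0"
    by (rule clear_factor[OF rel[of "coord 1 0 0 0 0 0"] assms(1), of 0 _ "1"])
      (simp only: leading_1, simp add: coord_def t_conv s_nonzero field_simps eval_nat_numeral)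
  from e1 show ?thesis using s_nonzero by simp
qed

lemma leading_independent_010:
  assumes "s \<noteq> 1"
    and rel: "\<And>f. x1 * leading (Letter gB) f = 0"
  shows "x1 = 0"
proof -
  have e1: "x1 = 0"
    by (rule clear_factor[OF rel[of "coord 0 1 0 0 0 0"] assms(1), of 0 _ "1"])
      (simp only: leading_1, simp add: coord_def t_conv s_nonzero field_simps eval_nat_numeral)
  from e1 show ?thesis using s_nonzero by simp
qed

lemma leading_independent_001:
  assumes "s \<noteq> 1"
    and rel: "\<And>f. x1 * leading (Letter gC) f = 0"
  shows "x1 = 0"
proof -
  have e1: "x1 = 0"
    by (rule clear_factor[OF rel[of "coord 0 0 1 0 0 0"] assms(1), of 0 _ "1"])
      (simp only: leading_1, simp add: coord_def t_conv s_nonzero field_simps eval_nat_numeral)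
  from e1 show ?thesis using s_nonzero by simp
qed

text \<open>Elimination leaves 2 (s + 1)^2 times one unknown. The same factor stands before the
  omitted element of this multidegree in \<open>relation_BAABC\<close>.\<close>

lemma leading_independent_221:
  assumes "s \<noteq> 1" "s \<noteq> - 1" "(2 :: 'f) \<noteq> 0"
    and rel: "\<And>f. x1 * leading (Bracket (left_normed [gB,gA,gA]) (left_normed [gC,gB])) f + x2 * leading (Bracket (left_normed [gB,gA,gB]) (left_normed [gC,gA])) f + x3 * leading (Bracket (left_normed [gB,gA,gC]) (left_normed [gB,gA])) f + x4 * leading (Bracket (left_normed [gC,gA,gB]) (left_normed [gB,gA])) f + x5 * leading (left_normed [gC,gA,gA,gB,gB]) f = 0"
  shows "x1 = 0 \<and> x2 = 0 \<and> x3 = 0 \<and> x4 = 0 \<and> x5 = 0"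
proof -
  have e1: "s * x1 - s * x2 - (s + 1) * x5 = 0"
    by (rule clear_factor[OF rel[of "coord 0 0 1 0 0 2"] assms(1), of 2 _ "- (s ^ 2)"])
      (simp only: leading_5, simp add: coord_def t_conv s_nonzero field_simps eval_nat_numeral)
  have e2: "x1 - x2 - x5 = 0"
    by (rule clear_factor[OF rel[of "coord 2 2 1 0 0 0"] assms(1), of 4 _ "- 1"])
      (simp only: leading_5, simp add: coord_def t_conv s_nonzero field_simps eval_nat_numeral)
  have e3: "(s ^ 2 + s - 1) * x1 + s * x3 - x4 + x5 = 0"
    by (rule clear_factor[OF rel[of "coord 0 1 0 0 1 1"] assms(1), of 2 _ "s ^ 2"])
      (simp only: leading_5, simp add: coord_def t_conv s_nonzero field_simps eval_nat_numeral)
  have e4: "(s ^ 2 + s) * x1 + x2 + s * x3 + x5 = 0"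
    by (rule clear_factor[OF rel[of "coord 1 2 0 0 1 0"] assms(1), of 3 _ "- (s ^ 2)"])
      (simp only: leading_5, simp add: coord_def t_conv s_nonzero field_simps eval_nat_numeral)
  have e5: "s ^ 2 * x1 + (s + 1) * x2 - s * x3 - s * x4 + (2 * s + 1) * x5 = 0"
    by (rule clear_factor[OF rel[of "coord 2 1 0 1 0 0"] assms(1), of 3 _ "s ^ 2"])
      (simp only: leading_5, simp add: coord_def t_conv s_nonzero field_simps eval_nat_numeral)
  have z1: "x5 = 0"
    using e1 e2 by Groebner_Basis.algebra
  have z2: "x2 = x1"
    using e2 z1 by Groebner_Basis.algebra
  have z3: "s * x3 = - (s ^ 2 + s + 1) * x1"
    using e4 z1 z2 by Groebner_Basis.algebra
  have z4: "s * x4 = 2 * (s ^ 2 + s + 1) * x1"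
    using e5 z1 z2 z3 by Groebner_Basis.algebra
  have "2 * (s + 1) ^ 2 * x1 = 0"
    using e3 z1 z3 z4 by Groebner_Basis.algebra
  then have "x1 = 0" using s_nonzero assms by (simp add: add_eq_0_iff2)
  then show ?thesis using s_nonzero z1 z2 z3 z4 by simp
qed

lemma leading_independent_122:
  assumes "s \<noteq> 1"
    and rel: "\<And>f. x1 * leading (Bracket (left_normed [gB,gA,gC]) (left_normed [gC,gB])) f + x2 * leading (Bracket (left_normed [gC,gA,gB]) (left_normed [gC,gB])) f + x3 * leading (Bracket (left_normed [gC,gB,gC]) (left_normed [gB,gA])) f + x4 * leading (left_normed [gB,gA,gB,gC,gC]) f + x5 * leading (left_normed [gC,gA,gB,gB,gC]) f = 0"
  shows "x1 = 0 \<and> x2 = 0 \<and> x3 = 0 \<and> x4 = 0 \<and> x5 = 0"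
proof -
  have e1: "x3 + x4 = 0"
    by (rule clear_factor[OF rel[of "coord 1 2 2 0 0 0"] assms(1), of 4 _ "- 1"])
      (simp only: leading_5, simp add: coord_def t_conv s_nonzero field_simps eval_nat_numeral)
  have e2: "s * x3 + (s + 1) * x4 + x5 = 0"
    by (rule clear_factor[OF rel[of "coord 1 0 0 2 0 0"] assms(1), of 2 _ "- (s ^ 2)"])
      (simp only: leading_5, simp add: coord_def t_conv s_nonzero field_simps eval_nat_numeral)
  have e3: "x2 - s * x3 - s * x4 - x5 = 0"
    by (rule clear_factor[OF rel[of "coord 0 1 2 0 0 1"] assms(1), of 3 _ "- s"])
      (simp only: leading_5, simp add: coord_def t_conv s_nonzero field_simps eval_nat_numeral)
  have e4: "x1 - (s + 1) * x3 - (s + 2) * x4 = 0"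
    by (rule clear_factor[OF rel[of "coord 0 2 1 0 1 0"] assms(1), of 3 _ "s"])
      (simp only: leading_5, simp add: coord_def t_conv s_nonzero field_simps eval_nat_numeral)
  have e5: "x1 + (s + 1) * x2 - (s ^ 2 - 1) * x3 - s ^ 2 * x4 - s * x5 = 0"
    by (rule clear_factor[OF rel[of "coord 0 0 1 1 0 1"] assms(1), of 2 _ "s ^ 2"])
      (simp only: leading_5, simp add: coord_def t_conv s_nonzero field_simps eval_nat_numeral)
  have z1: "x4 = - x3"
    using e1 by Groebner_Basis.algebra
  have z2: "x5 = x3"
    using e2 z1 by Groebner_Basis.algebra
  have z3: "x2 = x3"
    using e3 z1 z2 by Groebner_Basis.algebra
  have z4: "x1 = - x3"
    using e4 z1 by Groebner_Basis.algebra
  have "x3 = 0"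
    using e5 z1 z2 z3 z4 by Groebner_Basis.algebra
  then have "x3 = 0" using s_nonzero assms by (simp add: add_eq_0_iff2)
  then show ?thesis using s_nonzero z1 z2 z3 z4 by simp
qed

lemma leading_independent_212:
  assumes "s \<noteq> 1"
    and rel: "\<And>f. x1 * leading (Bracket (left_normed [gB,gA,gC]) (left_normed [gC,gA])) f + x2 * leading (Bracket (left_normed [gC,gA,gB]) (left_normed [gC,gA])) f + x3 * leading (Bracket (left_normed [gC,gA,gC]) (left_normed [gB,gA])) f + x4 * leading (left_normed [gB,gA,gA,gC,gC]) f + x5 * leading (left_normed [gC,gA,gA,gB,gC]) f = 0"
  shows "x1 = 0 \<and> x2 = 0 \<and> x3 = 0 \<and> x4 = 0 \<and> x5 = 0"
proof -
  have e1: "x3 + x4 - x5 = 0"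
    by (rule clear_factor[OF rel[of "coord 2 1 2 0 0 0"] assms(1), of 4 _ "s ^ 2"])
      (simp only: leading_5, simp add: coord_def t_conv s_nonzero field_simps eval_nat_numeral)
  have e2: "x3 + (s + 1) * x4 - x5 = 0"
    by (rule clear_factor[OF rel[of "coord 0 1 0 0 2 0"] assms(1), of 2 _ "s ^ 3"])
      (simp only: leading_5, simp add: coord_def t_conv s_nonzero field_simps eval_nat_numeral)
  have e3: "x2 + s * x3 + s * x4 - (s + 1) * x5 = 0"
    by (rule clear_factor[OF rel[of "coord 1 0 2 0 0 1"] assms(1), of 3 _ "- (s ^ 3)"])
      (simp only: leading_5, simp add: coord_def t_conv s_nonzero field_simps eval_nat_numeral)
  have e4: "s * x1 - x2 - s * x4 + (s + 1) * x5 = 0"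
    by (rule clear_factor[OF rel[of "coord 0 0 1 0 1 1"] assms(1), of 2 _ "- (s ^ 3)"])
      (simp only: leading_5, simp add: coord_def t_conv s_nonzero field_simps eval_nat_numeral)
  have e5: "s * x1 + s * x2 - (s + 1) * x3 - (2 * s + 1) * x4 + (2 * s + 1) * x5 = 0"
    by (rule clear_factor[OF rel[of "coord 2 0 1 1 0 0"] assms(1), of 3 _ "- (s ^ 4)"])
      (simp only: leading_5, simp add: coord_def t_conv s_nonzero field_simps eval_nat_numeral)
  have z0: "s * x4 = 0"
    using e1 e2 by Groebner_Basis.algebra
  then have z1: "x4 = 0" using s_nonzero by simp
  have z2: "x5 = x3"
    using e1 z1 by Groebner_Basis.algebra
  have z3: "x2 = x3"
    using e3 z1 z2 by Groebner_Basis.algebra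
  have z4: "s * x1 = - (s * x3)"
    using e4 z1 z2 z3 by Groebner_Basis.algebra
  have "s * x3 = 0"
    using e5 z1 z2 z3 z4 by Groebner_Basis.algebra
  then have "x3 = 0" using s_nonzero assms by (simp add: add_eq_0_iff2)
  then show ?thesis using s_nonzero z1 z2 z3 z4 by simp
qed

text \<open>The first two elements have the same leading term, so degree 5 determines only the sum
  of their coefficients. The same happens in multidegree (1,3,1).\<close>

lemma leading_independent_311:
  assumes "s \<noteq> 1"
    and rel: "\<And>f. x1 * leading (Bracket (left_normed [gB,gA,gA]) (left_normed [gC,gA])) f + x2 * leading (Bracket (left_normed [gC,gA,gA]) (left_normed [gB,gA])) f + x3 * leading (left_normed [gB,gA,gA,gA,gC]) f + x4 * leading (left_normed [gC,gA,gA,gA,gB]) f = 0"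
  shows "x2 = - x1 \<and> x3 = 0 \<and> x4 = 0"
proof -
  have e1: "s * x1 + s * x2 - (s ^ 2 + s) * x3 - (s + 1) * x4 = 0"
    by (rule clear_factor[OF rel[of "coord 1 0 0 0 1 1"] assms(1), of 2 _ "- (s ^ 3)"])
      (simp only: leading_5, simp add: coord_def t_conv s_nonzero field_simps eval_nat_numeral)
  have e2: "x1 + x2 - x3 - x4 = 0"
    by (rule clear_factor[OF rel[of "coord 3 0 0 1 0 0"] assms(1), of 3 _ "- (s ^ 3)"])
      (simp only: leading_5, simp add: coord_def t_conv s_nonzero field_simps eval_nat_numeral)
  have e3: "(s + 1) * x1 + (s + 1) * x2 - (s ^ 2 + s + 1) * x3 - (s + 1) * x4 = 0"
    by (rule clear_factor[OF rel[of "coord 2 1 0 0 1 0"] assms(1), of 3 _ "s ^ 3"])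
      (simp only: leading_5, simp add: coord_def t_conv s_nonzero field_simps eval_nat_numeral)
  have z0: "s ^ 2 * x3 = 0"
    using e2 e3 by Groebner_Basis.algebra
  then have z1: "x3 = 0" using s_nonzero by simp
  have z2: "x4 = 0"
    using e1 e2 z1 by Groebner_Basis.algebra
  have "x2 = - x1"
    using e2 z1 z2 by Groebner_Basis.algebra
  then show ?thesis using z1 z2 by simp
qed

lemma leading_independent_131:
  assumes "s \<noteq> 1"
    and rel: "\<And>f. x1 * leading (Bracket (left_normed [gB,gA,gB]) (left_normed [gC,gB])) f + x2 * leading (Bracket (left_normed [gC,gB,gB]) (left_normed [gB,gA])) f + x3 * leading (left_normed [gB,gA,gB,gB,gC]) f + x4 * leading (left_normed [gC,gA,gB,gB,gB]) f = 0"
  shows "x2 = - x1 \<and> x3 = 0 \<and> x4 = 0"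
proof -
  have e1: "x1 + x2 - x3 = 0"
    by (rule clear_factor[OF rel[of "coord 0 3 0 0 1 0"] assms(1), of 3 _ "s"])
      (simp only: leading_5, simp add: coord_def t_conv s_nonzero field_simps eval_nat_numeral)
  have e2: "(s ^ 2 + s) * x1 + (s ^ 2 + s) * x2 - (s ^ 2 + s) * x3 + x4 = 0"
    by (rule clear_factor[OF rel[of "coord 0 2 1 0 0 1"] assms(1), of 3 _ "- s"])
      (simp only: leading_5, simp add: coord_def t_conv s_nonzero field_simps eval_nat_numeral)
  have e3: "(s ^ 2 + s - 1) * x1 + (s ^ 2 + s - 1) * x2 - (s ^ 2 + s) * x3 = 0"
    by (rule clear_factor[OF rel[of "coord 0 1 0 1 0 1"] assms(1), of 2 _ "s"])
      (simp only: leading_5, simp add: coord_def t_conv s_nonzero field_simps eval_nat_numeral)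
  have z1: "x4 = 0"
    using e1 e2 by Groebner_Basis.algebra
  have z2: "x3 = 0"
    using e1 e3 by Groebner_Basis.algebra
  have "x2 = - x1"
    using e1 z2 by Groebner_Basis.algebra
  then show ?thesis using z1 z2 by simp
qed

end

section \<open>Hall elements of length at most 5\<close>

lemma lie_length_pos: "lie_length T > 0"
  by (induction T) auto

text \<open>In a Hall bracket the right factor is therefore no longer than the left one, which
  leaves only the splittings 4 + 1 and 3 + 2 in length 5, and 3 + 1 and 2 + 2 in length 4.\<close>

lemma lie_less_length: "lie_less U V \<Longrightarrow> lie_length U \<le> lie_length V"
proof (induction U V rule: lie_less.induct)
  case (2 x V1 V2)
  show ?case using lie_length_pos[of V1] by simp
qed auto

text \<open>All brackets with factors from two lists, filtered by the executable predicate
  \<open>hall\<close>, so that the explicit lists can be confirmed by evaluation.\<close>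

definition hall_brackets :: "'x::linorder lie_monomial list \<Rightarrow> 'x lie_monomial list \<Rightarrow> 'x lie_monomial list" where
  "hall_brackets Us Vs = filter hall (concat (map (\<lambda>U. map (Bracket U) Vs) Us))"

lemma set_hall_brackets:
  "set (hall_brackets Us Vs) = {Bracket U V | U V. U \<in> set Us \<and> V \<in> set Vs \<and> hall (Bracket U V)}"
  unfolding hall_brackets_def by auto

lemma hall_length_1: "{T :: gen lie_monomial. hall T \<and> lie_length T = 1} = set [Letter gA, Letter gB, Letter gC]"
proof -
  have "T \<in> {Letter gA, Letter gB, Letter gC}" if "lie_length T = 1" for T
  proof (cases T)
    case (Letter x)
    then show ?thesis by (cases x) auto
  next
    case (Bracket U V)
    then show ?thesis using that lie_length_pos[of U] lie_length_pos[of V] by simp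
  qed
  then show ?thesis by auto
qed

lemma hall_length_cases:
  assumes "hall T" "lie_length T = n" "n > 1"
  obtains U V k where "T = Bracket U V" "hall U" "hall V" "lie_length V = k" "lie_length U = n - k" "0 < k" "2 * k \<le> n"
proof (cases T)
  case (Letter x)
  then show ?thesis using assms by simp
next
  case (Bracket U V)
  then have "lie_length V \<le> lie_length U"
    using assms(1) lie_less_length by auto
  then show ?thesis
    using that[of U V "lie_length V"] Bracket assms(1,2) lie_length_pos[of V] by auto
qed

definition hall_1 :: "gen lie_monomial list" where
  "hall_1 = [Letter gA, Letter gB, Letter gC]"

definition hall_2 :: "gen lie_monomial list" where
  "hall_2 =
    [left_normed [gB,gA],
     left_normed [gC,gA],
     left_normed [gC,gB]]"

lemma hall_2_eq: "hall_2 = hall_brackets hall_1 hall_1"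
  by code_simp

definition hall_3 :: "gen lie_monomial list" where
  "hall_3 =
    [left_normed [gB,gA,gA],
     left_normed [gB,gA,gB],
     left_normed [gB,gA,gC],
     left_normed [gC,gA,gA],
     left_normed [gC,gA,gB],
     left_normed [gC,gA,gC],
     left_normed [gC,gB,gB],
     left_normed [gC,gB,gC]]"

lemma hall_3_eq: "hall_3 = hall_brackets hall_2 hall_1"
  by code_simp

definition hall_4 :: "gen lie_monomial list" where
  "hall_4 =
    [Bracket (left_normed [gC,gA]) (left_normed [gB,gA]),
     Bracket (left_normed [gC,gB]) (left_normed [gB,gA]),
     Bracket (left_normed [gC,gB]) (left_normed [gC,gA]),
     left_normed [gB,gA,gA,gA],
     left_normed [gB,gA,gA,gB],
     left_normed [gB,gA,gA,gC],
     left_normed [gB,gA,gB,gB],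
     left_normed [gB,gA,gB,gC],
     left_normed [gB,gA,gC,gC],
     left_normed [gC,gA,gA,gA],
     left_normed [gC,gA,gA,gB],
     left_normed [gC,gA,gA,gC],
     left_normed [gC,gA,gB,gB],
     left_normed [gC,gA,gB,gC],
     left_normed [gC,gA,gC,gC],
     left_normed [gC,gB,gB,gB],
     left_normed [gC,gB,gB,gC],
     left_normed [gC,gB,gC,gC]]"

lemma hall_4_eq: "hall_4 = hall_brackets hall_2 hall_2 @ hall_brackets hall_3 hall_1"
  by code_simp

definition hall_5 :: "gen lie_monomial list" where
  "hall_5 =
    [Bracket (left_normed [gB,gA,gA]) (left_normed [gB,gA]),
     Bracket (left_normed [gB,gA,gA]) (left_normed [gC,gA]),
     Bracket (left_normed [gB,gA,gA]) (left_normed [gC,gB]),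
     Bracket (left_normed [gB,gA,gB]) (left_normed [gB,gA]),
     Bracket (left_normed [gB,gA,gB]) (left_normed [gC,gA]),
     Bracket (left_normed [gB,gA,gB]) (left_normed [gC,gB]),
     Bracket (left_normed [gB,gA,gC]) (left_normed [gB,gA]),
     Bracket (left_normed [gB,gA,gC]) (left_normed [gC,gA]),
     Bracket (left_normed [gB,gA,gC]) (left_normed [gC,gB]),
     Bracket (left_normed [gC,gA,gA]) (left_normed [gB,gA]),
     Bracket (left_normed [gC,gA,gA]) (left_normed [gC,gA]),
     Bracket (left_normed [gC,gA,gA]) (left_normed [gC,gB]),
     Bracket (left_normed [gC,gA,gB]) (left_normed [gB,gA]),
     Bracket (left_normed [gC,gA,gB]) (left_normed [gC,gA]),
     Bracket (left_normed [gC,gA,gB]) (left_normed [gC,gB]),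
     Bracket (left_normed [gC,gA,gC]) (left_normed [gB,gA]),
     Bracket (left_normed [gC,gA,gC]) (left_normed [gC,gA]),
     Bracket (left_normed [gC,gA,gC]) (left_normed [gC,gB]),
     Bracket (left_normed [gC,gB,gB]) (left_normed [gB,gA]),
     Bracket (left_normed [gC,gB,gB]) (left_normed [gC,gA]),
     Bracket (left_normed [gC,gB,gB]) (left_normed [gC,gB]),
     Bracket (left_normed [gC,gB,gC]) (left_normed [gB,gA]),
     Bracket (left_normed [gC,gB,gC]) (left_normed [gC,gA]),
     Bracket (left_normed [gC,gB,gC]) (left_normed [gC,gB]),
     left_normed [gB,gA,gA,gA,gA],
     left_normed [gB,gA,gA,gA,gB],
     left_normed [gB,gA,gA,gA,gC],
     left_normed [gB,gA,gA,gB,gB],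
     left_normed [gB,gA,gA,gB,gC],
     left_normed [gB,gA,gA,gC,gC],
     left_normed [gB,gA,gB,gB,gB],
     left_normed [gB,gA,gB,gB,gC],
     left_normed [gB,gA,gB,gC,gC],
     left_normed [gB,gA,gC,gC,gC],
     left_normed [gC,gA,gA,gA,gA],
     left_normed [gC,gA,gA,gA,gB],
     left_normed [gC,gA,gA,gA,gC],
     left_normed [gC,gA,gA,gB,gB],
     left_normed [gC,gA,gA,gB,gC],
     left_normed [gC,gA,gA,gC,gC],
     left_normed [gC,gA,gB,gB,gB],
     left_normed [gC,gA,gB,gB,gC],
     left_normed [gC,gA,gB,gC,gC],
     left_normed [gC,gA,gC,gC,gC],
     left_normed [gC,gB,gB,gB,gB],
     left_normed [gC,gB,gB,gB,gC],
     left_normed [gC,gB,gB,gC,gC],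
     left_normed [gC,gB,gC,gC,gC]]"

lemma hall_5_eq: "hall_5 = hall_brackets hall_3 hall_2 @ hall_brackets hall_4 hall_1"
  by code_simp

lemma hall_1: "{T. hall T \<and> lie_length T = 1} = set hall_1"
  unfolding hall_length_1 hall_1_def ..

lemma set_hall_brackets_length:
  assumes "{T. hall T \<and> lie_length T = m} = set Us" "{T. hall T \<and> lie_length T = n} = set Vs"
  shows "set (hall_brackets Us Vs) = {Bracket U V | U V. hall (Bracket U V) \<and> lie_length U = m \<and> lie_length V = n}"
  unfolding set_hall_brackets assms[symmetric] by auto

lemma hall_2: "{T. hall T \<and> lie_length T = 2} = set hall_2"
proof -
  have "T \<in> {T. hall T \<and> lie_length T = 2} \<longleftrightarrow> T \<in> set hall_2" for T
  proof
    assume T: "T \<in> {T. hall T \<and> lie_length T = 2}"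
    then have h: "hall T" "lie_length T = 2" "(2 :: nat) > 1" by simp_all
    obtain U V k where UV: "T = Bracket U V" "lie_length V = k" "lie_length U = 2 - k" and k: "0 < k" "2 * k \<le> 2"
      by (rule hall_length_cases[OF h]) simp_all
    from k have "k = 1" by linarith
    then show "T \<in> set hall_2"
      using UV h(1) unfolding hall_2_eq set_append set_hall_brackets_length[OF hall_1 hall_1] by auto
  next
    assume "T \<in> set hall_2"
    then show "T \<in> {T. hall T \<and> lie_length T = 2}"
      unfolding hall_2_eq set_append set_hall_brackets_length[OF hall_1 hall_1] by auto
  qed
  then show ?thesis by blast
qed

lemma hall_3: "{T. hall T \<and> lie_length T = 3} = set hall_3"
proof -
  have "T \<in> {T. hall T \<and> lie_length T = 3} \<longleftrightarrow> T \<in> set hall_3" for T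
  proof
    assume T: "T \<in> {T. hall T \<and> lie_length T = 3}"
    then have h: "hall T" "lie_length T = 3" "(3 :: nat) > 1" by simp_all
    obtain U V k where UV: "T = Bracket U V" "lie_length V = k" "lie_length U = 3 - k" and k: "0 < k" "2 * k \<le> 3"
      by (rule hall_length_cases[OF h]) simp_all
    from k have "k = 1" by linarith
    then show "T \<in> set hall_3"
      using UV h(1) unfolding hall_3_eq set_append set_hall_brackets_length[OF hall_2 hall_1] by auto
  next
    assume "T \<in> set hall_3"
    then show "T \<in> {T. hall T \<and> lie_length T = 3}"
      unfolding hall_3_eq set_append set_hall_brackets_length[OF hall_2 hall_1] by auto
  qed
  then show ?thesis by blast
qed

lemma hall_4: "{T. hall T \<and> lie_length T = 4} = set hall_4"
proof -
  have "T \<in> {T. hall T \<and> lie_length T = 4} \<longleftrightarrow> T \<in> set hall_4" for T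
  proof
    assume T: "T \<in> {T. hall T \<and> lie_length T = 4}"
    then have h: "hall T" "lie_length T = 4" "(4 :: nat) > 1" by simp_all
    obtain U V k where UV: "T = Bracket U V" "lie_length V = k" "lie_length U = 4 - k" and k: "0 < k" "2 * k \<le> 4"
      by (rule hall_length_cases[OF h]) simp_all
    from k have "k = 2 \<or> k = 1" by linarith
    then show "T \<in> set hall_4"
      using UV h(1) unfolding hall_4_eq set_append set_hall_brackets_length[OF hall_2 hall_2] set_hall_brackets_length[OF hall_3 hall_1] by auto
  next
    assume "T \<in> set hall_4"
    then show "T \<in> {T. hall T \<and> lie_length T = 4}"
      unfolding hall_4_eq set_append set_hall_brackets_length[OF hall_2 hall_2] set_hall_brackets_length[OF hall_3 hall_1] by auto
  qed
  then show ?thesis by blast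
qed

lemma hall_5: "{T. hall T \<and> lie_length T = 5} = set hall_5"
proof -
  have "T \<in> {T. hall T \<and> lie_length T = 5} \<longleftrightarrow> T \<in> set hall_5" for T
  proof
    assume T: "T \<in> {T. hall T \<and> lie_length T = 5}"
    then have h: "hall T" "lie_length T = 5" "(5 :: nat) > 1" by simp_all
    obtain U V k where UV: "T = Bracket U V" "lie_length V = k" "lie_length U = 5 - k" and k: "0 < k" "2 * k \<le> 5"
      by (rule hall_length_cases[OF h]) simp_all
    from k have "k = 2 \<or> k = 1" by linarith
    then show "T \<in> set hall_5"
      using UV h(1) unfolding hall_5_eq set_append set_hall_brackets_length[OF hall_3 hall_2] set_hall_brackets_length[OF hall_4 hall_1] by auto
  next
    assume "T \<in> set hall_5"
    then show "T \<in> {T. hall T \<and> lie_length T = 5}"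
      unfolding hall_5_eq set_append set_hall_brackets_length[OF hall_3 hall_2] set_hall_brackets_length[OF hall_4 hall_1] by auto
  qed
  then show ?thesis by blast
qed

lemma hall_upto_5: "{T. hall T \<and> lie_length T \<le> 5} = set (hall_1 @ hall_2 @ hall_3 @ hall_4 @ hall_5)"
proof -
  have "lie_length T \<le> 5 \<longleftrightarrow> lie_length T = 1 \<or> lie_length T = 2 \<or> lie_length T = 3 \<or> lie_length T = 4 \<or> lie_length T = 5"
    for T :: "gen lie_monomial"
    using lie_length_pos[of T] by linarith
  then have "{T :: gen lie_monomial. hall T \<and> lie_length T \<le> 5} =
      {T. hall T \<and> lie_length T = 1} \<union> ({T. hall T \<and> lie_length T = 2} \<union> ({T. hall T \<and> lie_length T = 3}
        \<union> ({T. hall T \<and> lie_length T = 4} \<union> {T. hall T \<and> lie_length T = 5})))"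
    by blast
  then show ?thesis
    unfolding hall_1 hall_2 hall_3 hall_4 hall_5 set_append .
qed

definition hall_excluded :: "gen lie_monomial list" where
  "hall_excluded = [left_normed [gB, gA, gA, gB, gC],
     Bracket (left_normed [gC, gB, gB]) (left_normed [gC, gA]),
     Bracket (left_normed [gC, gA, gA]) (left_normed [gC, gB]),
     Bracket (left_normed [gC, gA, gC]) (left_normed [gC, gB])]"

definition hall_rest :: "gen lie_monomial list" where
  "hall_rest = filter (\<lambda>T. T \<notin> set hall_excluded) hall_5"

lemma hall_rest_explicit: "hall_rest =
    [Bracket (left_normed [gB,gA,gA]) (left_normed [gB,gA]),
     Bracket (left_normed [gB,gA,gA]) (left_normed [gC,gA]),
     Bracket (left_normed [gB,gA,gA]) (left_normed [gC,gB]),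
     Bracket (left_normed [gB,gA,gB]) (left_normed [gB,gA]),
     Bracket (left_normed [gB,gA,gB]) (left_normed [gC,gA]),
     Bracket (left_normed [gB,gA,gB]) (left_normed [gC,gB]),
     Bracket (left_normed [gB,gA,gC]) (left_normed [gB,gA]),
     Bracket (left_normed [gB,gA,gC]) (left_normed [gC,gA]),
     Bracket (left_normed [gB,gA,gC]) (left_normed [gC,gB]),
     Bracket (left_normed [gC,gA,gA]) (left_normed [gB,gA]),
     Bracket (left_normed [gC,gA,gA]) (left_normed [gC,gA]),
     Bracket (left_normed [gC,gA,gB]) (left_normed [gB,gA]),
     Bracket (left_normed [gC,gA,gB]) (left_normed [gC,gA]),
     Bracket (left_normed [gC,gA,gB]) (left_normed [gC,gB]),
     Bracket (left_normed [gC,gA,gC]) (left_normed [gB,gA]),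
     Bracket (left_normed [gC,gA,gC]) (left_normed [gC,gA]),
     Bracket (left_normed [gC,gB,gB]) (left_normed [gB,gA]),
     Bracket (left_normed [gC,gB,gB]) (left_normed [gC,gB]),
     Bracket (left_normed [gC,gB,gC]) (left_normed [gB,gA]),
     Bracket (left_normed [gC,gB,gC]) (left_normed [gC,gA]),
     Bracket (left_normed [gC,gB,gC]) (left_normed [gC,gB]),
     left_normed [gB,gA,gA,gA,gA],
     left_normed [gB,gA,gA,gA,gB],
     left_normed [gB,gA,gA,gA,gC],
     left_normed [gB,gA,gA,gB,gB],
     left_normed [gB,gA,gA,gC,gC],
     left_normed [gB,gA,gB,gB,gB],
     left_normed [gB,gA,gB,gB,gC],
     left_normed [gB,gA,gB,gC,gC],
     left_normed [gB,gA,gC,gC,gC],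
     left_normed [gC,gA,gA,gA,gA],
     left_normed [gC,gA,gA,gA,gB],
     left_normed [gC,gA,gA,gA,gC],
     left_normed [gC,gA,gA,gB,gB],
     left_normed [gC,gA,gA,gB,gC],
     left_normed [gC,gA,gA,gC,gC],
     left_normed [gC,gA,gB,gB,gB],
     left_normed [gC,gA,gB,gB,gC],
     left_normed [gC,gA,gB,gC,gC],
     left_normed [gC,gA,gC,gC,gC],
     left_normed [gC,gB,gB,gB,gB],
     left_normed [gC,gB,gB,gB,gC],
     left_normed [gC,gB,gB,gC,gC],
     left_normed [gC,gB,gC,gC,gC]]"
  by code_simp

definition hall_upto_4 :: "gen lie_monomial list" where
  "hall_upto_4 = hall_1 @ hall_2 @ hall_3 @ hall_4"

abbreviation hall_basis :: "gen lie_monomial list" where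
  "hall_basis \<equiv> hall_upto_4 @ hall_rest"

lemma set_hall_basis:
  "set hall_basis = {T. hall T \<and> lie_length T \<le> 5}
      - {left_normed [gB, gA, gA, gB, gC],
         Bracket (left_normed [gC, gB, gB]) (left_normed [gC, gA]),
         Bracket (left_normed [gC, gA, gA]) (left_normed [gC, gB]),
         Bracket (left_normed [gC, gA, gC]) (left_normed [gC, gB])}"
proof -
  have "\<forall>T\<in>set hall_upto_4. T \<notin> set hall_excluded"
    by code_simp
  then show ?thesis
    unfolding hall_upto_5 hall_rest_def hall_upto_4_def set_append set_filter hall_excluded_def list.set by blast
qed

lemma distinct_hall_basis: "distinct hall_basis"
  by code_simp

lemma lie_length_hall:
  "\<forall>T\<in>set hall_1. lie_length T = 1" "\<forall>T\<in>set hall_2. lie_length T = 2"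
  "\<forall>T\<in>set hall_3. lie_length T = 3" "\<forall>T\<in>set hall_4. lie_length T = 4"
  by code_simp+

lemma lie_length_hall_basis:
  "\<forall>T\<in>set hall_upto_4. lie_length T \<le> 4" "\<forall>T\<in>set hall_rest. lie_length T = 5"
  by code_simp+

text \<open>These evaluations make the abstract filtered sums of \<open>leading_relation\<close>
  explicit; their order matches the independence lemmas above.\<close>

lemma hall_rest_degree:
  "filter (has_degree 3 2 0) hall_rest = [Bracket (left_normed [gB,gA,gA]) (left_normed [gB,gA]), left_normed [gB,gA,gA,gA,gB]]"
  "filter (has_degree 3 1 1) hall_rest = [Bracket (left_normed [gB,gA,gA]) (left_normed [gC,gA]), Bracket (left_normed [gC,gA,gA]) (left_normed [gB,gA]), left_normed [gB,gA,gA,gA,gC], left_normed [gC,gA,gA,gA,gB]]"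
  "filter (has_degree 2 2 1) hall_rest = [Bracket (left_normed [gB,gA,gA]) (left_normed [gC,gB]), Bracket (left_normed [gB,gA,gB]) (left_normed [gC,gA]), Bracket (left_normed [gB,gA,gC]) (left_normed [gB,gA]), Bracket (left_normed [gC,gA,gB]) (left_normed [gB,gA]), left_normed [gC,gA,gA,gB,gB]]"
  "filter (has_degree 2 3 0) hall_rest = [Bracket (left_normed [gB,gA,gB]) (left_normed [gB,gA]), left_normed [gB,gA,gA,gB,gB]]"
  "filter (has_degree 1 3 1) hall_rest = [Bracket (left_normed [gB,gA,gB]) (left_normed [gC,gB]), Bracket (left_normed [gC,gB,gB]) (left_normed [gB,gA]), left_normed [gB,gA,gB,gB,gC], left_normed [gC,gA,gB,gB,gB]]"
  "filter (has_degree 2 1 2) hall_rest = [Bracket (left_normed [gB,gA,gC]) (left_normed [gC,gA]), Bracket (left_normed [gC,gA,gB]) (left_normed [gC,gA]), Bracket (left_normed [gC,gA,gC]) (left_normed [gB,gA]), left_normed [gB,gA,gA,gC,gC], left_normed [gC,gA,gA,gB,gC]]"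
  "filter (has_degree 1 2 2) hall_rest = [Bracket (left_normed [gB,gA,gC]) (left_normed [gC,gB]), Bracket (left_normed [gC,gA,gB]) (left_normed [gC,gB]), Bracket (left_normed [gC,gB,gC]) (left_normed [gB,gA]), left_normed [gB,gA,gB,gC,gC], left_normed [gC,gA,gB,gB,gC]]"
  "filter (has_degree 3 0 2) hall_rest = [Bracket (left_normed [gC,gA,gA]) (left_normed [gC,gA]), left_normed [gC,gA,gA,gA,gC]]"
  "filter (has_degree 2 0 3) hall_rest = [Bracket (left_normed [gC,gA,gC]) (left_normed [gC,gA]), left_normed [gC,gA,gA,gC,gC]]"
  "filter (has_degree 0 3 2) hall_rest = [Bracket (left_normed [gC,gB,gB]) (left_normed [gC,gB]), left_normed [gC,gB,gB,gB,gC]]"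
  "filter (has_degree 1 1 3) hall_rest = [Bracket (left_normed [gC,gB,gC]) (left_normed [gC,gA]), left_normed [gB,gA,gC,gC,gC], left_normed [gC,gA,gB,gC,gC]]"
  "filter (has_degree 0 2 3) hall_rest = [Bracket (left_normed [gC,gB,gC]) (left_normed [gC,gB]), left_normed [gC,gB,gB,gC,gC]]"
  "filter (has_degree 4 1 0) hall_rest = [left_normed [gB,gA,gA,gA,gA]]"
  "filter (has_degree 1 4 0) hall_rest = [left_normed [gB,gA,gB,gB,gB]]"
  "filter (has_degree 4 0 1) hall_rest = [left_normed [gC,gA,gA,gA,gA]]"
  "filter (has_degree 1 0 4) hall_rest = [left_normed [gC,gA,gC,gC,gC]]"
  "filter (has_degree 0 4 1) hall_rest = [left_normed [gC,gB,gB,gB,gB]]"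
  "filter (has_degree 0 1 4) hall_rest = [left_normed [gC,gB,gC,gC,gC]]"
  by code_simp+

lemma hall_upto_4_degree:
  "filter (has_degree 2 1 1) hall_upto_4 = [Bracket (left_normed [gC,gA]) (left_normed [gB,gA]), left_normed [gB,gA,gA,gC], left_normed [gC,gA,gA,gB]]"
  "filter (has_degree 1 2 1) hall_upto_4 = [Bracket (left_normed [gC,gB]) (left_normed [gB,gA]), left_normed [gB,gA,gB,gC], left_normed [gC,gA,gB,gB]]"
  "filter (has_degree 1 1 2) hall_upto_4 = [Bracket (left_normed [gC,gB]) (left_normed [gC,gA]), left_normed [gB,gA,gC,gC], left_normed [gC,gA,gB,gC]]"
  "filter (has_degree 3 1 0) hall_upto_4 = [left_normed [gB,gA,gA,gA]]"
  "filter (has_degree 2 2 0) hall_upto_4 = [left_normed [gB,gA,gA,gB]]"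
  "filter (has_degree 1 3 0) hall_upto_4 = [left_normed [gB,gA,gB,gB]]"
  "filter (has_degree 3 0 1) hall_upto_4 = [left_normed [gC,gA,gA,gA]]"
  "filter (has_degree 2 0 2) hall_upto_4 = [left_normed [gC,gA,gA,gC]]"
  "filter (has_degree 1 0 3) hall_upto_4 = [left_normed [gC,gA,gC,gC]]"
  "filter (has_degree 0 3 1) hall_upto_4 = [left_normed [gC,gB,gB,gB]]"
  "filter (has_degree 0 2 2) hall_upto_4 = [left_normed [gC,gB,gB,gC]]"
  "filter (has_degree 0 1 3) hall_upto_4 = [left_normed [gC,gB,gC,gC]]"
  "filter (has_degree 2 1 0) hall_upto_4 = [left_normed [gB,gA,gA]]"
  "filter (has_degree 1 2 0) hall_upto_4 = [left_normed [gB,gA,gB]]"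
  "filter (has_degree 1 1 1) hall_upto_4 = [left_normed [gB,gA,gC], left_normed [gC,gA,gB]]"
  "filter (has_degree 2 0 1) hall_upto_4 = [left_normed [gC,gA,gA]]"
  "filter (has_degree 1 0 2) hall_upto_4 = [left_normed [gC,gA,gC]]"
  "filter (has_degree 0 2 1) hall_upto_4 = [left_normed [gC,gB,gB]]"
  "filter (has_degree 0 1 2) hall_upto_4 = [left_normed [gC,gB,gC]]"
  "filter (has_degree 1 1 0) hall_upto_4 = [left_normed [gB,gA]]"
  "filter (has_degree 1 0 1) hall_upto_4 = [left_normed [gC,gA]]"
  "filter (has_degree 0 1 1) hall_upto_4 = [left_normed [gC,gB]]"
  "filter (has_degree 1 0 0) hall_upto_4 = [Letter gA]"
  "filter (has_degree 0 1 0) hall_upto_4 = [Letter gB]"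
  "filter (has_degree 0 0 1) hall_upto_4 = [Letter gC]"
  by code_simp+

context aw_parameter
begin

text \<open>The coefficients at c^2 and A^2 B^2 differ by a factor s + 1 for the Hall element but by
  s for the square, up to powers of s - 1 and sign. Eliminating x leaves (s + 1) k = s k.\<close>

lemma leading_square_independent_220:
  assumes "s \<noteq> 1"
    and rel: "\<And>f. x * leading (left_normed [gB,gA,gA,gB]) f + k * leading (left_normed [gB,gA]) (act_lie 0 f (left_normed [gB,gA])) = 0"
  shows "k = 0"
proof -
  have e1: "(s - 1) * x - k = 0"
    by (rule clear_factor[OF rel[of "coord 0 0 0 0 0 2"] assms(1), of 0 _ "- 1"])
      (simp only: leading_4 leading_square, simp add: coord_def t_conv s_nonzero field_simps eval_nat_numeral)
  have e2: "(s - 1) * (s + 1) * x - s * k = 0"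
    by (rule clear_factor[OF rel[of "coord 2 2 0 0 0 0"] assms(1), of 2 _ "- 1"])
      (simp only: leading_4 leading_square, simp add: coord_def t_conv s_nonzero field_simps eval_nat_numeral)
  from e1 e2 show ?thesis by Groebner_Basis.algebra
qed

lemma leading_square_independent_202:
  assumes "s \<noteq> 1"
    and rel: "\<And>f. x * leading (left_normed [gC,gA,gA,gC]) f + k * leading (left_normed [gC,gA]) (act_lie 0 f (left_normed [gC,gA])) = 0"
  shows "k = 0"
proof -
  have e1: "(s - 1) * x + s * k = 0"
    by (rule clear_factor[OF rel[of "coord 0 0 0 0 2 0"] assms(1), of 0 _ "s ^ 3"])
      (simp only: leading_4 leading_square, simp add: coord_def t_conv s_nonzero field_simps eval_nat_numeral)
  have e2: "(s - 1) * (s + 1) * x + s * k = 0"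
    by (rule clear_factor[OF rel[of "coord 2 0 2 0 0 0"] assms(1), of 2 _ "s ^ 4"])
      (simp only: leading_4 leading_square, simp add: coord_def t_conv s_nonzero field_simps eval_nat_numeral)
  from e1 e2 have "s ^ 2 * k = 0" by Groebner_Basis.algebra
  then show ?thesis using s_nonzero by simp
qed

text \<open>This makes the square relations, proved for abstract functionals, available for the
  action.\<close>

lemma aw_functional_act:
  assumes "q \<noteq> 0" "q ^ 4 \<noteq> 1" "s = q ^ 2"
  shows "aw_functional q (\<lambda>p. act (q ^ 3 - inverse q) f p 0 0 0 0 0 0)"
  by unfold_locales (simp_all add: assms(1,2) act_add act_const_mult fun_comb_def act_aw_ideal[OF assms])

lemma act_sum_list: "act l f (\<Sum>T\<leftarrow>Ts. g T) i j k a b c = (\<Sum>T\<leftarrow>Ts. act l f (g T) i j k a b c)"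
  by (induction Ts) (simp_all add: act_add)

section \<open>Descent through the lengths 5, 4, 3, 2, 1\<close>

lemma hall_basis_independent:
  assumes q: "q \<noteq> 0" "q ^ 4 \<noteq> 1" "s = q ^ 2" and two: "(2 :: 'f) \<noteq> 0"
    and mem: "(\<Sum>T\<leftarrow>hall_basis. const (u T) * lie_eval T) \<in> aw_ideal q"
    and T: "T \<in> set hall_basis"
  shows "u T = 0"
proof -
  define l where "l = q ^ 3 - inverse q"
  have s1: "s \<noteq> 1" and s2: "s \<noteq> - 1"
    using q by (auto simp: power2_eq_square power4_eq_xxxx)
  have "l = inverse q * (q ^ 4 - 1)"
    using q(1) unfolding l_def by (simp add: field_simps power3_eq_cube power4_eq_xxxx)
  then have l0: "l \<noteq> 0" using q by simp
  have rel: "(\<Sum>T\<leftarrow>hall_basis. u T * act_lie l f T 0 0 0 0 0 0) = 0" for f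
    using fun_cong[OF fun_cong[OF fun_cong[OF fun_cong[OF fun_cong[OF fun_cong[OF act_aw_ideal[OF q mem, of f]]]]]], of 0 0 0 0 0 0]
    by (simp add: act_sum_list act_const_mult fun_comb_def act_lie_eval l_def del: map_append sum_list_append)
  \<comment> \<open>No longer element is present, so the remainder is 0; and no element of length at
    most 4 has a multidegree of total 5.\<close>
  have rel5: "(\<Sum>T\<leftarrow>filter (has_degree x y z) hall_rest. u T * leading T f) = 0" if d: "x + y + z = 5" for x y z f
  proof -
    have "(\<Sum>T\<leftarrow>filter (has_degree x y z) hall_basis. u T * leading T f) + 0 = 0"
      by (rule leading_relation[where e = "\<lambda>f. 0"])
        (use rel lie_length_hall_basis d in \<open>auto simp del: map_append sum_list_append\<close>)
    moreover have "filter (has_degree x y z) hall_upto_4 = []"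
      using lie_length_hall_basis(1) d by (auto simp: filter_empty_conv lie_length_conv_gen_count)
    ultimately show ?thesis by simp
  qed
  have d320: "u (Bracket (left_normed [gB,gA,gA]) (left_normed [gB,gA])) = 0 \<and> u (left_normed [gB,gA,gA,gA,gB]) = 0"
    by (rule leading_independent_320[OF s1]) (use rel5[of 3 2 0, unfolded hall_rest_degree] in \<open>simp add: add.assoc\<close>)
  have d311: "u (Bracket (left_normed [gC,gA,gA]) (left_normed [gB,gA])) = - u (Bracket (left_normed [gB,gA,gA]) (left_normed [gC,gA])) \<and> u (left_normed [gB,gA,gA,gA,gC]) = 0 \<and> u (left_normed [gC,gA,gA,gA,gB]) = 0"
    by (rule leading_independent_311[OF s1]) (use rel5[of 3 1 1, unfolded hall_rest_degree] in \<open>simp add: add.assoc\<close>)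
  have d221: "u (Bracket (left_normed [gB,gA,gA]) (left_normed [gC,gB])) = 0 \<and> u (Bracket (left_normed [gB,gA,gB]) (left_normed [gC,gA])) = 0 \<and> u (Bracket (left_normed [gB,gA,gC]) (left_normed [gB,gA])) = 0 \<and> u (Bracket (left_normed [gC,gA,gB]) (left_normed [gB,gA])) = 0 \<and> u (left_normed [gC,gA,gA,gB,gB]) = 0"
    by (rule leading_independent_221[OF s1 s2 two]) (use rel5[of 2 2 1, unfolded hall_rest_degree] in \<open>simp add: add.assoc\<close>)
  have d230: "u (Bracket (left_normed [gB,gA,gB]) (left_normed [gB,gA])) = 0 \<and> u (left_normed [gB,gA,gA,gB,gB]) = 0"
    by (rule leading_independent_230[OF s1]) (use rel5[of 2 3 0, unfolded hall_rest_degree] in \<open>simp add: add.assoc\<close>)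
  have d131: "u (Bracket (left_normed [gC,gB,gB]) (left_normed [gB,gA])) = - u (Bracket (left_normed [gB,gA,gB]) (left_normed [gC,gB])) \<and> u (left_normed [gB,gA,gB,gB,gC]) = 0 \<and> u (left_normed [gC,gA,gB,gB,gB]) = 0"
    by (rule leading_independent_131[OF s1]) (use rel5[of 1 3 1, unfolded hall_rest_degree] in \<open>simp add: add.assoc\<close>)
  have d212: "u (Bracket (left_normed [gB,gA,gC]) (left_normed [gC,gA])) = 0 \<and> u (Bracket (left_normed [gC,gA,gB]) (left_normed [gC,gA])) = 0 \<and> u (Bracket (left_normed [gC,gA,gC]) (left_normed [gB,gA])) = 0 \<and> u (left_normed [gB,gA,gA,gC,gC]) = 0 \<and> u (left_normed [gC,gA,gA,gB,gC]) = 0"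
    by (rule leading_independent_212[OF s1]) (use rel5[of 2 1 2, unfolded hall_rest_degree] in \<open>simp add: add.assoc\<close>)
  have d122: "u (Bracket (left_normed [gB,gA,gC]) (left_normed [gC,gB])) = 0 \<and> u (Bracket (left_normed [gC,gA,gB]) (left_normed [gC,gB])) = 0 \<and> u (Bracket (left_normed [gC,gB,gC]) (left_normed [gB,gA])) = 0 \<and> u (left_normed [gB,gA,gB,gC,gC]) = 0 \<and> u (left_normed [gC,gA,gB,gB,gC]) = 0"
    by (rule leading_independent_122[OF s1]) (use rel5[of 1 2 2, unfolded hall_rest_degree] in \<open>simp add: add.assoc\<close>)
  have d302: "u (Bracket (left_normed [gC,gA,gA]) (left_normed [gC,gA])) = 0 \<and> u (left_normed [gC,gA,gA,gA,gC]) = 0"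
    by (rule leading_independent_302[OF s1]) (use rel5[of 3 0 2, unfolded hall_rest_degree] in \<open>simp add: add.assoc\<close>)
  have d203: "u (Bracket (left_normed [gC,gA,gC]) (left_normed [gC,gA])) = 0 \<and> u (left_normed [gC,gA,gA,gC,gC]) = 0"
    by (rule leading_independent_203[OF s1]) (use rel5[of 2 0 3, unfolded hall_rest_degree] in \<open>simp add: add.assoc\<close>)
  have d032: "u (Bracket (left_normed [gC,gB,gB]) (left_normed [gC,gB])) = 0 \<and> u (left_normed [gC,gB,gB,gB,gC]) = 0"
    by (rule leading_independent_032[OF s1]) (use rel5[of 0 3 2, unfolded hall_rest_degree] in \<open>simp add: add.assoc\<close>)
  have d113: "u (Bracket (left_normed [gC,gB,gC]) (left_normed [gC,gA])) = 0 \<and> u (left_normed [gB,gA,gC,gC,gC]) = 0 \<and> u (left_normed [gC,gA,gB,gC,gC]) = 0"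
    by (rule leading_independent_113[OF s1]) (use rel5[of 1 1 3, unfolded hall_rest_degree] in \<open>simp add: add.assoc\<close>)
  have d023: "u (Bracket (left_normed [gC,gB,gC]) (left_normed [gC,gB])) = 0 \<and> u (left_normed [gC,gB,gB,gC,gC]) = 0"
    by (rule leading_independent_023[OF s1]) (use rel5[of 0 2 3, unfolded hall_rest_degree] in \<open>simp add: add.assoc\<close>)
  have d410: "u (left_normed [gB,gA,gA,gA,gA]) = 0"
    by (rule leading_independent_410[OF s1]) (use rel5[of 4 1 0, unfolded hall_rest_degree] in \<open>simp add: add.assoc\<close>)
  have d140: "u (left_normed [gB,gA,gB,gB,gB]) = 0"
    by (rule leading_independent_140[OF s1]) (use rel5[of 1 4 0, unfolded hall_rest_degree] in \<open>simp add: add.assoc\<close>)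
  have d401: "u (left_normed [gC,gA,gA,gA,gA]) = 0"
    by (rule leading_independent_401[OF s1]) (use rel5[of 4 0 1, unfolded hall_rest_degree] in \<open>simp add: add.assoc\<close>)
  have d104: "u (left_normed [gC,gA,gC,gC,gC]) = 0"
    by (rule leading_independent_104[OF s1]) (use rel5[of 1 0 4, unfolded hall_rest_degree] in \<open>simp add: add.assoc\<close>)
  have d041: "u (left_normed [gC,gB,gB,gB,gB]) = 0"
    by (rule leading_independent_041[OF s1]) (use rel5[of 0 4 1, unfolded hall_rest_degree] in \<open>simp add: add.assoc\<close>)
  have d014: "u (left_normed [gC,gB,gC,gC,gC]) = 0"
    by (rule leading_independent_014[OF s1]) (use rel5[of 0 1 4, unfolded hall_rest_degree] in \<open>simp add: add.assoc\<close>)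
  note rest = d320 d311 d221 d230 d131 d212 d122 d302 d203 d032 d113 d023 d410 d140 d401 d104 d041 d014
  \<comment> \<open>Q is the value of f at the square of T.\<close>
  define Q where "Q T f = act_lie l (act_lie l f T) T 0 0 0 0 0 0" for T f
  define v w where "v = u (Bracket (left_normed [gB,gA,gA]) (left_normed [gC,gA]))" and "w = u (Bracket (left_normed [gB,gA,gB]) (left_normed [gC,gB]))"
  \<comment> \<open>With v and w the two coefficients left open, this is all that remains of the sum
    over length 5, by the square relations for A and B.\<close>
  define e where "e f = l * (1 - 1 / s) * (v * (Q (left_normed [gB,gA]) f - Q (left_normed [gC,gA]) f) + w * (Q (left_normed [gC,gB]) f - Q (left_normed [gB,gA]) f))" for f
  have e: "(\<Sum>T\<leftarrow>hall_rest. u T * act_lie l f T 0 0 0 0 0 0) = e f" for f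
  proof -
    interpret F: aw_functional q "\<lambda>p. act (q ^ 3 - inverse q) f p 0 0 0 0 0 0"
      by (rule aw_functional_act) (use q in auto)
    have k: "l * (1 - 1 / s) = F.l * (1 - 1 / F.s)"
      unfolding F.l_def F.s_def l_def q(3) ..
    have sq: "act_lie l f (Bracket (left_normed [gB,gA,gA]) (left_normed [gC,gA])) 0 0 0 0 0 0 - act_lie l f (Bracket (left_normed [gC,gA,gA]) (left_normed [gB,gA])) 0 0 0 0 0 0
        = l * (1 - 1 / s) * (Q (left_normed [gB,gA]) f - Q (left_normed [gC,gA]) f)"
      "act_lie l f (Bracket (left_normed [gB,gA,gB]) (left_normed [gC,gB])) 0 0 0 0 0 0 - act_lie l f (Bracket (left_normed [gC,gB,gB]) (left_normed [gB,gA])) 0 0 0 0 0 0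
        = l * (1 - 1 / s) * (Q (left_normed [gC,gB]) f - Q (left_normed [gB,gA]) f)"
      using F.square_relation_A F.square_relation_B
      unfolding Q_def k act_mult act_lie_eval l_def[symmetric] by simp_all
    have "(\<Sum>T\<leftarrow>hall_rest. u T * act_lie l f T 0 0 0 0 0 0)
        = v * (act_lie l f (Bracket (left_normed [gB,gA,gA]) (left_normed [gC,gA])) 0 0 0 0 0 0 - act_lie l f (Bracket (left_normed [gC,gA,gA]) (left_normed [gB,gA])) 0 0 0 0 0 0)
          + w * (act_lie l f (Bracket (left_normed [gB,gA,gB]) (left_normed [gC,gB])) 0 0 0 0 0 0 - act_lie l f (Bracket (left_normed [gC,gB,gB]) (left_normed [gB,gA])) 0 0 0 0 0 0)"
      unfolding hall_rest_explicit by (simp add: rest v_def w_def right_diff_distrib del: act_lie.simps)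
    then show ?thesis unfolding sq e_def by (simp only: distrib_left mult.left_commute)
  qed
  \<comment> \<open>The whole length 5 part now enters as the remainder e.\<close>
  have rel4: "(\<Sum>T\<leftarrow>filter (has_degree x y z) hall_upto_4. u T * leading T f) + e (restrict_degree x y z f) = 0"
    if d: "x + y + z = 4" for x y z f
    by (rule leading_relation) (use rel e lie_length_hall_basis d in \<open>auto simp: algebra_simps\<close>)
  have Q: "Q T (restrict_degree x y z f) = (if 2 * gen_count gA T = x \<and> 2 * gen_count gB T = y \<and> 2 * gen_count gC T = z
      then leading T (act_lie 0 f T) else 0)" if "x + y + z = 4" "lie_length T = 2" for T x y z f
    using act_lie_twice_restrict_degree[of T T x y z l f] that unfolding Q_def by (simp add: mult_2)
  have count: "gen_count gA (left_normed [gB,gA]) = 1" "gen_count gB (left_normed [gB,gA]) = 1" "gen_count gC (left_normed [gB,gA]) = 0"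
    "gen_count gA (left_normed [gC,gA]) = 1" "gen_count gB (left_normed [gC,gA]) = 0" "gen_count gC (left_normed [gC,gA]) = 1"
    "gen_count gA (left_normed [gC,gB]) = 0" "gen_count gB (left_normed [gC,gB]) = 1" "gen_count gC (left_normed [gC,gB]) = 1"
    "lie_length (left_normed [gB,gA]) = 2" "lie_length (left_normed [gC,gA]) = 2" "lie_length (left_normed [gC,gB]) = 2"
    by (simp_all add: left_normed_def)
  have four: "2 + 2 + 0 = (4 :: nat)" "2 + 0 + 2 = (4 :: nat)"
    by simp_all
  have alg: "k * (x * (y - 0) + z * (0 - y)) = k * (x - z) * y" "k * (x * (0 - y) + z * (0 - 0)) = k * (- x) * y" for k x y z :: 'f
    by (simp_all add: algebra_simps)
  \<comment> \<open>The squares of [BA], [CA], [CB] lie in the multidegrees (2,2,0), (2,0,2),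
    (0,2,2). Each restriction keeps one of them, with coefficient v - w in the first case and -v in
    the second, up to l (1 - 1/s).\<close>
  have "Q (left_normed [gB,gA]) (restrict_degree 2 2 0 f) = leading (left_normed [gB,gA]) (act_lie 0 f (left_normed [gB,gA]))"
    "Q (left_normed [gC,gA]) (restrict_degree 2 2 0 f) = 0" "Q (left_normed [gC,gB]) (restrict_degree 2 2 0 f) = 0" for f
    by (simp_all add: Q count)
  then have e220: "e (restrict_degree 2 2 0 f) = l * (1 - 1 / s) * (v - w) * leading (left_normed [gB,gA]) (act_lie 0 f (left_normed [gB,gA]))" for f
    unfolding e_def by (simp only: alg)
  have "u (left_normed [gB,gA,gA,gB]) * leading (left_normed [gB,gA,gA,gB]) f + l * (1 - 1 / s) * (v - w) * leading (left_normed [gB,gA]) (act_lie 0 f (left_normed [gB,gA])) = 0" for f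
    using rel4[OF four(1), of f] unfolding hall_upto_4_degree e220 by (simp only: list.map sum_list.Cons sum_list.Nil add_0_right)
  then have k1: "l * (1 - 1 / s) * (v - w) = 0"
    by (rule leading_square_independent_220[OF s1])
  have "Q (left_normed [gC,gA]) (restrict_degree 2 0 2 f) = leading (left_normed [gC,gA]) (act_lie 0 f (left_normed [gC,gA]))"
    "Q (left_normed [gB,gA]) (restrict_degree 2 0 2 f) = 0" "Q (left_normed [gC,gB]) (restrict_degree 2 0 2 f) = 0" for f
    by (simp_all add: Q count)
  then have e202: "e (restrict_degree 2 0 2 f) = l * (1 - 1 / s) * (- v) * leading (left_normed [gC,gA]) (act_lie 0 f (left_normed [gC,gA]))" for f
    unfolding e_def by (simp only: alg)
  have "u (left_normed [gC,gA,gA,gC]) * leading (left_normed [gC,gA,gA,gC]) f + l * (1 - 1 / s) * (- v) * leading (left_normed [gC,gA]) (act_lie 0 f (left_normed [gC,gA])) = 0" for f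
    using rel4[OF four(2), of f] unfolding hall_upto_4_degree e202 by (simp only: list.map sum_list.Cons sum_list.Nil add_0_right)
  then have k2: "l * (1 - 1 / s) * (- v) = 0"
    by (rule leading_square_independent_202[OF s1])
  have vw: "v = 0" "w = 0"
    using k1 k2 l0 s1 s_nonzero by simp_all
  then have e0: "e f = 0" for f unfolding e_def by simp
  \<comment> \<open>With e = 0 the descent is uniform: once all coefficients of larger length
    vanish, the leading relations of the current length hold without remainder.\<close>
  have rel_low: "(\<Sum>T\<leftarrow>filter (has_degree x y z) hall_upto_4. u T * leading T f) = 0"
    if low: "\<forall>T\<in>set hall_upto_4. x + y + z < lie_length T \<longrightarrow> u T = 0" for x y z f
  proof -
    have "(\<Sum>T\<leftarrow>hall_upto_4. u T * act_lie l f T 0 0 0 0 0 0) + 0 = 0" for f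
      using rel[of f] e[of f] e0[of f] by (simp add: algebra_simps)
    moreover have "u T = 0 \<or> lie_length T \<le> x + y + z" if "T \<in> set hall_upto_4" for T
      using low that by (auto simp: not_le)
    ultimately have "(\<Sum>T\<leftarrow>filter (has_degree x y z) hall_upto_4. u T * leading T f) + 0 = 0"
      by (rule leading_relation[where e = "\<lambda>f. 0"])
    then show ?thesis by simp
  qed
  have rel4': "(\<Sum>T\<leftarrow>filter (has_degree x y z) hall_upto_4. u T * leading T f) = 0" if "x + y + z = 4" for x y z f
    by (rule rel_low) (use that lie_length_hall in \<open>auto simp: hall_upto_4_def\<close>)
  have d211: "u (Bracket (left_normed [gC,gA]) (left_normed [gB,gA])) = 0 \<and> u (left_normed [gB,gA,gA,gC]) = 0 \<and> u (left_normed [gC,gA,gA,gB]) = 0"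
    by (rule leading_independent_211[OF s1]) (use rel4'[of 2 1 1, unfolded hall_upto_4_degree] in \<open>simp add: add.assoc\<close>)
  have d121: "u (Bracket (left_normed [gC,gB]) (left_normed [gB,gA])) = 0 \<and> u (left_normed [gB,gA,gB,gC]) = 0 \<and> u (left_normed [gC,gA,gB,gB]) = 0"
    by (rule leading_independent_121[OF s1]) (use rel4'[of 1 2 1, unfolded hall_upto_4_degree] in \<open>simp add: add.assoc\<close>)
  have d112: "u (Bracket (left_normed [gC,gB]) (left_normed [gC,gA])) = 0 \<and> u (left_normed [gB,gA,gC,gC]) = 0 \<and> u (left_normed [gC,gA,gB,gC]) = 0"
    by (rule leading_independent_112[OF s1]) (use rel4'[of 1 1 2, unfolded hall_upto_4_degree] in \<open>simp add: add.assoc\<close>)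
  have d310: "u (left_normed [gB,gA,gA,gA]) = 0"
    by (rule leading_independent_310[OF s1]) (use rel4'[of 3 1 0, unfolded hall_upto_4_degree] in \<open>simp add: add.assoc\<close>)
  have d220: "u (left_normed [gB,gA,gA,gB]) = 0"
    by (rule leading_independent_220[OF s1]) (use rel4'[of 2 2 0, unfolded hall_upto_4_degree] in \<open>simp add: add.assoc\<close>)
  have d130: "u (left_normed [gB,gA,gB,gB]) = 0"
    by (rule leading_independent_130[OF s1]) (use rel4'[of 1 3 0, unfolded hall_upto_4_degree] in \<open>simp add: add.assoc\<close>)
  have d301: "u (left_normed [gC,gA,gA,gA]) = 0"
    by (rule leading_independent_301[OF s1]) (use rel4'[of 3 0 1, unfolded hall_upto_4_degree] in \<open>simp add: add.assoc\<close>)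
  have d202: "u (left_normed [gC,gA,gA,gC]) = 0"
    by (rule leading_independent_202[OF s1]) (use rel4'[of 2 0 2, unfolded hall_upto_4_degree] in \<open>simp add: add.assoc\<close>)
  have d103: "u (left_normed [gC,gA,gC,gC]) = 0"
    by (rule leading_independent_103[OF s1]) (use rel4'[of 1 0 3, unfolded hall_upto_4_degree] in \<open>simp add: add.assoc\<close>)
  have d031: "u (left_normed [gC,gB,gB,gB]) = 0"
    by (rule leading_independent_031[OF s1]) (use rel4'[of 0 3 1, unfolded hall_upto_4_degree] in \<open>simp add: add.assoc\<close>)
  have d022: "u (left_normed [gC,gB,gB,gC]) = 0"
    by (rule leading_independent_022[OF s1]) (use rel4'[of 0 2 2, unfolded hall_upto_4_degree] in \<open>simp add: add.assoc\<close>)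
  have d013: "u (left_normed [gC,gB,gC,gC]) = 0"
    by (rule leading_independent_013[OF s1]) (use rel4'[of 0 1 3, unfolded hall_upto_4_degree] in \<open>simp add: add.assoc\<close>)
  have z4: "\<forall>T\<in>set hall_4. u T = 0"
    unfolding hall_4_def by (simp add: d211 d121 d112 d310 d220 d130 d301 d202 d103 d031 d022 d013)
  have rel3': "(\<Sum>T\<leftarrow>filter (has_degree x y z) hall_upto_4. u T * leading T f) = 0" if "x + y + z = 3" for x y z f
    by (rule rel_low) (use that lie_length_hall z4 in \<open>auto simp: hall_upto_4_def\<close>)
  have d210: "u (left_normed [gB,gA,gA]) = 0"
    by (rule leading_independent_210[OF s1]) (use rel3'[of 2 1 0, unfolded hall_upto_4_degree] in \<open>simp add: add.assoc\<close>)
  have d120: "u (left_normed [gB,gA,gB]) = 0"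
    by (rule leading_independent_120[OF s1]) (use rel3'[of 1 2 0, unfolded hall_upto_4_degree] in \<open>simp add: add.assoc\<close>)
  have d111: "u (left_normed [gB,gA,gC]) = 0 \<and> u (left_normed [gC,gA,gB]) = 0"
    by (rule leading_independent_111[OF s1]) (use rel3'[of 1 1 1, unfolded hall_upto_4_degree] in \<open>simp add: add.assoc\<close>)
  have d201: "u (left_normed [gC,gA,gA]) = 0"
    by (rule leading_independent_201[OF s1]) (use rel3'[of 2 0 1, unfolded hall_upto_4_degree] in \<open>simp add: add.assoc\<close>)
  have d102: "u (left_normed [gC,gA,gC]) = 0"
    by (rule leading_independent_102[OF s1]) (use rel3'[of 1 0 2, unfolded hall_upto_4_degree] in \<open>simp add: add.assoc\<close>)
  have d021: "u (left_normed [gC,gB,gB]) = 0"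
    by (rule leading_independent_021[OF s1]) (use rel3'[of 0 2 1, unfolded hall_upto_4_degree] in \<open>simp add: add.assoc\<close>)
  have d012: "u (left_normed [gC,gB,gC]) = 0"
    by (rule leading_independent_012[OF s1]) (use rel3'[of 0 1 2, unfolded hall_upto_4_degree] in \<open>simp add: add.assoc\<close>)
  have z3: "\<forall>T\<in>set hall_3. u T = 0"
    unfolding hall_3_def by (simp add: d210 d120 d111 d201 d102 d021 d012)
  have rel2': "(\<Sum>T\<leftarrow>filter (has_degree x y z) hall_upto_4. u T * leading T f) = 0" if "x + y + z = 2" for x y z f
    by (rule rel_low) (use that lie_length_hall z4 z3 in \<open>auto simp: hall_upto_4_def\<close>)
  have d110: "u (left_normed [gB,gA]) = 0"
    by (rule leading_independent_110[OF s1]) (use rel2'[of 1 1 0, unfolded hall_upto_4_degree] in \<open>simp add: add.assoc\<close>)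
  have d101: "u (left_normed [gC,gA]) = 0"
    by (rule leading_independent_101[OF s1]) (use rel2'[of 1 0 1, unfolded hall_upto_4_degree] in \<open>simp add: add.assoc\<close>)
  have d011: "u (left_normed [gC,gB]) = 0"
    by (rule leading_independent_011[OF s1]) (use rel2'[of 0 1 1, unfolded hall_upto_4_degree] in \<open>simp add: add.assoc\<close>)
  have z2: "\<forall>T\<in>set hall_2. u T = 0"
    unfolding hall_2_def by (simp add: d110 d101 d011)
  have rel1': "(\<Sum>T\<leftarrow>filter (has_degree x y z) hall_upto_4. u T * leading T f) = 0" if "x + y + z = 1" for x y z f
    by (rule rel_low) (use that lie_length_hall z4 z3 z2 in \<open>auto simp: hall_upto_4_def\<close>)
  have d100: "u (Letter gA) = 0"
    by (rule leading_independent_100[OF s1]) (use rel1'[of 1 0 0, unfolded hall_upto_4_degree] in \<open>simp add: add.assoc\<close>)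
  have d010: "u (Letter gB) = 0"
    by (rule leading_independent_010[OF s1]) (use rel1'[of 0 1 0, unfolded hall_upto_4_degree] in \<open>simp add: add.assoc\<close>)
  have d001: "u (Letter gC) = 0"
    by (rule leading_independent_001[OF s1]) (use rel1'[of 0 0 1, unfolded hall_upto_4_degree] in \<open>simp add: add.assoc\<close>)
  have z1: "\<forall>T\<in>set hall_1. u T = 0"
    unfolding hall_1_def by (simp add: d100 d010 d001)
  have "\<forall>T\<in>set hall_rest. u T = 0"
    unfolding hall_rest_explicit using vw by (simp add: rest v_def w_def)
  with z1 z2 z3 z4 T show ?thesis by (auto simp: hall_upto_4_def)
qed

end

section \<open>The Lie algebra as a subspace of the quotient\<close>

lemma aw_proj_eq_iff: "aw_proj q x = aw_proj q y \<longleftrightarrow> x - y \<in> aw_ideal q"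
proof
  assume "aw_proj q x = aw_proj q y"
  moreover have "x \<in> aw_proj q x"
    unfolding aw_proj_def a_r_coset_def' using aw_ideal_zero[of q] by force
  ultimately obtain h where "h \<in> aw_ideal q" "x = h + y"
    unfolding aw_proj_def a_r_coset_def' by auto
  then show "x - y \<in> aw_ideal q" by simp
next
  have *: "aw_proj q u \<subseteq> aw_proj q v" if "u - v \<in> aw_ideal q" for u v
  proof
    fix z assume "z \<in> aw_proj q u"
    then obtain h where "h \<in> aw_ideal q" "z = h + u"
      unfolding aw_proj_def a_r_coset_def' by auto
    then have "h + (u - v) \<in> aw_ideal q" "z = (h + (u - v)) + v"
      using aw_ideal_add[OF _ that] by auto
    then show "z \<in> aw_proj q v"
      unfolding aw_proj_def a_r_coset_def' by force
  qed
  assume "x - y \<in> aw_ideal q"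
  with aw_ideal_uminus[OF this] show "aw_proj q x = aw_proj q y"
    using *[of x y] *[of y x] by auto
qed

lemma aw_algebra_simps:
  "carrier (aw_algebra q) = range (aw_proj q)"
  "aw_proj q x \<oplus>\<^bsub>aw_algebra q\<^esub> aw_proj q y = aw_proj q (x + y)"
  "aw_proj q x \<otimes>\<^bsub>aw_algebra q\<^esub> aw_proj q y = aw_proj q (x * y)"
  "\<zero>\<^bsub>aw_algebra q\<^esub> = aw_proj q 0"
  "c \<odot>\<^bsub>aw_algebra q\<^esub> aw_proj q x = aw_proj q (const c * x)"
proof -
  interpret I: ideal "aw_ideal q" "ring_of_type_algebra :: 'a free_alg ring"
    by (rule ideal_aw_ideal)
  have mult: "aw_proj q x \<otimes>\<^bsub>aw_ring q\<^esub> aw_proj q y = aw_proj q (x * y)" for x y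
    using I.rcoset_mult_add[of x y] unfolding aw_ring_def FactRing_def aw_proj_def by simp
  show "carrier (aw_algebra q) = range (aw_proj q)"
    by (auto simp: aw_algebra_def ring.extend_def ring.defs monoid.defs module.defs aw_ring_def FactRing_def A_RCOSETS_def' aw_proj_def)
  show "aw_proj q x \<oplus>\<^bsub>aw_algebra q\<^esub> aw_proj q y = aw_proj q (x + y)"
    using I.a_rcos_sum[of x y]
    by (simp add: aw_algebra_def ring.defs monoid.defs module.defs aw_ring_def FactRing_def aw_proj_def)
  show "aw_proj q x \<otimes>\<^bsub>aw_algebra q\<^esub> aw_proj q y = aw_proj q (x * y)"
    using mult[of x y] by (simp add: aw_algebra_def ring.defs monoid.defs module.defs)
  show "\<zero>\<^bsub>aw_algebra q\<^esub> = aw_proj q 0"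
    by (auto simp: aw_algebra_def ring.defs monoid.defs module.defs aw_ring_def FactRing_def aw_proj_def a_r_coset_def')
  show "c \<odot>\<^bsub>aw_algebra q\<^esub> aw_proj q x = aw_proj q (const c * x)"
    using mult[of "const c" x] by (simp add: aw_algebra_def ring.defs monoid.defs module.defs)
qed

lemma module_aw_algebra: "module ring_of_type_algebra (aw_algebra (q :: 'f::field))"
proof (rule module_criteria)
  show "cring (ring_of_type_algebra :: 'f ring)" by (rule cring_from_type_algebra)
  have "\<exists>y. aw_proj q (x + y) = aw_proj q 0" for x
    by (rule exI[of _ "- x"]) simp
  then show "\<forall>v\<in>carrier (aw_algebra q). \<exists>w\<in>carrier (aw_algebra q). v \<oplus>\<^bsub>aw_algebra q\<^esub> w = \<zero>\<^bsub>aw_algebra q\<^esub>"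
    by (auto simp: aw_algebra_simps)
qed (auto simp: aw_algebra_simps ac_simps const_mult_const const_add distrib_left distrib_right
    simp flip: const_mult_const)

lemma vectorspace_aw_algebra: "vectorspace ring_of_type_algebra (aw_algebra (q :: 'f::field))"
  unfolding vectorspace_def using module_aw_algebra field_from_type_algebra by blast

lemma aw_algebra_diff: "aw_proj q x \<ominus>\<^bsub>aw_algebra q\<^esub> aw_proj q y = aw_proj q (x - (y :: 'f::field free_alg))"
proof -
  interpret M: Module.module ring_of_type_algebra "aw_algebra q" by (rule module_aw_algebra)
  have "\<ominus>\<^bsub>aw_algebra q\<^esub> aw_proj q y = aw_proj q (- y)"
    by (rule M.minus_equality) (simp_all add: aw_algebra_simps)
  then show ?thesis by (simp add: a_minus_def aw_algebra_simps)
qed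

definition aw_lie_carrier :: "'f::field \<Rightarrow> 'f free_alg set set" where
  "aw_lie_carrier q = lie_generated ring_of_type_algebra (aw_algebra q) (range (aw_proj q \<circ> letter))"

lemma submodule_aw_lie_carrier: "submodule ring_of_type_algebra (aw_lie_carrier q) (aw_algebra q)"
proof -
  let ?M = "aw_algebra q" and ?F = "{H. lie_subalgebra ring_of_type_algebra (aw_algebra q) H \<and> range (aw_proj q \<circ> letter) \<subseteq> H}"
  interpret M: vectorspace ring_of_type_algebra ?M by (rule vectorspace_aw_algebra)
  have sub: "submodule ring_of_type_algebra H ?M" if "H \<in> ?F" for H
    using that unfolding lie_subalgebra_def subspace_def by blast
  have "submodule ring_of_type_algebra (carrier ?M) ?M"
    unfolding submodule_def using module_aw_algebra by auto
  \<comment> \<open>The whole algebra belongs to the family, so the intersection is over a nonempty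
    family and stays inside the carrier.\<close>
  then have "carrier ?M \<in> ?F"
    using vectorspace_aw_algebra
    by (auto simp: lie_subalgebra_def subspace_def aw_algebra_simps aw_algebra_diff)
  then show ?thesis
    using sub unfolding aw_lie_carrier_def lie_generated_def submodule_def[where N = "\<Inter>_"]
    by (intro conjI allI impI InterI module_aw_algebra) (auto simp: submodule_def)
qed

text \<open>Spans of standard monomials may therefore be computed in \<open>\<Delta>\<close> instead
  of L.\<close>

lemma std_monomial_in_aw_lie_carrier: "std_monomial q T \<in> aw_lie_carrier q"
proof (induction T)
  case (Letter x)
  show ?case by (auto simp: std_monomial_def aw_lie_carrier_def lie_generated_def)
next
  case (Bracket U V)
  have "std_monomial q (Bracket U V) = (std_monomial q U \<otimes>\<^bsub>aw_algebra q\<^esub> std_monomial q V)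
      \<ominus>\<^bsub>aw_algebra q\<^esub> (std_monomial q V \<otimes>\<^bsub>aw_algebra q\<^esub> std_monomial q U)"
    by (simp add: std_monomial_def commutator_def aw_algebra_simps aw_algebra_diff)
  then show ?case
    using Bracket.IH unfolding aw_lie_carrier_def lie_generated_def lie_subalgebra_def by auto
qed

lemma finsum_aw_proj:
  assumes "finite J"
  shows "(\<Oplus>\<^bsub>aw_algebra q\<^esub>T\<in>J. aw_proj q (g T)) = aw_proj q (\<Sum>T\<in>J. g T :: 'f::field free_alg)"
proof -
  interpret M: Module.module ring_of_type_algebra "aw_algebra q" by (rule module_aw_algebra)
  show ?thesis using assms
    by (induction J rule: finite_induct) (simp_all add: aw_algebra_simps)
qed

text \<open>The relation is given as a list of coefficients and monomials, so that membership of its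
  terms in a submodule can be checked entry by entry.\<close>

lemma aw_functional_relation:
  assumes q: "q \<noteq> 0" "q ^ 4 \<noteq> 1"
    and rel: "\<And>f. aw_functional q f \<Longrightarrow> d * f (lie_eval T) = (\<Sum>(c, U)\<leftarrow>cs. c * f (lie_eval U))"
  shows "const d * lie_eval T - (\<Sum>(c, U)\<leftarrow>cs. const c * lie_eval U) \<in> aw_ideal q"
proof (rule aw_functionals_separate[OF q])
  fix f assume "aw_functional q f"
  then interpret aw_functional q f .
  have "f (\<Sum>(c, U)\<leftarrow>cs. const c * lie_eval U) = (\<Sum>(c, U)\<leftarrow>cs. c * f (lie_eval U))"
    using f_ideal[OF aw_ideal_zero] by (induction cs) (auto simp: f_add f_scale)
  then show "f (const d * lie_eval T - (\<Sum>(c, U)\<leftarrow>cs. const c * lie_eval U)) = 0"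
    using rel[OF \<open>aw_functional q f\<close>] by (simp add: f_diff f_scale)
qed

lemma std_monomial_in_submodule:
  assumes N: "submodule ring_of_type_algebra N (aw_algebra q)"
    and rel: "const d * lie_eval T - (\<Sum>(c, U)\<leftarrow>cs. const c * lie_eval U) \<in> aw_ideal q"
    and d: "d \<noteq> 0" and cs: "\<And>c U. (c, U) \<in> set cs \<Longrightarrow> std_monomial q U \<in> N"
  shows "std_monomial q T \<in> N"
proof -
  interpret N: submodule ring_of_type_algebra N "aw_algebra q" by (rule N)
  have smult: "aw_proj q (const c * x) \<in> N" if "aw_proj q x \<in> N" for c x
    using N.smult_closed[of c, OF _ that] by (simp add: aw_algebra_simps)
  have "aw_proj q (\<Sum>(c, U)\<leftarrow>cs. const c * lie_eval U) \<in> N"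
    using cs
  proof (induction cs)
    case Nil
    then show ?case using N.zero_closed by (simp add: aw_algebra_simps)
  next
    case (Cons p cs)
    obtain c U where p: "p = (c, U)" by (cases p)
    have "aw_proj q (const c * lie_eval U) \<in> N"
      using Cons.prems[of c U] smult unfolding p std_monomial_def by simp
    moreover have "aw_proj q (\<Sum>(c, U)\<leftarrow>cs. const c * lie_eval U) \<in> N"
      by (rule Cons.IH) (use Cons.prems in auto)
    ultimately show ?case
      using N.m_closed unfolding p by (fastforce simp: aw_algebra_simps)
  qed
  then have "aw_proj q (const d * lie_eval T) \<in> N"
    using rel aw_proj_eq_iff by metis
  from smult[OF this, of "inverse d"] show ?thesis
    using d by (simp add: std_monomial_def mult.assoc[symmetric] const_mult_const)
qed

section \<open>Independence and spanning in the quotient\<close>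

lemma hall_basis_independent_sum:
  fixes q :: "'f::field"
  assumes q: "q \<noteq> 0" "q ^ 4 \<noteq> 1" and two: "(2 :: 'f) \<noteq> 0"
    and mem: "(\<Sum>T\<in>set hall_basis. const (u T) * lie_eval T) \<in> aw_ideal q"
    and T: "T \<in> set hall_basis"
  shows "u T = 0"
proof -
  interpret aw_parameter "q ^ 2" "inverse (q ^ 2)"
    by unfold_locales (use q(1) in simp)
  show ?thesis
    using hall_basis_independent[OF q refl two _ T, of u] mem
    unfolding sum.distinct_set_conv_list[OF distinct_hall_basis] by blast
qed

lemma inj_on_std_monomial:
  assumes q: "q \<noteq> 0" "q ^ 4 \<noteq> 1" and two: "(2 :: 'f::field) \<noteq> 0"
  shows "inj_on (std_monomial (q :: 'f)) (set hall_basis)"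
proof (rule inj_onI, rule ccontr)
  fix T U assume T: "T \<in> set hall_basis" and U: "U \<in> set hall_basis"
    and eq: "std_monomial q T = std_monomial q U" and "T \<noteq> U"
  \<comment> \<open>Two equal images would give the relation with coefficients 1 and -1, so
    injectivity is a case of independence.\<close>
  define u :: "gen lie_monomial \<Rightarrow> 'f" where "u k = (if k = T then 1 else if k = U then - 1 else 0)" for k
  have "(\<Sum>k\<in>set hall_basis. const (u k) * lie_eval k)
      = (\<Sum>k\<in>set hall_basis. (if k = T then lie_eval k else 0) - (if k = U then lie_eval k else 0))"
    by (rule sum.cong) (use \<open>T \<noteq> U\<close> in \<open>auto simp: u_def const_uminus\<close>)
  also have "\<dots> = lie_eval T - lie_eval U"
    unfolding sum_subtractf sum.delta'[OF finite_set] sum.delta[OF finite_set] using T U by simp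
  finally have "u T = 0"
    using eq hall_basis_independent_sum[OF q two _ T, of u]
    by (simp add: std_monomial_def aw_proj_eq_iff del: set_append)
  then show False by (simp add: u_def)
qed

lemma lin_indpt_std_monomial:
  assumes q: "q \<noteq> 0" "q ^ 4 \<noteq> 1" and two: "(2 :: 'f::field) \<noteq> 0"
  shows "\<not> LinearCombinations.module.lin_dep ring_of_type_algebra (aw_algebra (q :: 'f)) (std_monomial q ` set hall_basis)"
proof -
  interpret M: Module.module "ring_of_type_algebra :: 'f ring" "aw_algebra q" by (rule module_aw_algebra)
  have closed: "std_monomial q T \<in> carrier (aw_algebra q)" for T
    by (simp add: aw_algebra_simps std_monomial_def)
  show ?thesis
  proof (rule M.finite_lin_indpt2)
    fix a assume "M.lincomb a (std_monomial q ` set hall_basis) = \<zero>\<^bsub>aw_algebra q\<^esub>"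
    then have "(\<Oplus>\<^bsub>aw_algebra q\<^esub>T\<in>set hall_basis. a (std_monomial q T) \<odot>\<^bsub>aw_algebra q\<^esub> std_monomial q T) = \<zero>\<^bsub>aw_algebra q\<^esub>"
      unfolding M.lincomb_def
      by (subst (asm) M.finsum_reindex[OF _ inj_on_std_monomial[OF assms]]) (auto simp: aw_algebra_simps std_monomial_def)
    then have "(\<Sum>T\<in>set hall_basis. const (a (std_monomial q T)) * lie_eval T) \<in> aw_ideal q"
      by (simp add: std_monomial_def aw_algebra_simps finsum_aw_proj aw_proj_eq_iff del: set_append)
    from hall_basis_independent_sum[OF assms this] have "a (std_monomial q T) = 0" if "T \<in> set hall_basis" for T
      using that by simp
    then show "\<forall>v\<in>std_monomial q ` set hall_basis. a v = \<zero>\<^bsub>ring_of_type_algebra\<^esub>"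
      by (auto simp: ring_of_type_algebra_simps)
  qed (use closed in auto)
qed

lemma std_monomial_in_span:
  assumes q: "q \<noteq> 0" "q ^ 4 \<noteq> 1" and two: "(2 :: 'f::field) \<noteq> 0"
    and T: "hall T" "lie_length T \<le> 5"
  shows "std_monomial q T \<in> LinearCombinations.module.span ring_of_type_algebra (aw_algebra (q :: 'f)) (std_monomial q ` set hall_basis)"
proof -
  interpret M: Module.module "ring_of_type_algebra :: 'f ring" "aw_algebra q" by (rule module_aw_algebra)
  let ?N = "M.span (std_monomial q ` set hall_basis)"
  have sub: "std_monomial q ` set hall_basis \<subseteq> carrier (aw_algebra q)"
    by (auto simp: aw_algebra_simps std_monomial_def)
  have N: "submodule ring_of_type_algebra ?N (aw_algebra q)"
    by (rule M.span_is_submodule[OF sub])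
  have basis: "std_monomial q T \<in> ?N" if "T \<in> set hall_basis" for T
    using M.in_own_span[OF sub] that by blast
  define s l where "s = q ^ 2" and "l = q ^ 3 - inverse q"
  have s0: "s \<noteq> 0" and s1: "s + 1 \<noteq> 0"
    using q by (auto simp: s_def power2_eq_square power4_eq_xxxx eq_neg_iff_add_eq_0[symmetric])
  let ?w = "left_normed" and ?b = "\<lambda>u v. Bracket (left_normed u) (left_normed v)"
  \<comment> \<open>Each omitted element needs three checks: its relation holds, its own coefficient
    is nonzero, and all other terms are retained elements. The last is decided by
    evaluation.\<close>
  have in_N: "std_monomial q T \<in> ?N"
    if rel: "\<And>f. aw_functional q f \<Longrightarrow> d * f (lie_eval T) = (\<Sum>(c, U)\<leftarrow>cs. c * f (lie_eval U))"
      and d: "d \<noteq> 0" and cs: "\<forall>U\<in>set (map snd cs). U \<in> set hall_basis" for d T cs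
    by (rule std_monomial_in_submodule[OF N aw_functional_relation[OF q rel] d])
      (use cs basis in force)+
  have "std_monomial q (?w [gB, gA, gA, gB, gC]) \<in> ?N"
  proof (rule in_N)
    fix f assume "aw_functional q f"
    then interpret F: aw_functional q f .
    show "2 * (s + 1) ^ 2 * f (lie_eval (?w [gB, gA, gA, gB, gC])) = (\<Sum>(c, U)\<leftarrow>
      [(2 * (s + 1) * l, ?w [gB, gA, gA, gA]), (- (2 * (s + 1) * l), ?w [gB, gA, gB, gB]),
       (- (2 * (s + 1) * l), ?w [gB, gA, gC, gC]), (2 * (s + 1) * l * 2, ?w [gC, gA, gB, gC]),
       (- (2 * s ^ 2 + 5 * s + 2), ?b [gB, gA, gA] [gC, gB]), (- (2 * s ^ 2 + 5 * s + 2), ?b [gB, gA, gB] [gC, gA]),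
       ((s ^ 2 + 3 * s + 1) * 2, ?b [gC, gA, gB] [gB, gA]), (- (s ^ 2 + 3 * s + 1), ?b [gB, gA, gC] [gB, gA])].
      c * f (lie_eval U))"
      using F.relation_BAABC unfolding F.s_def F.l_def s_def[symmetric] l_def[symmetric]
      by (simp add: algebra_simps power2_eq_square del: lie_eval.simps)
  qed (use two s1 in simp, code_simp)
  moreover have "std_monomial q (?b [gC, gB, gB] [gC, gA]) \<in> ?N"
  proof (rule in_N)
    fix f assume "aw_functional q f"
    then interpret F: aw_functional q f .
    show "s * f (lie_eval (?b [gC, gB, gB] [gC, gA])) = (\<Sum>(c, U)\<leftarrow>
      [(2 * (s + 1) * l, ?w [gB, gA, gA, gC]), (2 * (s + 1) * l, ?w [gC, gA, gA, gB]),
       (- (2 * (s + 1) * l), ?w [gC, gB, gB, gB]), (2 * (s + 1) * l, ?w [gC, gB, gC, gC]),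
       (- (3 * s ^ 2 + 5 * s + 3), ?b [gB, gA, gC] [gC, gB]), (s ^ 2 + 3 * s + 1, ?b [gC, gA, gB] [gC, gB]),
       (2 * s ^ 2 + 3 * s + 2, ?b [gC, gB, gC] [gB, gA]),
       (2 * (s + 1) ^ 2, ?w [gC, gA, gB, gB, gC]), (- (2 * (s + 1) ^ 2), ?w [gB, gA, gB, gC, gC])].
      c * f (lie_eval U))"
      using F.relation_CBB_CA unfolding F.s_def F.l_def s_def[symmetric] l_def[symmetric]
      by (simp add: algebra_simps power2_eq_square del: lie_eval.simps)
  qed (use s0 in simp, code_simp)
  moreover have "std_monomial q (?b [gC, gA, gA] [gC, gB]) \<in> ?N"
  proof (rule in_N)
    fix f assume "aw_functional q f"
    then interpret F: aw_functional q f .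
    show "s * f (lie_eval (?b [gC, gA, gA] [gC, gB])) = (\<Sum>(c, U)\<leftarrow>
      [(2 * (s + 1) * l * 2, ?w [gB, gA, gB, gC]), (- (2 * (s + 1) * l * 2), ?b [gC, gB] [gB, gA]),
       (2 * (s + 1) * l, ?w [gC, gA, gA, gA]), (- (2 * (s + 1) * l), ?w [gC, gA, gB, gB]),
       (- (2 * (s + 1) * l), ?w [gC, gA, gC, gC]), (- (2 * (s ^ 2 + 3 * s + 1)), ?b [gB, gA, gC] [gC, gA]),
       (s ^ 2 + 3 * s + 1, ?b [gC, gA, gB] [gC, gA]), (2 * s ^ 2 + 5 * s + 2, ?b [gC, gA, gC] [gB, gA]),
       (2 * (s + 1) ^ 2, ?w [gC, gA, gA, gB, gC])].
      c * f (lie_eval U))"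
      using F.relation_CAA_CB unfolding F.s_def F.l_def s_def[symmetric] l_def[symmetric]
      by (simp add: algebra_simps power2_eq_square del: lie_eval.simps)
  qed (use s0 in simp, code_simp)
  moreover have "std_monomial q (?b [gC, gA, gC] [gC, gB]) \<in> ?N"
  proof (rule in_N)
    fix f assume "aw_functional q f"
    then interpret F: aw_functional q f .
    show "1 * f (lie_eval (?b [gC, gA, gC] [gC, gB])) = (\<Sum>(c, U)\<leftarrow>
      [(1, ?b [gC, gB, gC] [gC, gA]), (1, ?b [gC, gA, gA] [gB, gA]), (- 1, ?b [gB, gA, gA] [gC, gA]),
       (1, ?b [gC, gB, gB] [gB, gA]), (- 1, ?b [gB, gA, gB] [gC, gB])].
      c * f (lie_eval U))"
      using F.relation_CAC_CB by (simp del: lie_eval.simps)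
  qed (simp, code_simp)
  ultimately show ?thesis
    using T basis[of T] unfolding set_hall_basis by blast
qed

theorem theorem7p14:
  fixes q :: "'f::alg_closed_field"
  assumes "CHAR('f) \<noteq> 2"
    and "q \<noteq> 0" and "q ^ 4 \<noteq> 1" and "q ^ 6 \<noteq> 1"
  shows "basis_family ring_of_type_algebra ((aw_lie q)\<lparr>carrier := aw_lie_upto q 5\<rparr>)
    (std_monomial q)
    ({t. hall t \<and> lie_length t \<le> 5}
      - {left_normed [gB, gA, gA, gB, gC],
         Bracket (left_normed [gC, gB, gB]) (left_normed [gC, gA]),
         Bracket (left_normed [gC, gA, gA]) (left_normed [gC, gB]),
         Bracket (left_normed [gC, gA, gC]) (left_normed [gC, gB])})"
proof -
  note q = assms(2,3)
  have two: "(2 :: 'f) \<noteq> 0"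
  proof
    assume "(2 :: 'f) = 0"
    then have "CHAR('f) dvd 2"
      using of_nat_eq_0_iff_char_dvd[of 2, where ?'a = 'f] by simp
    then have "CHAR('f) = 1 \<or> CHAR('f) = 2"
      using two_is_prime_nat prime_nat_iff by blast
    then show False using assms(1) by simp
  qed
  interpret M: vectorspace "ring_of_type_algebra :: 'f ring" "aw_algebra q"
    by (rule vectorspace_aw_algebra)
  let ?B = "std_monomial q ` set hall_basis" and ?H = "std_monomial q ` {t. hall t \<and> lie_length t \<le> 5}"
  have sub: "std_monomial q ` J \<subseteq> carrier (aw_algebra q)" for J
    by (auto simp: aw_algebra_simps std_monomial_def)
  have N: "submodule ring_of_type_algebra (M.span ?B) (aw_algebra q)"
    by (rule M.span_is_submodule[OF sub])
  have "?B \<subseteq> ?H"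
    unfolding set_hall_basis by blast
  moreover have "?H \<subseteq> M.span ?B"
    using std_monomial_in_span[OF q two] by blast
  ultimately have span: "M.span ?H = M.span ?B"
    using M.span_is_monotone[of ?B ?H] M.span_is_subset[of ?H "M.span ?B"] N by blast
  have lie: "aw_lie q = M.md (aw_lie_carrier q)"
    unfolding aw_lie_def aw_lie_carrier_def ..
  \<comment> \<open>L is a submodule containing all standard monomials, so the span taken in L is
    the span taken in the ambient algebra.\<close>
  have upto: "aw_lie_upto q 5 = M.span ?B"
    unfolding aw_lie_upto_def lie
    by (subst M.span_li_not_depend(1)[OF _ submodule_aw_lie_carrier])
      (use std_monomial_in_aw_lie_carrier span in auto)
  have md: "(aw_lie q)\<lparr>carrier := aw_lie_upto q 5\<rparr> = M.md (M.span ?B)"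
    unfolding lie upto by simp
  have own: "?B \<subseteq> M.span ?B"
    by (rule M.in_own_span[OF sub])
  interpret N: vectorspace "ring_of_type_algebra :: 'f ring" "M.md (M.span ?B)"
    unfolding vectorspace_def using M.submodule_is_module[OF N] field_from_type_algebra by blast
  have "N.basis ?B"
    unfolding N.basis_def M.span_li_not_depend[OF own N]
    using lin_indpt_std_monomial[OF q two] own by simp
  then show ?thesis
    unfolding basis_family_def md set_hall_basis[symmetric]
    using inj_on_std_monomial[OF q two] by blast
qed

end
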